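(* (1) If $X\in\Omega$ and $X=e_i(t)X'$ with $t>0$ and $X'\in U_{\ge0}$, then $X'\in\Omega$. (2) Each element of $\mathbb L_r$ has a unique factorization into factors which lie in $\Omega$, with possibly one factor which is a finite product of Chevalley generators. (3) If $X\in\Omega$ and $X=YZ$ with $Y\in\Omega$ and $Z\in U_{\ge0}$, then $Z$ is the identity matrix.
   Context: Elements of $GL_n(\mathbb R((t)))$ are identified with their unfoldings, the $\mathbb Z\times\mathbb Z$ matrices $(x_{i,j})$ with $x_{i+n,j+n}=x_{i,j}$ and $a_{ij}(t)=\sum_kx_{i,j+kn}t^k$. $U_{\ge0}$ is the set of upper-triangular unipotent elements with all finite minors nonnegative. The Chevalley generator $e_i(a)$, $i\in\mathbb Z/n\mathbb Z$, is the identity except for entries $a$ at positions $(kn+i,kn+i+1)$. For an infinite word $\mathbf i$ and $\mathbf a\in\ell^1_{>0}$ (positive sequences with finite sum), $e_{\mathbf i}(\mathbf a)=\lim_ke_{i_1}(a_1)\cdots e_{i_k}(a_k)$. $\Omega$ is the union of the images of $e_{\mathbf i}$ over all infinite reduced words $\mathbf i$ (words whose prefixes $s_{i_1}\cdots s_{i_k}$ have length $k$ in the affine symmetric group). $\mathbb L_r$ is the smallest subset of $U_{\ge0}$ containing all $e_i(a)$ ($a\ge0$) and closed under finite products and convergent right-infinite products $\prod_{k\ge1}Y_k=\lim_kY_1\cdots Y_k$. *)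

theory Defs
  imports Complex_Main "Jordan_Normal_Form.Determinant"
begin

section \<open>Unfolded upper-triangular unipotent loops\<close>

text \<open>
  A loop is represented by its unfolding, an \<open>n\<close>-periodic matrix with rows and columns indexed by
  the integers; the coefficient of \<open>t^k\<close> in the entry \<open>(i, j)\<close>, \<open>1 \<le> i, j \<le> n\<close>, of the folded
  matrix is \<open>X i (j + k n)\<close>.
\<close>

type_synonym zmat = "int \<Rightarrow> int \<Rightarrow> real"

definition zid :: zmat where
  "zid i j = (if i = j then 1 else 0)"

text \<open>
  Product of upper-triangular matrices: the summands with \<open>k\<close> outside \<open>{i..j}\<close> vanish.
  It is only ever applied to such matrices.
\<close>

definition zmult :: "zmat \<Rightarrow> zmat \<Rightarrow> zmat" (infixl "\<star>" 70) where
  "(X \<star> Y) i j = (\<Sum>k = i..j. X i k * Y k j)"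

definition zperiodic :: "nat \<Rightarrow> zmat \<Rightarrow> bool" where
  "zperiodic n X \<longleftrightarrow> (\<forall>i j. X (i + int n) (j + int n) = X i j)"

definition upper_unipotent :: "zmat \<Rightarrow> bool" where
  "upper_unipotent X \<longleftrightarrow> (\<forall>i. X i i = 1) \<and> (\<forall>i j. j < i \<longrightarrow> X i j = 0)"

text \<open>The minor with rows \<open>r 0 < \<dots> < r (k-1)\<close> and columns \<open>c 0 < \<dots> < c (k-1)\<close>.\<close>

definition minor :: "zmat \<Rightarrow> nat \<Rightarrow> (nat \<Rightarrow> int) \<Rightarrow> (nat \<Rightarrow> int) \<Rightarrow> real" where
  "minor X k r c = det (mat k k (\<lambda>(i, j). X (r i) (c j)))"

definition totally_nonneg :: "zmat \<Rightarrow> bool" where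
  "totally_nonneg X \<longleftrightarrow>
     (\<forall>k r c. strict_mono_on {..<k} r \<longrightarrow> strict_mono_on {..<k} c \<longrightarrow> 0 \<le> minor X k r c)"

text \<open>
  Periodic upper-triangular unipotent matrices are automatically unfoldings of invertible matrices:
  the folded matrix has power series entries and is unipotent at \<open>t = 0\<close>.
\<close>

definition U_nonneg :: "nat \<Rightarrow> zmat set" where
  "U_nonneg n = {X. zperiodic n X \<and> upper_unipotent X \<and> totally_nonneg X}"

text \<open>Here and below an integer \<open>i\<close> stands for its residue class modulo \<open>n\<close>.\<close>

definition chevalley :: "nat \<Rightarrow> int \<Rightarrow> real \<Rightarrow> zmat" where
  "chevalley n i a p q =
     (if p = q then 1 else if q = p + 1 \<and> p mod int n = i mod int n then a else 0)"

section \<open>Limits and infinite products\<close>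

text \<open>Limits of matrices are entrywise.\<close>

definition zmat_lim :: "(nat \<Rightarrow> zmat) \<Rightarrow> zmat \<Rightarrow> bool" where
  "zmat_lim S X \<longleftrightarrow> (\<forall>i j. (\<lambda>k. S k i j) \<longlonglongrightarrow> X i j)"

primrec partial_prod :: "(nat \<Rightarrow> zmat) \<Rightarrow> nat \<Rightarrow> zmat" where
  "partial_prod Y 0 = zid"
| "partial_prod Y (Suc k) = partial_prod Y k \<star> Y k"

definition has_right_inf_prod :: "(nat \<Rightarrow> zmat) \<Rightarrow> zmat \<Rightarrow> bool" where
  "has_right_inf_prod Y X \<longleftrightarrow> zmat_lim (partial_prod Y) X"

section \<open>The affine symmetric group and infinite reduced words\<close>

text \<open>Simple reflections act on the integers, exchanging \<open>i + k n\<close> and \<open>i + 1 + k n\<close> (for \<open>n \<ge> 2\<close>).\<close>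

definition simple_refl :: "nat \<Rightarrow> int \<Rightarrow> int \<Rightarrow> int" where
  "simple_refl n i p =
     (if p mod int n = i mod int n then p + 1
      else if p mod int n = (i + 1) mod int n then p - 1 else p)"

definition word_perm :: "nat \<Rightarrow> int list \<Rightarrow> int \<Rightarrow> int" where
  "word_perm n w = foldr (\<lambda>i f. simple_refl n i \<circ> f) w id"

definition affine_length :: "nat \<Rightarrow> (int \<Rightarrow> int) \<Rightarrow> nat" where
  "affine_length n x = (LEAST k. \<exists>w. length w = k \<and> word_perm n w = x)"

definition infinite_reduced_word :: "nat \<Rightarrow> (nat \<Rightarrow> int) \<Rightarrow> bool" where
  "infinite_reduced_word n w \<longleftrightarrow> (\<forall>k. affine_length n (word_perm n (map w [0..<k])) = k)"

section \<open>The sets \<open>\<Omega>\<close> and \<open>L_r\<close>\<close>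

definition l1_pos :: "(nat \<Rightarrow> real) set" where
  "l1_pos = {a. (\<forall>k. 0 < a k) \<and> summable a}"

definition Omega :: "nat \<Rightarrow> zmat set" where
  "Omega n = {X. \<exists>w a. infinite_reduced_word n w \<and> a \<in> l1_pos \<and>
                   has_right_inf_prod (\<lambda>k. chevalley n (w k) (a k)) X}"

definition L_r :: "nat \<Rightarrow> zmat set" where
  "L_r n = \<Inter>{S. S \<subseteq> U_nonneg n \<and>
                (\<forall>i a. 0 \<le> a \<longrightarrow> chevalley n i a \<in> S) \<and>
                (\<forall>X\<in>S. \<forall>Y\<in>S. X \<star> Y \<in> S) \<and>
                (\<forall>Y X. (\<forall>k. Y k \<in> S) \<longrightarrow> has_right_inf_prod Y X \<longrightarrow> X \<in> S)}"

definition finite_chevalley_products :: "nat \<Rightarrow> zmat set" where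
  "finite_chevalley_products n =
     {F. \<exists>m w a. (\<forall>k<m. 0 \<le> a k) \<and> F = partial_prod (\<lambda>k. chevalley n (w k) (a k)) m}"

section \<open>Transfinite factorizations\<close>

text \<open>
  Iterating right-infinite products yields products indexed by ordinals, here by a well-order \<open>r\<close>
  (smaller indices stand further left). \<open>P A\<close> is the product of the \<open>Y a\<close> over an initial
  segment \<open>A\<close> of \<open>r\<close>: the identity for empty \<open>A\<close>, multiplied by the next factor at successors,
  and the entrywise limit of the preceding partial products at nonempty \<open>A\<close> without maximum.
\<close>

definition wo_partial_prods :: "'a rel \<Rightarrow> ('a \<Rightarrow> zmat) \<Rightarrow> ('a set \<Rightarrow> zmat) \<Rightarrow> bool" where
  "wo_partial_prods r Y P \<longleftrightarrow>
     P {} = zid \<and>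
     (\<forall>a\<in>Field r. P (under r a) = P (underS r a) \<star> Y a) \<and>
     (\<forall>A. Order_Relation.ofilter r A \<longrightarrow> A \<noteq> {} \<longrightarrow> (\<forall>a\<in>A. \<exists>b\<in>A. a \<noteq> b \<and> (a, b) \<in> r) \<longrightarrow>
        (\<forall>i j. ((\<lambda>b. P (under r b) i j) \<longlongrightarrow> P A i j)
                 (INF a\<in>A. principal {b\<in>A. (a, b) \<in> r})))"

definition has_wo_prod :: "'a rel \<Rightarrow> ('a \<Rightarrow> zmat) \<Rightarrow> zmat \<Rightarrow> bool" where
  "has_wo_prod r Y X \<longleftrightarrow> (\<exists>P. wo_partial_prods r Y P \<and> P (Field r) = X)"

text \<open>
  The finite factor \<open>F\<close> stands last (\<open>F = zid\<close> meaning that it is absent): in any other position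
  it could be merged into the factor of \<open>\<Omega>\<close> to its right, so factorizations would not be unique.
\<close>

definition Omega_factorization ::
    "nat \<Rightarrow> 'a rel \<Rightarrow> ('a \<Rightarrow> zmat) \<Rightarrow> zmat \<Rightarrow> zmat \<Rightarrow> bool" where
  "Omega_factorization n r Y F X \<longleftrightarrow>
     Well_order r \<and> (\<forall>a\<in>Field r. Y a \<in> Omega n) \<and> F \<in> finite_chevalley_products n \<and>
     (\<exists>Z. has_wo_prod r Y Z \<and> X = Z \<star> F)"

definition same_factors :: "'a rel \<Rightarrow> ('a \<Rightarrow> zmat) \<Rightarrow> 'b rel \<Rightarrow> ('b \<Rightarrow> zmat) \<Rightarrow> bool" where
  "same_factors r Y r' Y' \<longleftrightarrow>
     (\<exists>f. BNF_Wellorder_Embedding.iso r r' f \<and> (\<forall>a\<in>Field r. Y' (f a) = Y a))"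

end

theory Submission
  imports Defs "HOL-Library.Countable"
begin

text \<open>
  Let \<open>\<mu>\<^sub>i(X)\<close> be the limit of the decreasing ratios \<open>x\<^sub>i\<^sub>j / x\<^sub>i\<^sub>+\<^sub>1\<^sub>,\<^sub>j\<close> as \<open>j \<rightarrow> \<infinity>\<close>. The entries of
  convergent products of Chevalley generators decay faster than any geometric sequence, so some
  \<open>\<mu>\<^sub>i\<close> vanishes. Hence, unless all of them vanish, there is a \<open>k\<close> with \<open>\<mu>\<^sub>k\<^sub>-\<^sub>1 = 0 < \<mu>\<^sub>k\<close>, and then
  \<open>e\<^sub>k(\<mu>\<^sub>k)\<close> divides \<open>X\<close> from the left with totally nonnegative quotient. Such greedy divisions form
  a confluent system: the limit of an infinite sequence of them depends on \<open>X\<close> only, and it does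
  not change when \<open>X\<close> is first divided by some \<open>e\<^sub>i(a)\<close>. Therefore \<open>\<Omega>\<close> consists of the matrices
  that infinitely many greedy divisions exhaust, the words of greedy divisions being reduced.
  For \<open>Y \<in> \<Omega>\<close> the matrices \<open>Y\<close> and \<open>Y Z\<close> have the same ratios, so the greedy quotients of \<open>Y Z\<close>
  converge to \<open>Z\<close>. Thus the leading factor in \<open>\<Omega>\<close> of a matrix is unique, and the transfinite
  factorization arises by splitting it off repeatedly and taking limits.
\<close>

section \<open>Determinants of kernels\<close>

text \<open>Total nonnegativity of quotients is not attacked directly. Division is controlled
  through minors with consecutive rows: adding a multiple of the next row affects such a minor
  through its last row alone, and a limit of Schur complements settles that row. Full total
  nonnegativity returns afterwards, because a matrix exhausted by greedy steps is a limit of finite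
  Chevalley products.

  The greedy process might stop at a matrix whose ratios all vanish, or converge to something other
  than the identity. Either outcome persists under division by any Chevalley factor, hence lies
  entrywise below every tail of an infinite product, and the tails tend to the identity. The
  delicate point is this persistence: the diamond of a braid relation closes only after two greedy
  steps. For infinite sequences the discrepancy is repeatedly a single factor, whose parameter is
  bounded by ratios tending to zero.

  Ordinals are avoided: the stages of repeated splitting form a Bourbaki-Witt tower, and every
  factorization runs through the same stages.\<close>

definition det_fun :: "nat \<Rightarrow> (nat \<Rightarrow> nat \<Rightarrow> real) \<Rightarrow> real" where
  "det_fun k f = det (mat k k (\<lambda>(i, j). f i j))"

lemma minor_det_fun: "minor X k r c = det_fun k (\<lambda>i j. X (r i) (c j))"
  by (simp add: minor_def det_fun_def)

lemma det_fun_expand: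
  "det_fun k f = (\<Sum>p | p permutes {0..<k}. signof p * (\<Prod>i = 0..<k. f i (p i)))"
proof -
  have "(\<Prod>i = 0..<k. mat k k (\<lambda>(i, j). f i j) $$ (i, p i)) = (\<Prod>i = 0..<k. f i (p i))"
    if "p permutes {0..<k}" for p
  proof (rule prod.cong)
    fix i assume "i \<in> {0..<k}"
    then have "p i < k" using that permutes_in_image[OF that] by auto
    then show "mat k k (\<lambda>(i, j). f i j) $$ (i, p i) = f i (p i)"
      using \<open>i \<in> {0..<k}\<close> by simp
  qed simp
  then show ?thesis
    unfolding det_fun_def by (subst det_def'[of _ k]) (auto intro!: sum.cong)
qed

lemma det_fun_cong:
  assumes "\<And>i j. i < k \<Longrightarrow> j < k \<Longrightarrow> f i j = g i j"
  shows "det_fun k f = det_fun k g"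
  unfolding det_fun_def by (rule arg_cong[of _ _ det]) (rule cong_mat, auto simp: assms)

lemma det_fun_linear_row:
  assumes "i < k"
  shows "det_fun k (\<lambda>l c. if l = i then u c + t * v c else f l c) =
    det_fun k (\<lambda>l c. if l = i then u c else f l c) +
    t * det_fun k (\<lambda>l c. if l = i then v c else f l c)"
proof -
  have split: "(\<Prod>l = 0..<k. if l = i then w (p l) else f l (p l)) =
      w (p i) * (\<Prod>l \<in> {0..<k} - {i}. f l (p l))" for w and p :: "nat \<Rightarrow> nat"
    using assms by (subst prod.remove[of _ i]) (auto intro!: prod.cong)
  show ?thesis
    unfolding det_fun_expand sum_distrib_left
    unfolding split[of u] split[of v] split[of "\<lambda>c. u c + t * v c"]
    by (subst sum.distrib[symmetric], rule sum.cong) (simp_all add: algebra_simps)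
qed

lemma det_fun_equal_rows:
  assumes "i \<noteq> j" "i < k" "j < k" and "\<And>c. c < k \<Longrightarrow> f i c = f j c"
  shows "det_fun k f = 0"
  unfolding det_fun_def
  by (rule det_identical_rows[OF _ assms(1-3)]) (auto simp: assms intro!: eq_vecI)

lemma det_fun_transpose: "det_fun k (\<lambda>i j. f j i) = det_fun k f"
proof -
  have "mat k k (\<lambda>(i, j). f j i) = transpose_mat (mat k k (\<lambda>(i, j). f i j))"
    by (rule eq_matI) auto
  then show ?thesis
    unfolding det_fun_def by (simp add: det_transpose[of _ k])
qed

lemma det_fun_zero_row:
  assumes "i < k" and "\<And>c. c < k \<Longrightarrow> f i c = 0"
  shows "det_fun k f = 0"
proof -
  have "(\<Prod>l = 0..<k. f l (p l)) = 0" if "p permutes {0..<k}" for p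
  proof -
    have "p i < k" using assms(1) permutes_in_image[OF that, of i] by auto
    then show ?thesis using assms by (intro prod_zero bexI[of _ i]) auto
  qed
  then show ?thesis unfolding det_fun_expand by (intro sum.neutral) auto
qed

lemma det_fun_zero_col:
  assumes "j < k" and "\<And>l. l < k \<Longrightarrow> f l j = 0"
  shows "det_fun k f = 0"
  using det_fun_zero_row[of j k "\<lambda>i j. f j i"] assms unfolding det_fun_transpose[of k f] by blast

lemma tendsto_det_fun:
  assumes "\<And>i j. i < k \<Longrightarrow> j < k \<Longrightarrow> ((\<lambda>x. f x i j) \<longlongrightarrow> g i j) F"
  shows "((\<lambda>x. det_fun k (f x)) \<longlongrightarrow> det_fun k g) F"
  unfolding det_fun_expand
proof (intro tendsto_sum tendsto_mult tendsto_const tendsto_prod)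
  fix p i assume "p \<in> {p. p permutes {0..<k}}" "i \<in> {0..<k}"
  then show "((\<lambda>x. f x i (p i)) \<longlongrightarrow> g i (p i)) F"
    using permutes_in_image[of p "{0..<k}" i] by (intro assms) auto
qed

text \<open>Working from the top, the row below is still unchanged when its multiple is added, so
  each step is an elementary row operation.\<close>

lemma det_fun_add_next_rows:
  "det_fun m (\<lambda>l c. f l c + (if Suc l < m then s l * f (Suc l) c else 0)) = det_fun m f"
proof -
  have "det_fun m (\<lambda>l c. if l < t then f l c + s l * f (Suc l) c else f l c) = det_fun m f"
    if "t < m \<or> t = 0" for t
    using that
  proof (induction t)
    case (Suc t)
    then have t: "Suc t < m" by auto
    have "det_fun m (\<lambda>l c. if l < Suc t then f l c + s l * f (Suc l) c else f l c) =
      det_fun m (\<lambda>l c. if l = t then f t c + s t * f (Suc t) c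
        else if l < t then f l c + s l * f (Suc l) c else f l c)"
      by (rule det_fun_cong) auto
    also have "\<dots> = det_fun m (\<lambda>l c. if l = t then f t c
          else if l < t then f l c + s l * f (Suc l) c else f l c) +
        s t * det_fun m (\<lambda>l c. if l = t then f (Suc t) c
          else if l < t then f l c + s l * f (Suc l) c else f l c)"
      using t by (intro det_fun_linear_row) auto
    also have "det_fun m (\<lambda>l c. if l = t then f (Suc t) c
          else if l < t then f l c + s l * f (Suc l) c else f l c) = 0"
      using t by (intro det_fun_equal_rows[of t "Suc t"]) auto
    also have "det_fun m (\<lambda>l c. if l = t then f t c
          else if l < t then f l c + s l * f (Suc l) c else f l c) =
        det_fun m (\<lambda>l c. if l < t then f l c + s l * f (Suc l) c else f l c)"
      by (rule det_fun_cong) auto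
    finally show ?case using Suc t by auto
  qed simp
  from this[of "m - 1"]
  have "det_fun m (\<lambda>l c. if l < m - 1 then f l c + s l * f (Suc l) c else f l c) = det_fun m f"
    by (cases m) auto
  moreover have "det_fun m (\<lambda>l c. f l c + (if Suc l < m then s l * f (Suc l) c else 0)) =
    det_fun m (\<lambda>l c. if l < m - 1 then f l c + s l * f (Suc l) c else f l c)"
    by (rule det_fun_cong) (simp add: less_diff_conv)
  ultimately show ?thesis by simp
qed

text \<open>Schur complement of the lower right corner: the pivot clears the last column above it,
  and expansion along that column leaves one term.\<close>

lemma det_fun_schur:
  assumes "f m m \<noteq> 0"
  shows "det_fun (Suc m) f = f m m * det_fun m (\<lambda>l c. f l c - f l m / f m m * f m c)"
proof -
  define h where "h t = (\<lambda>l c. if l < t then f l c - f l m / f m m * f m c else f l c)" for t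
  have "det_fun (Suc m) (h t) = det_fun (Suc m) f" if "t \<le> m" for t
    using that
  proof (induction t)
    case 0
    show ?case by (rule det_fun_cong) (simp add: h_def)
  next
    case (Suc t)
    have "det_fun (Suc m) (h (Suc t)) = det_fun (Suc m)
        (\<lambda>l c. if l = t then f t c + (- (f t m / f m m)) * f m c else h t l c)"
      by (rule det_fun_cong) (auto simp: h_def)
    also have "\<dots> = det_fun (Suc m) (\<lambda>l c. if l = t then f t c else h t l c) +
        (- (f t m / f m m)) * det_fun (Suc m) (\<lambda>l c. if l = t then f m c else h t l c)"
      using Suc by (intro det_fun_linear_row) auto
    also have "det_fun (Suc m) (\<lambda>l c. if l = t then f m c else h t l c) = 0"
      using Suc by (intro det_fun_equal_rows[of t m]) (auto simp: h_def)
    also have "det_fun (Suc m) (\<lambda>l c. if l = t then f t c else h t l c) = det_fun (Suc m) (h t)"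
      by (rule det_fun_cong) (auto simp: h_def)
    finally show ?case using Suc by simp
  qed
  then have "det_fun (Suc m) f = det_fun (Suc m) (h m)" by simp
  also have "\<dots> = f m m * det_fun m (\<lambda>l c. f l c - f l m / f m m * f m c)"
  proof -
    let ?A = "mat (Suc m) (Suc m) (\<lambda>(i, j). h m i j)"
    have "det ?A = (\<Sum>i<Suc m. ?A $$ (i, m) * cofactor ?A i m)"
      by (rule laplace_expansion_column) auto
    also have "\<dots> = ?A $$ (m, m) * cofactor ?A m m + (\<Sum>i<m. ?A $$ (i, m) * cofactor ?A i m)"
      by simp
    also have "(\<Sum>i<m. ?A $$ (i, m) * cofactor ?A i m) = 0"
      using assms by (intro sum.neutral) (auto simp: h_def)
    also have "cofactor ?A m m = det (mat m m (\<lambda>(l, c). f l c - f l m / f m m * f m c))"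
      unfolding cofactor_def mat_delete_def
      by (simp add: power_add[symmetric] mult_2[symmetric] h_def del: power_add)
        (intro arg_cong[of _ _ det] cong_mat, auto)
    finally show ?thesis by (simp add: det_fun_def h_def)
  qed
  finally show ?thesis .
qed

lemma strict_mono_on_lessThanI:
  fixes r :: "nat \<Rightarrow> int"
  assumes "\<And>l. Suc l < k \<Longrightarrow> r l < r (Suc l)"
  shows "strict_mono_on {..<k} r"
proof (rule strict_mono_onI)
  fix x y assume "x \<in> {..<k}" "y \<in> {..<k}" "x < y"
  have "x < y \<Longrightarrow> y < k \<Longrightarrow> r x < r y" for y
  proof (induction y)
    case (Suc y)
    then show ?case using assms[of y] by (cases "x = y") auto
  qed simp
  then show "r x < r y" using \<open>y \<in> {..<k}\<close> \<open>x < y\<close> by simp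
qed


section \<open>Closure properties of total nonnegativity\<close>

lemma minor_weakly_increasing_rows:
  assumes "totally_nonneg G" "strict_mono_on {..<k} c" and "\<And>l. Suc l < k \<Longrightarrow> r l \<le> r (Suc l)"
  shows "0 \<le> minor G k r c"
proof (cases "\<exists>l. Suc l < k \<and> r l = r (Suc l)")
  case True
  then obtain l where "Suc l < k" "r l = r (Suc l)" by blast
  then have "minor G k r c = 0"
    unfolding minor_det_fun by (intro det_fun_equal_rows[of l "Suc l"]) auto
  then show ?thesis by simp
next
  case False
  then have "strict_mono_on {..<k} r"
    using assms(3) by (intro strict_mono_on_lessThanI) (auto simp: less_le simp del: Suc_le_eq)
  then show ?thesis using assms(1,2) by (simp add: totally_nonneg_def)
qed

text \<open>Multilinear expansion turns each row into \<open>r l\<close> or \<open>r l + s\<close>.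
  Since strictly increasing integers move by one step in a common direction, the chosen rows stay
  weakly increasing, and each term is a nonnegative minor or has two equal rows. The sign
  \<open>s = -1\<close> serves right multiplication, after transposing.\<close>

lemma totally_nonneg_row_op:
  fixes s :: int
  assumes G: "totally_nonneg G" and s: "\<bar>s\<bar> = 1" and a: "\<And>p. 0 \<le> a p"
  shows "totally_nonneg (\<lambda>p q. G p q + a p * G (p + s) q)"
  unfolding totally_nonneg_def
proof (intro allI impI)
  fix k and r c :: "nat \<Rightarrow> int"
  assume r: "strict_mono_on {..<k} r" and c: "strict_mono_on {..<k} c"
  \<comment> \<open>The rows before \<open>m\<close> have been expanded, with choices
    \<open>r'\<close>; the others still carry the sum.\<close>
  define H where "H m r' = (\<lambda>l j. if l < m then G (r' l) (c j)
    else G (r l) (c j) + a (r l) * G (r l + s) (c j))" for m :: nat and r'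
  have "0 \<le> det_fun k (H m r')"
    if "m \<le> k" "\<And>l. l < m \<Longrightarrow> r' l \<in> {r l, r l + s}" for m r'
    using that
  proof (induction "k - m" arbitrary: m r')
    case 0
    then have [simp]: "m = k" by simp
    have "r' l \<le> r' (Suc l)" if "Suc l < k" for l
      using 0(3)[of l] 0(3)[of "Suc l"] strict_mono_onD[OF r, of l "Suc l"] s that by auto
    then have "0 \<le> minor G k r' c" by (intro minor_weakly_increasing_rows G c)
    also have "minor G k r' c = det_fun k (H m r')"
      unfolding minor_det_fun by (rule det_fun_cong) (simp add: H_def)
    finally show ?case .
  next
    case (Suc d)
    have m: "m < k" using Suc(2) by simp
    have split: "det_fun k (\<lambda>l j. if l = m then G x (c j) else H m r' l j) =
        det_fun k (H (Suc m) (r'(m := x)))" for x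
      by (rule det_fun_cong) (auto simp: H_def)
    have "det_fun k (H m r') = det_fun k
       (\<lambda>l j. if l = m then G (r m) (c j) + a (r m) * G (r m + s) (c j) else H m r' l j)"
      by (rule det_fun_cong) (auto simp: H_def)
    also have "\<dots> = det_fun k (H (Suc m) (r'(m := r m))) +
        a (r m) * det_fun k (H (Suc m) (r'(m := r m + s)))"
      unfolding det_fun_linear_row[OF m] split ..
    also have "\<dots> \<ge> 0"
      using Suc.hyps(2) Suc.prems m a
      by (intro add_nonneg_nonneg mult_nonneg_nonneg Suc.hyps(1)) (auto simp: less_Suc_eq)
    finally show ?case .
  qed
  from this[of 0] show "0 \<le> minor (\<lambda>p q. G p q + a p * G (p + s) q) k r c"
    by (simp add: minor_det_fun H_def)
qed

lemma totally_nonneg_transpose: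
  assumes "totally_nonneg G" shows "totally_nonneg (\<lambda>p q. G q p)"
proof -
  have "minor (\<lambda>p q. G q p) k r c = minor G k c r" for k r c
    unfolding minor_det_fun by (rule det_fun_transpose[of k "\<lambda>i j. G (c i) (r j)"])
  then show ?thesis using assms by (simp add: totally_nonneg_def)
qed

text \<open>If the row and column sets differ, the smaller index at the first discrepancy is missing
  from the other set, which gives a zero row or a zero column.\<close>

lemma totally_nonneg_zid: "totally_nonneg zid"
  unfolding totally_nonneg_def
proof (intro allI impI)
  fix k and r c :: "nat \<Rightarrow> int"
  assume r: "strict_mono_on {..<k} r" and c: "strict_mono_on {..<k} c"
  have neq: "u l \<noteq> v j"
    if u: "strict_mono_on {..<k} u" and v: "strict_mono_on {..<k} v"
      and l: "l < k" "u l < v l" and min: "\<And>j. j < l \<Longrightarrow> u j = v j" and j: "j < k"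
    for l j and u v :: "nat \<Rightarrow> int"
  proof (cases "j < l")
    case True
    then show ?thesis using strict_mono_onD[OF u, of j l] min[of j] l by auto
  next
    case False
    then have "v l \<le> v j" using strict_mono_onD[OF v, of l j] j l by (cases "l = j") auto
    then show ?thesis using l by simp
  qed
  show "0 \<le> minor zid k r c"
  proof (cases "\<forall>l<k. r l = c l")
    case True
    have "minor zid k r c = det_fun k (\<lambda>i j. if i = j then 1 else 0)"
      unfolding minor_det_fun using True strict_mono_on_imp_inj_on[OF r]
      by (intro det_fun_cong) (auto simp: zid_def inj_on_def)
    also have "\<dots> = det (1\<^sub>m k)" by (simp add: det_fun_def one_mat_def)
    finally show ?thesis by simp
  next
    case False
    define l where "l = (LEAST l. l < k \<and> r l \<noteq> c l)"
    have l: "l < k" "r l \<noteq> c l"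
      using False LeastI_ex[of "\<lambda>l. l < k \<and> r l \<noteq> c l"] by (auto simp: l_def)
    have min: "r j = c j" if "j < l" for j
      using not_less_Least[of j "\<lambda>l. l < k \<and> r l \<noteq> c l"] that l by (auto simp: l_def)
    have "minor zid k r c = 0"
    proof (cases "r l < c l")
      case True
      then show ?thesis unfolding minor_det_fun
        using neq[OF r c l(1) True min] l by (intro det_fun_zero_row[of l]) (auto simp: zid_def)
    next
      case False
      then have "c l < r l" using l by simp
      then show ?thesis unfolding minor_det_fun
        using neq[OF c r l(1) _ min[symmetric]] l
        by (intro det_fun_zero_col[of l]) (fastforce simp: zid_def)+
    qed
    then show ?thesis by simp
  qed
qed

lemma totally_nonneg_limit:
  assumes "\<And>i j. ((\<lambda>b. S b i j) \<longlongrightarrow> X i j) F" "F \<noteq> bot" "eventually (\<lambda>b. totally_nonneg (S b)) F"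
  shows "totally_nonneg X"
  unfolding totally_nonneg_def
proof (intro allI impI)
  fix k and r c :: "nat \<Rightarrow> int"
  assume rc: "strict_mono_on {..<k} r" "strict_mono_on {..<k} c"
  have "((\<lambda>b. minor (S b) k r c) \<longlongrightarrow> minor X k r c) F"
    unfolding minor_det_fun by (intro tendsto_det_fun assms(1))
  moreover have "eventually (\<lambda>b. 0 \<le> minor (S b) k r c) F"
    using assms(3) by eventually_elim (use rc in \<open>simp add: totally_nonneg_def\<close>)
  ultimately show "0 \<le> minor X k r c"
    by (rule tendsto_lowerbound) (rule assms(2))
qed

section \<open>The product of upper-triangular matrices\<close>

lemma zmult_assoc: "(X \<star> Y) \<star> Z = X \<star> (Y \<star> Z)"
proof (intro ext)
  fix i j
  have "((X \<star> Y) \<star> Z) i j = (\<Sum>k = i..j. \<Sum>l | l \<in> {i..j} \<and> l \<le> k. X i l * Y l k * Z k j)"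
    unfolding zmult_def sum_distrib_right by (intro sum.cong refl) auto
  also have "\<dots> = (\<Sum>l = i..j. \<Sum>k | k \<in> {i..j} \<and> l \<le> k. X i l * Y l k * Z k j)"
    by (rule sum.swap_restrict) auto
  also have "\<dots> = (X \<star> (Y \<star> Z)) i j"
    unfolding zmult_def sum_distrib_left by (intro sum.cong refl) (auto simp: mult.assoc)
  finally show "((X \<star> Y) \<star> Z) i j = (X \<star> (Y \<star> Z)) i j" .
qed

lemma upper_unipotent_diag [simp]: "upper_unipotent X \<Longrightarrow> X i i = 1"
  and upper_unipotent_lower: "upper_unipotent X \<Longrightarrow> j < i \<Longrightarrow> X i j = 0"
  by (auto simp: upper_unipotent_def)

lemma upper_unipotent_zid [simp]: "upper_unipotent zid"
  by (simp add: upper_unipotent_def zid_def)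

lemma zmult_lower: "j < i \<Longrightarrow> (X \<star> Y) i j = 0"
  by (simp add: zmult_def)

lemma zid_zmult [simp]: assumes "upper_unipotent X" shows "zid \<star> X = X"
proof (intro ext)
  fix i j
  have "(zid \<star> X) i j = (\<Sum>k = i..j. if k = i then X k j else 0)"
    unfolding zmult_def zid_def by (intro sum.cong) auto
  then show "(zid \<star> X) i j = X i j"
    using upper_unipotent_lower[OF assms] by (simp add: sum.delta)
qed

lemma zmult_zid [simp]: assumes "upper_unipotent X" shows "X \<star> zid = X"
proof (intro ext)
  fix i j
  have "(X \<star> zid) i j = (\<Sum>k = i..j. if k = j then X i k else 0)"
    unfolding zmult_def zid_def by (intro sum.cong) auto
  then show "(X \<star> zid) i j = X i j"
    using upper_unipotent_lower[OF assms] by (simp add: sum.delta)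
qed

lemma upper_unipotent_zmult [simp]:
  "upper_unipotent X \<Longrightarrow> upper_unipotent Y \<Longrightarrow> upper_unipotent (X \<star> Y)"
  by (simp add: upper_unipotent_def zmult_def)

text \<open>The superdiagonal is an additive invariant: it yields summability of the parameters and
  shows that no factor in \<Omega> acts trivially.\<close>

lemma zmult_superdiag:
  assumes "upper_unipotent X" "upper_unipotent Y"
  shows "(X \<star> Y) i (i + 1) = X i (i + 1) + Y i (i + 1)"
proof -
  have "{i..i + 1} = {i, i + 1}" by auto
  then show ?thesis using assms by (simp add: zmult_def)
qed

text \<open>Back substitution gives a right inverse that is again upper unipotent, hence two-sided.
  The recursion on \<open>j - i\<close> also makes it entrywise continuous.\<close>

function zinv :: "zmat \<Rightarrow> zmat" where
  "zinv X i j = (if j < i then 0 else if i = j then 1 else - (\<Sum>k = i + 1..j. X i k * zinv X k j))"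
  by auto
termination by (relation "measure (\<lambda>(X, i, j). nat (j - i))") auto

declare zinv.simps [simp del]

lemma upper_unipotent_zinv [simp]: "upper_unipotent (zinv X)"
  by (simp add: upper_unipotent_def zinv.simps)

lemma zmult_zinv [simp]: assumes "upper_unipotent X" shows "X \<star> zinv X = zid"
proof (intro ext)
  fix i j
  have "(X \<star> zinv X) i j = zinv X i j + (\<Sum>k = i + 1..j. X i k * zinv X k j)" if "i < j"
  proof -
    have "{i..j} = insert i {i + 1..j}" using that by auto
    then show ?thesis using assms by (simp add: zmult_def)
  qed
  then show "(X \<star> zinv X) i j = zid i j"
    by (cases i j rule: linorder_cases)
      (use assms in \<open>auto simp: zmult_def zid_def zinv.simps[of X i j]\<close>)
qed

lemma zinv_zmult [simp]: assumes "upper_unipotent X" shows "zinv X \<star> X = zid"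
proof -
  have "zinv X \<star> X = (zinv X \<star> X) \<star> (zinv X \<star> zinv (zinv X))"
    using assms by simp
  also have "\<dots> = zinv X \<star> (X \<star> zinv X) \<star> zinv (zinv X)" by (simp only: zmult_assoc)
  also have "\<dots> = zid" using assms by simp
  finally show ?thesis .
qed

lemma zmult_left_cancel:
  assumes "upper_unipotent P" "upper_unipotent X" "upper_unipotent Y" "P \<star> X = P \<star> Y"
  shows "X = Y"
proof -
  have "X = zinv P \<star> (P \<star> X)" using assms(1-3) by (simp add: zmult_assoc[symmetric])
  also have "\<dots> = zinv P \<star> (P \<star> Y)" by (simp only: assms(4))
  also have "\<dots> = Y" using assms(1-3) by (simp add: zmult_assoc[symmetric])
  finally show ?thesis .
qed

lemma zmult_right_cancel:
  assumes "upper_unipotent P" "upper_unipotent X" "upper_unipotent Y" "X \<star> P = Y \<star> P"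
  shows "X = Y"
proof -
  have "X = (X \<star> P) \<star> zinv P" using assms(1-3) by (simp add: zmult_assoc)
  also have "\<dots> = (Y \<star> P) \<star> zinv P" by (simp only: assms(4))
  also have "\<dots> = Y" using assms(1-3) by (simp add: zmult_assoc)
  finally show ?thesis .
qed

lemma zperiodic_zmult: assumes "zperiodic n X" "zperiodic n Y" shows "zperiodic n (X \<star> Y)"
  unfolding zperiodic_def
proof (intro allI)
  fix i j
  have "(X \<star> Y) (i + int n) (j + int n) =
      (\<Sum>k = i..j. X (i + int n) (k + int n) * Y (k + int n) (j + int n))"
    unfolding zmult_def
    by (rule sum.reindex_bij_witness[of _ "\<lambda>k. k + int n" "\<lambda>k. k - int n"]) auto
  then show "(X \<star> Y) (i + int n) (j + int n) = (X \<star> Y) i j"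
    using assms by (simp add: zmult_def zperiodic_def)
qed

lemma zperiodic_shift: assumes "zperiodic n X" shows "X (i + m * int n) (j + m * int n) = X i j"
proof (induction m rule: int_induct[where k = 0])
  case (step1 m)
  have "X (i + (m + 1) * int n) (j + (m + 1) * int n) = X (i + m * int n) (j + m * int n)"
    using assms[unfolded zperiodic_def, rule_format, of "i + m * int n" "j + m * int n"]
    by (simp add: algebra_simps)
  then show ?case using step1 by simp
next
  case (step2 m)
  have "X (i + (m - 1) * int n) (j + (m - 1) * int n) = X (i + m * int n) (j + m * int n)"
    using assms[unfolded zperiodic_def, rule_format, of "i + (m - 1) * int n" "j + (m - 1) * int n"]
    by (simp add: algebra_simps)
  then show ?case using step2 by simp
qed simp

lemma zperiodic_zid [simp]: "zperiodic n zid"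
  by (simp add: zperiodic_def zid_def)

lemma zmult_mono:
  assumes "\<And>i j. 0 \<le> X i j" "\<And>i j. 0 \<le> Y i j" "X \<le> X'" "Y \<le> Y'"
  shows "X \<star> Y \<le> X' \<star> Y'"
  unfolding le_fun_def zmult_def
proof (intro allI sum_mono mult_mono)
  fix i k show "0 \<le> X' i k" using assms(1)[of i k] assms(3) by (auto simp: le_fun_def intro: order_trans)
qed (use assms in \<open>auto simp: le_fun_def\<close>)

lemma zid_le: "upper_unipotent X \<Longrightarrow> (\<And>i j. 0 \<le> X i j) \<Longrightarrow> zid \<le> X"
  by (auto simp: le_fun_def zid_def)

lemma tendsto_zmult:
  assumes "\<And>i j. ((\<lambda>b. S b i j) \<longlongrightarrow> X i j) F" "\<And>i j. ((\<lambda>b. T b i j) \<longlongrightarrow> Y i j) F"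
  shows "((\<lambda>b. (S b \<star> T b) i j) \<longlongrightarrow> (X \<star> Y) i j) F"
  unfolding zmult_def by (intro tendsto_sum tendsto_mult assms)

lemma tendsto_zinv:
  assumes "\<And>i j. ((\<lambda>b. S b i j) \<longlongrightarrow> X i j) F"
  shows "((\<lambda>b. zinv (S b) i j) \<longlongrightarrow> zinv X i j) F"
proof (induction "nat (j - i)" arbitrary: i rule: less_induct)
  case less
  show ?case
  proof (cases "i < j")
    case True
    then have step: "zinv W i j = - (\<Sum>k = i + 1..j. W i k * zinv W k j)" for W
      by (subst zinv.simps) simp
    have "((\<lambda>b. - (\<Sum>k = i + 1..j. S b i k * zinv (S b) k j)) \<longlongrightarrow>
        - (\<Sum>k = i + 1..j. X i k * zinv X k j)) F"
    proof (intro tendsto_minus tendsto_sum tendsto_mult assms)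
      fix k assume "k \<in> {i + 1..j}"
      then show "((\<lambda>b. zinv (S b) k j) \<longlongrightarrow> zinv X k j) F" by (intro less) auto
    qed
    then show ?thesis by (simp only: step)
  next
    case False
    then have "zinv W i j = (if j < i then 0 else 1)" for W
      by (subst zinv.simps) simp
    then show ?thesis by simp
  qed
qed

section \<open>Row operations and total nonnegativity\<close>

lemma det_fun_1: "det_fun (Suc 0) f = f 0 0"
  unfolding det_fun_def by (subst det_single) auto

lemma det_fun_2: "det_fun 2 f = f 0 0 * f 1 1 - f 0 1 * f 1 0"
proof -
  let ?A = "mat 2 2 (\<lambda>(i, j). f i j)"
  have "det ?A = (\<Sum>i<2. ?A $$ (i, 0) * cofactor ?A i 0)"
    by (rule laplace_expansion_column) auto
  then show ?thesis
    unfolding det_fun_def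
    by (simp add: numeral_2_eq_2 cofactor_def mat_delete_def det_single)
qed

text \<open>Minors with consecutive rows are the ones that a row operation with the next row changes
  in a controlled way, and they already make the ratios of neighbouring rows monotone.\<close>

definition solid_nonneg :: "zmat \<Rightarrow> bool" where
  "solid_nonneg X \<longleftrightarrow>
     (\<forall>b k c. strict_mono_on {..<k} c \<longrightarrow> 0 \<le> minor X k (\<lambda>l. b + int l) c)"

lemma totally_nonneg_solid: "totally_nonneg X \<Longrightarrow> solid_nonneg X"
  by (auto simp: totally_nonneg_def solid_nonneg_def strict_mono_on_def)

lemma solid_nonneg_entry: assumes "solid_nonneg X" shows "0 \<le> X i j"
proof -
  have "strict_mono_on {..<Suc 0} (\<lambda>_. j)" by (rule strict_mono_onI) auto
  then have "0 \<le> minor X (Suc 0) (\<lambda>l. i + int l) (\<lambda>_. j)"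
    using assms unfolding solid_nonneg_def by blast
  then show ?thesis by (simp add: minor_det_fun det_fun_1)
qed

lemma strict_mono_on_pair:
  fixes p q :: int
  assumes "p < q" shows "strict_mono_on {..<2} (\<lambda>l::nat. if l = 0 then p else q)"
  by (rule strict_mono_onI) (use assms in auto)

lemma solid_nonneg_2:
  assumes "solid_nonneg X" "p < q" shows "X i q * X (i + 1) p \<le> X i p * X (i + 1) q"
proof -
  have "0 \<le> minor X 2 (\<lambda>l. i + int l) (\<lambda>l. if l = 0 then p else q)"
    using assms(1) unfolding solid_nonneg_def using strict_mono_on_pair[OF assms(2)] by blast
  then show ?thesis by (simp add: minor_det_fun det_fun_2)
qed

lemma totally_nonneg_2:
  assumes "totally_nonneg X" "i < j" "p < q" shows "X i q * X j p \<le> X i p * X j q"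
proof -
  have "0 \<le> minor X 2 (\<lambda>l. if l = 0 then i else j) (\<lambda>l. if l = 0 then p else q)"
    using assms(1) unfolding totally_nonneg_def
    using strict_mono_on_pair[OF assms(2)] strict_mono_on_pair[OF assms(3)] by blast
  then show ?thesis by (simp add: minor_det_fun det_fun_2)
qed

lemma U_nonnegD:
  assumes "X \<in> U_nonneg n"
  shows "zperiodic n X" "upper_unipotent X" "totally_nonneg X" "solid_nonneg X" "0 \<le> X i j"
  using assms totally_nonneg_solid solid_nonneg_entry by (auto simp: U_nonneg_def)

text \<open>This is the minor with rows \<open>i\<close>, \<open>j\<close> and columns
  \<open>j\<close>, \<open>k\<close>, whose remaining entry is \<open>X j j = 1\<close>.\<close>

lemma U_nonneg_submult:
  assumes "X \<in> U_nonneg n" "i \<le> j" "j \<le> k" shows "X i k \<le> X i j * X j k"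
proof (cases "i < j \<and> j < k")
  case True
  then show ?thesis
    using totally_nonneg_2[OF U_nonnegD(3)[OF assms(1)], of i j j k] U_nonnegD(2)[OF assms(1)] by simp
qed (use assms U_nonnegD(2)[OF assms(1)] in auto)

lemma U_nonneg_limit:
  assumes lim: "\<And>i j. ((\<lambda>b. S b i j) \<longlongrightarrow> X i j) F" and F: "F \<noteq> bot"
    and ev: "eventually (\<lambda>b. S b \<in> U_nonneg n) F"
  shows "X \<in> U_nonneg n"
proof -
  have eq: "f = g" if "(h \<longlongrightarrow> f) F" "(h' \<longlongrightarrow> g) F" "eventually (\<lambda>b. h b = h' b) F"
    for f g :: real and h h'
    using that F by (metis tendsto_cong tendsto_unique)
  have "X (i + int n) (j + int n) = X i j" for i j
    by (rule eq[OF lim lim], use ev in eventually_elim) (auto simp: U_nonneg_def zperiodic_def)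
  moreover have "X i i = 1" for i
    by (rule eq[OF lim tendsto_const], use ev in eventually_elim) (auto simp: U_nonneg_def)
  moreover have "X i j = 0" if "j < i" for i j
    by (rule eq[OF lim tendsto_const], use ev in eventually_elim)
      (use that in \<open>auto simp: U_nonneg_def upper_unipotent_lower\<close>)
  moreover have "totally_nonneg X"
    by (rule totally_nonneg_limit[OF lim F], use ev in eventually_elim) (simp add: U_nonneg_def)
  ultimately show ?thesis by (simp add: U_nonneg_def zperiodic_def upper_unipotent_def)
qed

lemma zid_U_nonneg: "zid \<in> U_nonneg n"
  by (simp add: U_nonneg_def totally_nonneg_zid)

text \<open>Says that the entries of the folded matrix are entire functions of \<open>t\<close>; an
  upper bound is enough since the matrices in question are nonnegative.\<close>

definition entire :: "zmat \<Rightarrow> bool" where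
  "entire X \<longleftrightarrow> (\<forall>e>0. \<exists>C. \<forall>i j. X i j \<le> C * e ^ nat (j - i))"

lemma entire_le: "entire X \<Longrightarrow> Y \<le> X \<Longrightarrow> entire Y"
  unfolding entire_def le_fun_def by (meson order_trans)

section \<open>Chevalley generators as row and column operations\<close>

locale loop =
  fixes n :: nat
  assumes n_ge_2: "2 \<le> n"
begin

lemma mod_succ_neq: "p mod int n = i mod int n \<Longrightarrow> (p + 1) mod int n \<noteq> i mod int n"
proof
  assume "p mod int n = i mod int n" "(p + 1) mod int n = i mod int n"
  then have "(p + 1) mod int n = p mod int n" by simp
  then have "int n dvd (p + 1) - p" by (metis mod_eq_dvd_iff)
  then have "int n dvd 1" by simp
  then show False using n_ge_2 by simp
qed

lemma mod_neq_succ: "(p + 1) mod int n = i mod int n \<Longrightarrow> p mod int n \<noteq> i mod int n"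
  using mod_succ_neq by blast

text \<open>Left multiplication by \<open>chevalley n i a\<close>, see
  \<open>chevalley_zmult\<close>. Because \<open>2 \<le> n\<close>, the added row
  \<open>p + 1\<close> is itself unchanged; hence parameters add up, and a negative parameter means
  division.\<close>

definition rw :: "int \<Rightarrow> real \<Rightarrow> zmat \<Rightarrow> zmat" where
  "rw i a X p q = X p q + (if p mod int n = i mod int n then a * X (p + 1) q else 0)"

lemma rw_cong_mod: "i mod int n = j mod int n \<Longrightarrow> rw i a X = rw j a X"
  by (simp add: rw_def fun_eq_iff)

lemma rw_rw: "rw i a (rw i b X) = rw i (a + b) X"
  by (auto simp: rw_def fun_eq_iff algebra_simps dest: mod_succ_neq)

lemma rw_0 [simp]: "rw i 0 X = X"
  by (simp add: rw_def fun_eq_iff)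

lemma rw_inverse [simp]: "rw i a (rw i (- a) X) = X" "rw i (- a) (rw i a X) = X"
  by (simp_all add: rw_rw)

lemma rw_commute:
  assumes "(i + 1) mod int n \<noteq> j mod int n" "(j + 1) mod int n \<noteq> i mod int n"
  shows "rw i a (rw j b X) = rw j b (rw i a X)"
proof (intro ext)
  fix p q
  have "(p + 1) mod int n \<noteq> j mod int n" if "p mod int n = i mod int n"
    using assms(1) that by (metis mod_add_left_eq)
  moreover have "(p + 1) mod int n \<noteq> i mod int n" if "p mod int n = j mod int n"
    using assms(2) that by (metis mod_add_left_eq)
  ultimately show "rw i a (rw j b X) p q = rw j b (rw i a X) p q"
    by (auto simp: rw_def)
qed

lemma upper_unipotent_rw [simp]: "upper_unipotent X \<Longrightarrow> upper_unipotent (rw i a X)"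
  by (simp add: upper_unipotent_def rw_def)

lemma zperiodic_rw [simp]: assumes "zperiodic n X" shows "zperiodic n (rw i a X)"
proof -
  have "X (p + int n + 1) (q + int n) = X (p + 1) q" for p q
    using assms[unfolded zperiodic_def, rule_format, of "p + 1" q] by (simp add: algebra_simps)
  then show ?thesis using assms by (simp add: zperiodic_def rw_def)
qed

lemma chevalley_zmult: assumes "upper_unipotent X" shows "chevalley n i a \<star> X = rw i a X"
proof (intro ext)
  fix p q
  show "(chevalley n i a \<star> X) p q = rw i a X p q"
  proof (cases "p < q")
    case True
    have "(chevalley n i a \<star> X) p q = (\<Sum>k \<in> {p, p + 1}. chevalley n i a p k * X k q)"
      unfolding zmult_def using True
      by (intro sum.mono_neutral_right) (auto simp: chevalley_def)
    then show ?thesis by (simp add: chevalley_def rw_def)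
  next
    case False
    then show ?thesis using assms
      by (cases "p = q") (auto simp: zmult_def rw_def chevalley_def upper_unipotent_lower)
  qed
qed

lemma zmult_chevalley:
  assumes "upper_unipotent X"
  shows "(X \<star> chevalley n i a) p q =
    X p q + (if (q - 1) mod int n = i mod int n then a * X p (q - 1) else 0)"
proof (cases "p < q")
  case True
  have "(X \<star> chevalley n i a) p q = (\<Sum>k \<in> {q - 1, q}. X p k * chevalley n i a k q)"
    unfolding zmult_def using True
    by (intro sum.mono_neutral_right) (auto simp: chevalley_def)
  then show ?thesis by (simp add: chevalley_def)
next
  case False
  then show ?thesis using assms
    by (cases "p = q") (auto simp: zmult_def chevalley_def upper_unipotent_lower)
qed

lemma upper_unipotent_chevalley [simp]: "upper_unipotent (chevalley n i a)"
  by (simp add: upper_unipotent_def chevalley_def)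

lemma rw_zmult:
  assumes "upper_unipotent X" "upper_unipotent Y" shows "rw i a X \<star> Y = rw i a (X \<star> Y)"
  using assms by (simp add: chevalley_zmult[symmetric] zmult_assoc)

lemma U_nonneg_rw: assumes "X \<in> U_nonneg n" "0 \<le> a" shows "rw i a X \<in> U_nonneg n"
proof -
  have "totally_nonneg (\<lambda>p q. X p q + (if p mod int n = i mod int n then a else 0) * X (p + 1) q)"
    using assms U_nonnegD by (intro totally_nonneg_row_op) auto
  also have "(\<lambda>p q. X p q + (if p mod int n = i mod int n then a else 0) * X (p + 1) q) = rw i a X"
    by (intro ext) (simp add: rw_def)
  finally show ?thesis using U_nonnegD[OF assms(1)] by (simp add: U_nonneg_def)
qed

lemma chevalley_U_nonneg: "0 \<le> a \<Longrightarrow> chevalley n i a \<in> U_nonneg n"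
  using U_nonneg_rw[OF zid_U_nonneg, of a i] chevalley_zmult[of zid i a] by simp

lemma U_nonneg_zmult_chevalley:
  assumes "X \<in> U_nonneg n" "0 \<le> a" shows "X \<star> chevalley n i a \<in> U_nonneg n"
proof -
  have "totally_nonneg (\<lambda>q p. X p q + (if (q - 1) mod int n = i mod int n then a else 0) * X p (q + - 1))"
    using assms(2) totally_nonneg_transpose[OF U_nonnegD(3)[OF assms(1)]]
    by (intro totally_nonneg_row_op) auto
  from totally_nonneg_transpose[OF this]
  have "totally_nonneg (X \<star> chevalley n i a)"
    by (rule back_subst[of totally_nonneg])
      (intro ext, simp add: zmult_chevalley[OF U_nonnegD(2)[OF assms(1)]])
  then show ?thesis
    using U_nonnegD[OF assms(1)] U_nonnegD[OF chevalley_U_nonneg[OF assms(2)]]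
    by (simp add: U_nonneg_def zperiodic_zmult)
qed

text \<open>
  Closure of \<open>U_nonneg\<close> under arbitrary products would need the Cauchy-Binet formula;
  multiplication by limits of Chevalley products from either side is all that matters below.
\<close>

definition bimult :: "zmat set" where
  "bimult = {X \<in> U_nonneg n. \<forall>Z \<in> U_nonneg n. X \<star> Z \<in> U_nonneg n \<and> Z \<star> X \<in> U_nonneg n}"

lemma bimultD:
  assumes "X \<in> bimult"
  shows "X \<in> U_nonneg n" "Z \<in> U_nonneg n \<Longrightarrow> X \<star> Z \<in> U_nonneg n"
    "Z \<in> U_nonneg n \<Longrightarrow> Z \<star> X \<in> U_nonneg n"
  using assms by (auto simp: bimult_def)

lemma zid_bimult: "zid \<in> bimult"
  by (auto simp: bimult_def zid_U_nonneg U_nonnegD)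

lemma chevalley_bimult: "0 \<le> a \<Longrightarrow> chevalley n i a \<in> bimult"
  by (auto simp: bimult_def chevalley_U_nonneg U_nonneg_zmult_chevalley U_nonneg_rw
      chevalley_zmult U_nonnegD(2))

lemma zmult_bimult: "X \<in> bimult \<Longrightarrow> Y \<in> bimult \<Longrightarrow> X \<star> Y \<in> bimult"
  by (auto simp: bimult_def zmult_assoc) (simp add: zmult_assoc[symmetric])

lemma bimult_limit:
  assumes lim: "\<And>i j. ((\<lambda>b. S b i j) \<longlongrightarrow> X i j) F" and F: "F \<noteq> bot"
    and ev: "eventually (\<lambda>b. S b \<in> bimult) F"
  shows "X \<in> bimult"
  unfolding bimult_def
proof (intro CollectI conjI ballI)
  show "X \<in> U_nonneg n"
    by (rule U_nonneg_limit[OF lim F], use ev in eventually_elim) (rule bimultD)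
  fix Z assume Z: "Z \<in> U_nonneg n"
  show "X \<star> Z \<in> U_nonneg n"
    by (rule U_nonneg_limit[OF tendsto_zmult[OF lim tendsto_const] F], use ev in eventually_elim)
      (rule bimultD(2)[OF _ Z])
  show "Z \<star> X \<in> U_nonneg n"
    by (rule U_nonneg_limit[OF tendsto_zmult[OF tendsto_const lim] F], use ev in eventually_elim)
      (rule bimultD(3)[OF _ Z])
qed

text \<open>A row other than the last receives a multiple of another row of the same minor, which
  has no effect; only the last row can pick up a row from outside.\<close>

lemma minor_rw_solid:
  "minor (rw i s X) m (\<lambda>l. b + int l) c =
   det_fun m (\<lambda>l j. X (b + int l) (c j) +
     (if Suc l = m \<and> (b + int l) mod int n = i mod int n then s * X (b + int l + 1) (c j) else 0))"
proof -
  define f where "f l j = X (b + int l) (c j) +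
     (if Suc l = m \<and> (b + int l) mod int n = i mod int n then s * X (b + int l + 1) (c j) else 0)"
    for l j
  have "minor (rw i s X) m (\<lambda>l. b + int l) c =
    det_fun m (\<lambda>l j. f l j + (if Suc l < m
      then (if (b + int l) mod int n = i mod int n then s else 0) * f (Suc l) j else 0))"
    unfolding minor_det_fun
  proof (rule det_fun_cong)
    fix l j assume "l < m"
    have "(b + int (Suc l)) mod int n \<noteq> i mod int n" if "(b + int l) mod int n = i mod int n"
      using mod_succ_neq[OF that] by (simp add: algebra_simps)
    then show "rw i s X (b + int l) (c j) = f l j + (if Suc l < m
      then (if (b + int l) mod int n = i mod int n then s else 0) * f (Suc l) j else 0)"
      using \<open>l < m\<close> by (auto simp: rw_def f_def algebra_simps)
  qed
  also have "\<dots> = det_fun m f" by (rule det_fun_add_next_rows)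
  finally show ?thesis by (simp add: f_def[abs_def])
qed

text \<open>Extend the minor by the next row and a column \<open>j\<close> further right, and take
  the Schur complement at the new corner. Its coefficients are ratios in column \<open>j\<close>,
  which become products of \<open>mu\<close> as \<open>j\<close> tends to infinity.\<close>

lemma solid_schur_nonneg:
  assumes X: "solid_nonneg X" and c: "strict_mono_on {..<Suc m} c"
    and j: "c m < j" and pos: "0 < X (b + int m + 1) j"
  shows "0 \<le> det_fun (Suc m) (\<lambda>l q. X (b + int l) (c q) -
    X (b + int l) j / X (b + int m + 1) j * X (b + int m + 1) (c q))"
proof -
  define c' where "c' = c(Suc m := j)"
  have "strict_mono_on {..<Suc (Suc m)} c'"
  proof (rule strict_mono_onI)
    fix x y assume xy: "x \<in> {..<Suc (Suc m)}" "y \<in> {..<Suc (Suc m)}" "x < y"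
    have "c x < j" if "y = Suc m"
      using strict_mono_onD[OF c, of x m] j xy that by (cases "x = m") auto
    then show "c' x < c' y"
      using strict_mono_onD[OF c, of x y] xy by (cases "y = Suc m") (auto simp: c'_def)
  qed
  then have "0 \<le> minor X (Suc (Suc m)) (\<lambda>l. b + int l) c'"
    using X by (simp add: solid_nonneg_def)
  also have "\<dots> = X (b + int m + 1) j * det_fun (Suc m) (\<lambda>l q. X (b + int l) (c' q) -
      X (b + int l) j / X (b + int m + 1) j * X (b + int m + 1) (c' q))"
    unfolding minor_det_fun using pos
    by (subst det_fun_schur) (simp_all add: c'_def algebra_simps)
  also have "det_fun (Suc m) (\<lambda>l q. X (b + int l) (c' q) -
      X (b + int l) j / X (b + int m + 1) j * X (b + int m + 1) (c' q)) =
    det_fun (Suc m) (\<lambda>l q. X (b + int l) (c q) -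
      X (b + int l) j / X (b + int m + 1) j * X (b + int m + 1) (c q))"
    by (rule det_fun_cong) (simp add: c'_def)
  finally show ?thesis using pos by (simp add: zero_le_mult_iff)
qed

section \<open>Asymptotic ratios of consecutive rows\<close>

text \<open>The domain of greedy division: positivity gives meaning to the ratios, the growth
  condition forces one of them to tend to zero, and nonnegativity is asked for the minors that
  division is shown to preserve.\<close>

definition Adm :: "zmat set" where
  "Adm = {X. zperiodic n X \<and> upper_unipotent X \<and> (\<forall>i j. i \<le> j \<longrightarrow> 0 < X i j) \<and>
     solid_nonneg X \<and> entire X}"

lemma AdmD:
  assumes "X \<in> Adm"
  shows "zperiodic n X" "upper_unipotent X" "i \<le> j \<Longrightarrow> 0 < X i j" "solid_nonneg X" "entire X"
    "0 \<le> X i j"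
  using assms solid_nonneg_entry by (auto simp: Adm_def)

text \<open>Column \<open>i + 1\<close> is the first with a nonzero denominator. The infimum is the
  limit, since minors of order two make the ratios decrease.\<close>

definition mu :: "zmat \<Rightarrow> int \<Rightarrow> real" where
  "mu X i = (INF j \<in> {i<..}. X i j / X (i + 1) j)"

lemma mu_bdd: assumes "X \<in> Adm" shows "bdd_below ((\<lambda>j. X i j / X (i + 1) j) ` {i<..})"
  using AdmD(6)[OF assms] by (intro bdd_belowI2[of _ 0]) simp

lemma mu_nonneg: "X \<in> Adm \<Longrightarrow> 0 \<le> mu X i"
  unfolding mu_def using AdmD(6) by (intro cINF_greatest) auto

lemma mu_le: assumes "X \<in> Adm" shows "mu X i * X (i + 1) j \<le> X i j"
proof (cases "i < j")
  case True
  then have "mu X i \<le> X i j / X (i + 1) j"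
    unfolding mu_def by (intro cINF_lower mu_bdd[OF assms]) simp
  then show ?thesis using AdmD(3)[OF assms, of "i + 1" j] True by (simp add: pos_le_divide_eq)
next
  case False
  then show ?thesis using AdmD[OF assms] by (simp add: upper_unipotent_lower)
qed

lemma mu_greatest:
  assumes "X \<in> Adm" "\<And>j. i < j \<Longrightarrow> t * X (i + 1) j \<le> X i j" shows "t \<le> mu X i"
  unfolding mu_def using assms AdmD(3)[OF assms(1), of "i + 1"]
  by (intro cINF_greatest) (auto simp: pos_le_divide_eq)

lemma tendsto_mu: assumes "X \<in> Adm" shows "((\<lambda>j. X i j / X (i + 1) j) \<longlongrightarrow> mu X i) at_top"
proof (rule decreasing_tendsto)
  show "\<forall>\<^sub>F j in at_top. mu X i \<le> X i j / X (i + 1) j"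
    using eventually_gt_at_top[of i]
  proof eventually_elim
    case (elim j)
    then show ?case
      using mu_le[OF assms, of i j] AdmD(3)[OF assms, of "i + 1" j] by (simp add: pos_le_divide_eq)
  qed
next
  fix x assume "mu X i < x"
  then obtain p where p: "i < p" "X i p / X (i + 1) p < x"
    unfolding mu_def using cINF_less_iff[OF _ mu_bdd[OF assms]] by auto
  show "\<forall>\<^sub>F j in at_top. X i j / X (i + 1) j < x"
    using eventually_gt_at_top[of p]
  proof eventually_elim
    case (elim j)
    have "X i j / X (i + 1) j \<le> X i p / X (i + 1) p"
      using solid_nonneg_2[OF AdmD(4)[OF assms] elim, of i] elim p(1)
        AdmD(3)[OF assms, of "i + 1" j] AdmD(3)[OF assms, of "i + 1" p]
      by (simp add: field_simps)
    then show ?case using p by simp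
  qed
qed

lemma mu_eqI:
  assumes "X \<in> Adm" "((\<lambda>j. X i j / X (i + 1) j) \<longlongrightarrow> l) at_top" shows "mu X i = l"
  using tendsto_unique[OF _ tendsto_mu[OF assms(1)] assms(2)] by simp

text \<open>The ratio of distant rows telescopes into ratios of neighbouring rows, so a single
  vanishing \<open>mu\<close> in between makes it tend to zero.\<close>

lemma tendsto_row_ratio:
  assumes "X \<in> Adm"
  shows "((\<lambda>j. X i j / X (i + int d) j) \<longlongrightarrow> (\<Prod>l<d. mu X (i + int l))) at_top"
proof (induction d)
  case 0
  have "\<forall>\<^sub>F j in at_top. X i j / X i j = 1"
    using eventually_ge_at_top[of i] by eventually_elim (use AdmD(3)[OF assms, of i] in fastforce)
  then show ?case by (simp add: tendsto_eventually)
next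
  case (Suc d)
  have "((\<lambda>j. (X i j / X (i + int d) j) * (X (i + int d) j / X (i + int d + 1) j)) \<longlongrightarrow>
      (\<Prod>l<d. mu X (i + int l)) * mu X (i + int d)) at_top"
    by (intro tendsto_mult Suc tendsto_mu assms)
  moreover have "\<forall>\<^sub>F j in at_top. (X i j / X (i + int d) j) * (X (i + int d) j / X (i + int d + 1) j) =
      X i j / X (i + int (Suc d)) j"
    using eventually_ge_at_top[of "i + int d"]
  proof eventually_elim
    case (elim j)
    then show ?case using AdmD(3)[OF assms elim] by (simp add: algebra_simps)
  qed
  ultimately show ?case by (simp add: tendsto_cong)
qed

lemma filterlim_minus_int: "filterlim (\<lambda>j::int. j - c) at_top at_top"
  unfolding filterlim_at_top
  by (intro allI, rule eventually_mono[OF eventually_ge_at_top]) (simp add: le_diff_eq)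

lemma mod_eq_shiftE:
  fixes p q :: int
  assumes "p mod int n = q mod int n" obtains m where "p = q + m * int n"
  using assms by (metis mod_eqE add.commute mult.commute)

lemma mu_cong_mod:
  assumes "X \<in> Adm" "p mod int n = q mod int n" shows "mu X p = mu X q"
proof -
  obtain m where p: "p = q + m * int n" using assms(2) by (rule mod_eq_shiftE)
  have "X p j / X (p + 1) j = X q (j - m * int n) / X (q + 1) (j - m * int n)" for j
    using zperiodic_shift[OF AdmD(1)[OF assms(1)], of q m "j - m * int n"]
      zperiodic_shift[OF AdmD(1)[OF assms(1)], of "q + 1" m "j - m * int n"]
    by (simp add: p algebra_simps)
  then show ?thesis
    using filterlim_compose[OF tendsto_mu[OF assms(1), of q] filterlim_minus_int]
    by (intro mu_eqI[OF assms(1)]) simp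
qed

lemma mu_rw_same:
  assumes "X \<in> Adm" "rw i a X \<in> Adm" shows "mu (rw i a X) i = mu X i + a"
proof (rule mu_eqI[OF assms(2)])
  have "((\<lambda>j. X i j / X (i + 1) j + a) \<longlongrightarrow> mu X i + a) at_top"
    by (intro tendsto_intros tendsto_mu assms)
  moreover have "\<forall>\<^sub>F j in at_top. X i j / X (i + 1) j + a = rw i a X i j / rw i a X (i + 1) j"
    using eventually_gt_at_top[of i]
  proof eventually_elim
    case (elim j)
    then show ?case using AdmD(3)[OF assms(1), of "i + 1" j] mod_succ_neq[of i i]
      by (simp add: rw_def add_divide_distrib)
  qed
  ultimately show "((\<lambda>j. rw i a X i j / rw i a X (i + 1) j) \<longlongrightarrow> mu X i + a) at_top"
    by (simp add: tendsto_cong)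
qed

lemma mu_rw_other:
  assumes "k mod int n \<noteq> i mod int n" "(k + 1) mod int n \<noteq> i mod int n"
  shows "mu (rw i a X) k = mu X k"
  using assms by (simp add: mu_def rw_def)

text \<open>Row \<open>k\<close> stays, while row \<open>k + 1\<close> gains \<open>a\<close> times
  row \<open>k + 2\<close>. The old ratio is thus multiplied by \<open>v / (v + a)\<close>, where
  \<open>v\<close> is the ratio of the rows \<open>k + 1\<close> and \<open>k + 2\<close>.\<close>

lemma mu_rw_prev:
  assumes "X \<in> Adm" "rw i a X \<in> Adm" "0 < a" "(k + 1) mod int n = i mod int n"
  shows "mu (rw i a X) k = mu X k * (mu X (k + 1) / (mu X (k + 1) + a))"
proof (rule mu_eqI[OF assms(2)])
  have "((\<lambda>j. (X k j / X (k + 1) j) * ((X (k + 1) j / X (k + 1 + 1) j) /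
      (X (k + 1) j / X (k + 1 + 1) j + a))) \<longlongrightarrow>
      mu X k * (mu X (k + 1) / (mu X (k + 1) + a))) at_top"
    using mu_nonneg[OF assms(1), of "k + 1"] assms(3)
    by (intro tendsto_intros tendsto_mu assms(1)) simp
  moreover have "\<forall>\<^sub>F j in at_top. (X k j / X (k + 1) j) * ((X (k + 1) j / X (k + 1 + 1) j) /
      (X (k + 1) j / X (k + 1 + 1) j + a)) = rw i a X k j / rw i a X (k + 1) j"
    using eventually_gt_at_top[of "k + 1"]
  proof eventually_elim
    case (elim j)
    have "0 < X (k + 1) j" "0 < X (k + 1 + 1) j" using AdmD(3)[OF assms(1)] elim by auto
    moreover have "X (k + 1) j + a * X (k + 1 + 1) j \<noteq> 0"
      using calculation assms(3) by (smt (verit) mult_pos_pos)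
    ultimately show ?case using assms(4) mod_neq_succ[OF assms(4)]
      by (simp add: rw_def field_simps)
  qed
  ultimately show "((\<lambda>j. rw i a X k j / rw i a X (k + 1) j) \<longlongrightarrow>
      mu X k * (mu X (k + 1) / (mu X (k + 1) + a))) at_top"
    by (simp add: tendsto_cong)
qed

lemma rw_le: assumes "solid_nonneg X" "0 \<le> a" shows "X \<le> rw i a X"
  using solid_nonneg_entry[OF assms(1)] assms(2) by (simp add: le_fun_def rw_def)

text \<open>A zero of \<open>X\<close> at \<open>(p, q)\<close> with \<open>p < q\<close> forces one
  at \<open>(p - 1, q)\<close> by a minor of order two, and then \<open>rw i a X\<close> vanishes at
  \<open>(p - 1, q)\<close> as well. The growth bound passes down from
  \<open>rw i a X\<close>.\<close>

lemma Adm_rwD: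
  assumes "rw i a X \<in> Adm" "0 \<le> a" "zperiodic n X" "upper_unipotent X" "solid_nonneg X"
  shows "X \<in> Adm"
proof -
  have nn: "0 \<le> X p q" for p q using solid_nonneg_entry[OF assms(5)] .
  have "0 < X p q" if "p \<le> q" for p q
  proof (rule ccontr)
    assume "\<not> 0 < X p q"
    then have z: "X p q = 0" using nn[of p q] by simp
    then have "p < q" using that assms(4) by (cases "p = q") auto
    then have "X (p - 1) q = 0"
      using solid_nonneg_2[OF assms(5), of p q "p - 1"] z nn[of "p - 1" q] assms(4) by simp
    then have "rw i a X (p - 1) q = 0" using z by (simp add: rw_def)
    then show False using AdmD(3)[OF assms(1), of "p - 1" q] that by simp
  qed
  moreover have "entire X" using AdmD(5)[OF assms(1)] rw_le[OF assms(5,2)] by (rule entire_le)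
  ultimately show ?thesis using assms by (simp add: Adm_def)
qed

text \<open>Let \<open>e\<close> be the last row of the minor, with \<open>e\<close> congruent to
  \<open>k\<close>. The limiting Schur complement subtracts from each row a multiple of row
  \<open>e + 1\<close>, the coefficient being a product of ratios ending at \<open>e\<close>. Above
  the last row this product contains \<open>mu X (e - 1) = 0\<close>, so only row \<open>e\<close>
  changes, by the amount that the division prescribes.\<close>

lemma Adm_remove_left_end:
  assumes X: "X \<in> Adm" and z: "mu X (k - 1) = 0" and pos: "0 < mu X k"
  shows "rw k (- mu X k) X \<in> Adm"
proof -
  define t where "t = mu X k"
  define X' where "X' = rw k (- t) X"
  have solid: "solid_nonneg X'"
    unfolding solid_nonneg_def
  proof (intro allI impI)
    fix b m and c :: "nat \<Rightarrow> int"
    assume c: "strict_mono_on {..<m} c"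
    show "0 \<le> minor X' m (\<lambda>l. b + int l) c"
    proof (cases "m > 0 \<and> (b + int (m - 1)) mod int n = k mod int n")
      case False
      then have "minor X' m (\<lambda>l. b + int l) c = minor X m (\<lambda>l. b + int l) c"
        unfolding X'_def unfolding minor_rw_solid unfolding minor_det_fun by (intro det_fun_cong) auto
      then show ?thesis using AdmD(4)[OF X] c by (simp add: solid_nonneg_def)
    next
      case True
      then obtain m' where m: "m = Suc m'" by (cases m) auto
      define e where "e = b + int m'"
      have e: "e mod int n = k mod int n" using True m by (simp add: e_def)
      have "mu X e = t" using mu_cong_mod[OF X e] by (simp add: t_def)
      have "(e - 1) mod int n = (k - 1) mod int n" using e by (metis mod_diff_left_eq)
      then have "mu X (e - 1) = 0" using mu_cong_mod[OF X, of "e - 1" "k - 1"] z by simp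
      define g where "g l q = X (b + int l) (c q) - (if l = m' then t else 0) * X (e + 1) (c q)" for l q
      have "((\<lambda>j. det_fun (Suc m') (\<lambda>l q. X (b + int l) (c q) -
          X (b + int l) j / X (e + 1) j * X (e + 1) (c q))) \<longlongrightarrow> det_fun (Suc m') g) at_top"
      proof (rule tendsto_det_fun)
        fix l q assume l: "l < Suc m'"
        have "((\<lambda>j. X (b + int l) j / X (b + int l + int (Suc (m' - l))) j) \<longlongrightarrow>
           (\<Prod>r<Suc (m' - l). mu X (b + int l + int r))) at_top"
          by (rule tendsto_row_ratio[OF X])
        moreover have "(\<Prod>r<Suc (m' - l). mu X (b + int l + int r)) = (if l = m' then t else 0)"
        proof (cases "l = m'")
          case True
          then show ?thesis using \<open>mu X e = t\<close> by (simp add: e_def)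
        next
          case False
          \<comment> \<open>This index points to row \<open>e - 1\<close>, whose ratio vanishes by
            assumption.\<close>
          have "mu X (b + int l + int (m' - l - 1)) = 0"
            using \<open>mu X (e - 1) = 0\<close> False l by (simp add: e_def of_nat_diff algebra_simps)
          then show ?thesis using False l
            by (simp del: prod.lessThan_Suc) (intro bexI[of _ "m' - l - 1"], auto)
        qed
        moreover have "b + int l + int (Suc (m' - l)) = e + 1"
          using l by (simp add: e_def of_nat_diff)
        ultimately have "((\<lambda>j. X (b + int l) j / X (e + 1) j) \<longlongrightarrow> (if l = m' then t else 0)) at_top"
          by (simp only:)
        then show "((\<lambda>j. X (b + int l) (c q) - X (b + int l) j / X (e + 1) j * X (e + 1) (c q))
            \<longlongrightarrow> g l q) at_top"
          unfolding g_def by (intro tendsto_intros)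
      qed
      moreover have "\<forall>\<^sub>F j in at_top. 0 \<le> det_fun (Suc m') (\<lambda>l q. X (b + int l) (c q) -
          X (b + int l) j / X (e + 1) j * X (e + 1) (c q))"
        using eventually_gt_at_top[of "max (c m') (e + 1)"]
      proof eventually_elim
        case (elim j)
        then show ?case
          unfolding e_def using c m
          by (intro solid_schur_nonneg AdmD(4)[OF X] AdmD(3)[OF X]) (auto simp: e_def)
      qed
      ultimately have "0 \<le> det_fun (Suc m') g"
        by (rule tendsto_lowerbound) simp
      also have "det_fun (Suc m') g = minor X' m (\<lambda>l. b + int l) c"
        unfolding X'_def minor_rw_solid m using e
        by (intro det_fun_cong) (auto simp: g_def e_def algebra_simps)
      finally show ?thesis .
    qed
  qed
  have A: "rw k t X' \<in> Adm" unfolding X'_def rw_inverse by (rule X)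
  have "zperiodic n X'" "upper_unipotent X'"
    unfolding X'_def by (intro zperiodic_rw upper_unipotent_rw AdmD[OF X])+
  moreover have "0 \<le> t" using pos by (simp add: t_def)
  ultimately have "X' \<in> Adm" using Adm_rwD[OF A] solid by blast
  then show ?thesis unfolding X'_def t_def .
qed

text \<open>A common positive lower bound \<open>c\<close> for the ratios makes entries at distance
  \<open>d\<close> at least \<open>c ^ d\<close>, which contradicts decay at rate
  \<open>c / 2\<close>.\<close>

lemma Adm_mu_zero: assumes X: "X \<in> Adm" shows "\<exists>z. mu X z = 0"
proof (rule ccontr)
  assume "\<not> (\<exists>z. mu X z = 0)"
  then have pos: "0 < mu X z" for z using mu_nonneg[OF X, of z] by (simp add: less_le)
  define c where "c = Min (mu X ` {0..<int n})"
  have fin: "finite (mu X ` {0..<int n})" "mu X ` {0..<int n} \<noteq> {}" using n_ge_2 by auto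
  have c0: "0 < c" unfolding c_def using Min_in[OF fin] pos by auto
  have cle: "c \<le> mu X i" for i
  proof -
    have "mu X i = mu X (i mod int n)" by (rule mu_cong_mod[OF X]) simp
    then show ?thesis unfolding c_def using n_ge_2 by (intro Min_le[OF fin(1)]) auto
  qed
  have low: "c ^ d \<le> X i (i + int d)" for i d
  proof (induction d arbitrary: i)
    case 0
    then show ?case using AdmD(2)[OF X] by simp
  next
    case (Suc d)
    have "c ^ Suc d \<le> c * X (i + 1) (i + 1 + int d)" using Suc[of "i + 1"] c0 by simp
    also have "\<dots> \<le> mu X i * X (i + 1) (i + 1 + int d)"
      using cle AdmD(6)[OF X] by (intro mult_right_mono)
    also have "\<dots> \<le> X i (i + int (Suc d))" using mu_le[OF X, of i "i + 1 + int d"] by (simp add: algebra_simps)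
    finally show ?case .
  qed
  obtain C where C: "\<And>i j. X i j \<le> C * (c / 2) ^ nat (j - i)"
    using AdmD(5)[OF X] c0 unfolding entire_def by (meson half_gt_zero)
  have "2 ^ d \<le> C" for d
  proof -
    have "c ^ d \<le> C * (c / 2) ^ d" using low[of d 0] C[of 0 "int d"] by simp
    then have "c ^ d * 2 ^ d \<le> C * c ^ d" by (simp add: power_divide field_simps)
    then show ?thesis using c0 by (simp add: mult.commute)
  qed
  then show False
    using real_arch_pow[of 2 C] by (smt (verit))
qed

text \<open>The sites form a circle, so walking left from \<open>i\<close> eventually meets a
  vanishing ratio.\<close>

lemma Adm_left_end:
  assumes X: "X \<in> Adm" and i: "0 < mu X i"
  shows "\<exists>k. 0 < mu X k \<and> mu X (k - 1) = 0"
proof (rule ccontr)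
  assume "\<not> ?thesis"
  then have step: "0 < mu X (k - 1)" if "0 < mu X k" for k
    using that mu_nonneg[OF X, of "k - 1"] by (force simp: less_le)
  have all: "0 < mu X (i - int d)" for d
  proof (induction d)
    case (Suc d)
    then show ?case using step[of "i - int d"] by (simp add: algebra_simps)
  qed (use i in simp)
  obtain z where z: "mu X z = 0" using Adm_mu_zero[OF X] by blast
  define d where "d = nat ((i - z) mod int n)"
  have "(i - int d) mod int n = z mod int n"
    using n_ge_2 by (simp add: d_def mod_diff_right_eq)
  then show False using all[of d] z mu_cong_mod[OF X, of "i - int d" z] by simp
qed


section \<open>Dividing by Chevalley generators\<close>

lemma mod_add_1_iff: "(p + 1) mod int n = q mod int n \<longleftrightarrow> p mod int n = (q - 1) mod int n"
  by (simp add: mod_eq_dvd_iff algebra_simps)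

lemma mod_add_1_eq_iff [simp]: "(p + 1) mod int n = (q + 1) mod int n \<longleftrightarrow> p mod int n = q mod int n"
  by (simp add: mod_eq_dvd_iff)

lemma rw_hit: "p mod int n = i mod int n \<Longrightarrow> rw i a X p q = X p q + a * X (p + 1) q"
  and rw_miss: "p mod int n \<noteq> i mod int n \<Longrightarrow> rw i a X p q = X p q"
  by (simp_all add: rw_def)

definition cstep :: "int \<Rightarrow> real \<Rightarrow> zmat \<Rightarrow> zmat \<Rightarrow> bool" where
  "cstep i a X Y \<longleftrightarrow> X \<in> Adm \<and> Y \<in> Adm \<and> 0 < a \<and> X = rw i a Y"

definition chev_step :: "zmat \<Rightarrow> zmat \<Rightarrow> bool" where
  "chev_step X Y \<longleftrightarrow> (\<exists>i a. cstep i a X Y)"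

lemma cstepD:
  assumes "cstep i a X Y"
  shows "X \<in> Adm" "Y \<in> Adm" "0 < a" "X = rw i a Y"
  using assms by (auto simp: cstep_def)

lemma cstep_mu_same: assumes "cstep i a X Y" "p mod int n = i mod int n" shows "mu X p = mu Y p + a"
  using assms mu_rw_same[of Y p a] rw_cong_mod[OF assms(2)] by (auto simp: cstep_def)

lemma cstep_mu_other:
  "cstep i a X Y \<Longrightarrow> p mod int n \<noteq> i mod int n \<Longrightarrow> (p + 1) mod int n \<noteq> i mod int n \<Longrightarrow> mu X p = mu Y p"
  using mu_rw_other by (auto simp: cstep_def)

lemma cstep_mu_prev:
  assumes "cstep i a X Y" "(p + 1) mod int n = i mod int n"
  shows "mu X p = mu Y p * (mu Y i / (mu Y i + a))"
proof -
  have "mu X p = mu Y p * (mu Y (p + 1) / (mu Y (p + 1) + a))"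
    using assms mu_rw_prev[of Y i a p] by (auto simp: cstep_def)
  then show ?thesis using mu_cong_mod[OF cstepD(2)[OF assms(1)] assms(2)] by simp
qed

lemma cstep_le: assumes "cstep i a X Y" shows "Y \<le> X"
  using cstepD[OF assms] rw_le[of Y a i] AdmD(4)[of Y] by auto

text \<open>While the divided site keeps mass, the factor acting on its left neighbour is positive,
  so no site is filled or emptied.\<close>

lemma cstep_zero_iff:
  assumes "cstep i a X Y" "0 < mu Y i" shows "mu X p = 0 \<longleftrightarrow> mu Y p = 0"
proof -
  consider "p mod int n = i mod int n" | "(p + 1) mod int n = i mod int n"
    | "p mod int n \<noteq> i mod int n" "(p + 1) mod int n \<noteq> i mod int n" by blast
  then show ?thesis
  proof cases
    case 1
    then show ?thesis
      using cstep_mu_same[OF assms(1) 1] mu_cong_mod[OF cstepD(2)[OF assms(1)] 1] assms(2)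
        cstepD(3)[OF assms(1)] by simp
  next
    case 2
    then show ?thesis
      using cstep_mu_prev[OF assms(1) 2] assms(2) cstepD(3)[OF assms(1)] by simp
  next
    case 3
    then show ?thesis using cstep_mu_other[OF assms(1) 3] by simp
  qed
qed

text \<open>A monovariant: at the divided site the ratio and the superdiagonal entry drop by the
  same \<open>a\<close>, and at its left neighbour the ratio cannot drop. Since the entries
  converge, a ratio cannot fall much late in a sequence.\<close>

lemma cstep_mu_minus_entry:
  assumes "cstep i a X Y" shows "mu X p - X p (p + 1) \<le> mu Y p - Y p (p + 1)"
proof -
  note D = cstepD[OF assms]
  have X: "X p (p + 1) = Y p (p + 1) + (if p mod int n = i mod int n then a else 0)"
    using AdmD(2)[OF D(2)] by (simp add: D(4) rw_def)
  consider "p mod int n = i mod int n" | "(p + 1) mod int n = i mod int n"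
    | "p mod int n \<noteq> i mod int n" "(p + 1) mod int n \<noteq> i mod int n" by blast
  then show ?thesis
  proof cases
    case 1
    then show ?thesis using X cstep_mu_same[OF assms 1] by simp
  next
    case 2
    have "mu Y i / (mu Y i + a) \<le> 1" using mu_nonneg[OF D(2), of i] D(3) by simp
    then have "mu Y p * (mu Y i / (mu Y i + a)) \<le> mu Y p * 1"
      using mu_nonneg[OF D(2), of p] by (rule mult_left_mono)
    then have "mu X p \<le> mu Y p" using cstep_mu_prev[OF assms 2] by simp
    then show ?thesis using X mod_neq_succ[OF 2] by simp
  next
    case 3
    then show ?thesis using X cstep_mu_other[OF assms 3] by simp
  qed
qed

text \<open>
  Think of a particle sitting at each residue \<open>p\<close> with \<open>mu X p > 0\<close>. Dividing by \<open>e_i\<close> leaves the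
  particles where they are, unless it exhausts \<open>mu X i\<close>. In that case the site \<open>i - 1\<close> was empty,
  and the particle at \<open>i\<close> moves there or dies. Hence nothing moves past a particle that never moves,
  which bounds the number of moves.
\<close>

definition potential :: "zmat \<Rightarrow> int \<Rightarrow> nat" where
  "potential X i = (\<Sum>d<n. if 0 < mu X (i + int d) then d else 0)"

text \<open>With \<open>d\<close> the distance from \<open>i\<close> to an exhausted site, its
  particle passes from \<open>d\<close> to \<open>d - 1\<close> or dies, and all other distances
  keep their occupancy.\<close>

lemma potential_mono:
  assumes c: "cstep k t X Y" and pos: "0 < mu X i" "0 < mu Y i"
  shows "potential Y i \<le> potential X i \<and> (mu Y k = 0 \<longrightarrow> potential Y i < potential X i)"
proof (cases "mu Y k = 0")
  case False
  have "0 < mu Y k" using mu_nonneg[OF cstepD(2)[OF c], of k] False by simp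
  have "0 < mu X p \<longleftrightarrow> 0 < mu Y p" for p
    using cstep_zero_iff[OF c \<open>0 < mu Y k\<close>, of p] mu_nonneg[OF cstepD(1)[OF c], of p]
      mu_nonneg[OF cstepD(2)[OF c], of p] by (simp add: less_le)
  then show ?thesis using False by (simp add: potential_def)
next
  case True
  note D = cstepD[OF c]
  define d where "d = nat ((k - i) mod int n)"
  have d: "d < n" using n_ge_2 by (simp add: d_def nat_less_iff)
  have id: "(i + int d) mod int n = k mod int n"
    using n_ge_2 by (simp add: d_def mod_add_right_eq)
  have Yd: "mu Y (i + int d) = 0" using mu_cong_mod[OF D(2) id] True by simp
  have Xd: "0 < mu X (i + int d)"
    using cstep_mu_same[OF c id] mu_nonneg[OF D(2), of "i + int d"] D(3) by simp
  have d0: "d \<noteq> 0" using Yd pos by (cases d) auto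
  have prev: "(i + int (d - 1) + 1) mod int n = k mod int n"
    using id d0 by (simp add: of_nat_diff)
  \<comment> \<open>The site to the left of an exhausted one was empty before. As \<open>i\<close>
    is occupied, that site is not \<open>i\<close>.\<close>
  have Xd1: "mu X (i + int (d - 1)) = 0" using cstep_mu_prev[OF c prev] True by simp
  have d1: "d - 1 \<noteq> 0"
  proof
    assume "d - 1 = 0"
    then have "mu X (i + int 0) = 0" using Xd1 by (simp only:)
    then show False using pos by simp
  qed
  have other: "mu X (i + int e) = mu Y (i + int e)" if e: "e < n" "e \<noteq> d" "e \<noteq> d - 1" for e
  proof (rule cstep_mu_other[OF c])
    have inj: "x = y" if "x < n" "y < n" "(i + int x) mod int n = (i + int y) mod int n" for x y
    proof -
      have "int x mod int n = int y mod int n"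
        using that(3) by (simp add: mod_eq_dvd_iff)
      then show ?thesis using that by simp
    qed
    show "(i + int e) mod int n \<noteq> k mod int n" using inj[OF e(1) d] id e(2) by metis
    have "(i + int e + 1) mod int n = k mod int n \<Longrightarrow> e = d - 1"
      using inj[OF e(1), of "d - 1"] prev d by (metis mod_add_1_eq_iff less_imp_diff_less)
    then show "(i + int e + 1) mod int n \<noteq> k mod int n" using e(3) by blast
  qed
  let ?w = "\<lambda>Z e. if 0 < mu Z (i + int e) then e else 0"
  have split: "potential Z i = ?w Z d + (?w Z (d - 1) + (\<Sum>e \<in> {..<n} - {d} - {d - 1}. ?w Z e))" for Z
    unfolding potential_def using d d0
    by (subst sum.remove[of _ d], simp, simp, subst sum.remove[of _ "d - 1"]) auto
  have "(\<Sum>e \<in> {..<n} - {d} - {d - 1}. ?w X e) = (\<Sum>e \<in> {..<n} - {d} - {d - 1}. ?w Y e)"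
    by (intro sum.cong refl) (simp add: other)
  moreover have "?w X d = d" "?w X (d - 1) = 0" "?w Y d = 0" "?w Y (d - 1) \<le> d - 1"
    using Xd Yd Xd1 by auto
  ultimately have "potential Y i < potential X i"
    unfolding split using d0 by linarith
  then show ?thesis by simp
qed

text \<open>Otherwise the ratio at \<open>i\<close> is at least some \<open>e > 0\<close> infinitely
  often. Once the superdiagonal entry is within \<open>e\<close> of its limit, the monovariant keeps
  such a ratio positive for good, and then each of infinitely many exhausting divisions lowers the
  potential seen from \<open>i\<close>.\<close>

lemma mu_tendsto_0:
  assumes c: "\<And>p. cstep (k p) (t p) (X p) (X (Suc p))"
    and hops: "\<And>p. \<exists>q\<ge>p. mu (X (Suc q)) (k q) = 0"
  shows "(\<lambda>p. mu (X p) i) \<longlonglongrightarrow> 0"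
proof (rule ccontr)
  assume not: "\<not> (\<lambda>p. mu (X p) i) \<longlonglongrightarrow> 0"
  have Adm: "X p \<in> Adm" for p using cstepD(1)[OF c] .
  obtain e where e: "0 < e" "\<And>m. \<exists>p\<ge>m. e \<le> mu (X p) i"
    using not mu_nonneg[OF Adm] unfolding LIMSEQ_def by (auto simp: not_less)
  define s where "s p = X p i (i + 1)" for p
  have dec: "decseq s"
    unfolding s_def decseq_Suc_iff using cstep_le[OF c] by (auto simp: le_fun_def)
  have "0 \<le> s p" for p using AdmD(6)[OF Adm] by (simp add: s_def)
  then obtain L where L: "s \<longlonglongrightarrow> L" "\<And>p. L \<le> s p"
    using decseq_convergent[OF dec] by metis
  have "\<forall>\<^sub>F p in sequentially. s p < L + e" using L(1) e(1) by (intro order_tendstoD) auto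
  then obtain m where m: "\<And>p. m \<le> p \<Longrightarrow> s p < L + e" by (auto simp: eventually_sequentially)
  obtain p0 where p0: "m \<le> p0" "e \<le> mu (X p0) i" using e(2) by blast
  have pos: "0 < mu (X q) i" if "p0 \<le> q" for q
  proof -
    have "mu (X p0) i - s p0 \<le> mu (X q) i - s q"
      using that
    proof (induction q rule: dec_induct)
      case (step q)
      then show ?case using cstep_mu_minus_entry[OF c, of q i] by (simp add: s_def)
    qed simp
    then show ?thesis using m[OF p0(1)] p0(2) L(2)[of q] by simp
  qed
  define P where "P q = potential (X (p0 + q)) i" for q
  have mono: "P (Suc q) \<le> P q \<and> (mu (X (Suc (p0 + q))) (k (p0 + q)) = 0 \<longrightarrow> P (Suc q) < P q)" for q
    using potential_mono[OF c, of "p0 + q" i] pos by (simp add: P_def)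
  then have anti: "P q \<le> P r" if "r \<le> q" for r q
    using lift_Suc_antimono_le[of P r q] mono that by blast
  define q where "q = (LEAST v. \<exists>q. P q = v)"
  obtain r where r: "P r = q" using LeastI_ex[of "\<lambda>v. \<exists>q. P q = v"] by (auto simp: q_def)
  obtain q' where q': "q' \<ge> p0 + r" "mu (X (Suc q')) (k q') = 0" using hops by blast
  define r' where "r' = q' - p0"
  have "P (Suc r') < P r'" "r \<le> r'" using mono[of r'] q' by (auto simp: r'_def)
  then have "P (Suc r') < q" using anti[of r r'] r by simp
  then show False using not_less_Least[of "P (Suc r')" "\<lambda>v. \<exists>q. P q = v"] by (auto simp: q_def)
qed

section \<open>Greedy factorizations\<close>

text \<open>
  A greedy step removes the whole of \<open>mu X k\<close>, but only at a site \<open>k\<close> whose left neighbour is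
  empty; elsewhere the quotient need not be totally nonnegative.
\<close>

definition gstep :: "int \<Rightarrow> zmat \<Rightarrow> zmat \<Rightarrow> bool" where
  "gstep k X Y \<longleftrightarrow> X \<in> Adm \<and> 0 < mu X k \<and> mu X (k - 1) = 0 \<and> Y = rw k (- mu X k) X"

definition greedy_step :: "zmat \<Rightarrow> zmat \<Rightarrow> bool" where
  "greedy_step X Y \<longleftrightarrow> (\<exists>k. gstep k X Y)"

lemma gstep_cstep: assumes "gstep k X Y" shows "cstep k (mu X k) X Y"
  using assms Adm_remove_left_end[of X k] by (simp add: gstep_def cstep_def)

lemma gstep_mu: assumes "gstep k X Y" shows "mu Y k = 0"
  using cstep_mu_same[OF gstep_cstep[OF assms] refl] by simp

lemma gstep_distinct:
  assumes "gstep k X Y" "0 < mu X l" shows "(l + 1) mod int n \<noteq> k mod int n"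
proof
  assume "(l + 1) mod int n = k mod int n"
  then have "mu X l = mu X (k - 1)"
    using assms(1) by (intro mu_cong_mod) (auto simp: gstep_def mod_add_1_iff)
  then show False using assms by (simp add: gstep_def)
qed

lemma gstepI:
  assumes "X \<in> Adm" "0 < mu X k" "\<And>l. (l + 1) mod int n = k mod int n \<Longrightarrow> mu X l = 0"
    "Y = rw k (- mu X k) X"
  shows "gstep k X Y"
  using assms by (simp add: gstep_def)

lemma gstep_cong:
  assumes "gstep k X Y" "k mod int n = l mod int n" shows "gstep l X Y"
proof -
  have "(k - 1) mod int n = (l - 1) mod int n" using assms(2) by (metis mod_diff_left_eq)
  then have "mu X (k - 1) = mu X (l - 1)" "mu X k = mu X l"
    using assms mu_cong_mod[of X "k - 1" "l - 1"] mu_cong_mod[of X k l] by (auto simp: gstep_def)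
  moreover have "rw k (- mu X k) X = rw l (- mu X k) X" by (rule rw_cong_mod[OF assms(2)])
  ultimately show ?thesis using assms(1) unfolding gstep_def by metis
qed

lemma gstep_unique: "gstep k X Y \<Longrightarrow> gstep k X Y' \<Longrightarrow> Y = Y'"
  unfolding gstep_def by metis

lemma grD: assumes "greedy_step X Y" shows "X \<in> Adm" "Y \<in> Adm" "Y \<le> X" "chev_step X Y"
proof -
  obtain k where "cstep k (mu X k) X Y" using assms gstep_cstep by (auto simp: greedy_step_def)
  from cstepD[OF this] cstep_le[OF this] this
  show "X \<in> Adm" "Y \<in> Adm" "Y \<le> X" "chev_step X Y" unfolding chev_step_def by blast+
qed

text \<open>Two occupied sites with empty left neighbours are not adjacent, so their generators
  commute, and division at one leaves the other occupied with an empty left neighbour.\<close>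

lemma gstep_commute:
  assumes k: "gstep k X Y" and l: "gstep l X Z" and kl: "k mod int n \<noteq> l mod int n"
  obtains W where "gstep l Y W" "gstep k Z W"
proof
  have pos: "0 < mu X k" "0 < mu X l" "X \<in> Adm" using k l by (auto simp: gstep_def)
  note nl = gstep_distinct[OF k pos(2)] and nk = gstep_distinct[OF l pos(1)]
  define W where "W = rw l (- mu X l) Y"
  have prev: "mu Y p = 0" if "(p + 1) mod int n = l mod int n" "gstep k X Y" "gstep l X Z"
    "k mod int n \<noteq> l mod int n" "(k + 1) mod int n \<noteq> l mod int n" for p k l Y Z
  proof -
    have "mu Y p = mu X p"
    proof (rule cstep_mu_other[OF gstep_cstep[OF that(2)], symmetric])
      show "p mod int n \<noteq> k mod int n" using that(1,5) by (metis mod_add_left_eq)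
      show "(p + 1) mod int n \<noteq> k mod int n" using that(1,4) by metis
    qed
    also have "\<dots> = 0"
    proof -
      have "mu X p = mu X (l - 1)"
        using that by (intro mu_cong_mod) (auto simp: gstep_def mod_add_1_iff)
      then show ?thesis using that by (simp add: gstep_def)
    qed
    finally show ?thesis .
  qed
  have "mu Y l = mu X l" using cstep_mu_other[OF gstep_cstep[OF k], of l] kl nl by metis
  then show "gstep l Y W"
    using cstepD(2)[OF gstep_cstep[OF k]] pos prev[OF _ k l kl nk]
    by (intro gstepI) (auto simp: W_def)
  have "mu Z k = mu X k" using cstep_mu_other[OF gstep_cstep[OF l], of k] kl nk by metis
  moreover have "W = rw k (- mu X k) Z"
    using k l rw_commute[OF nl nk, of "- mu X l" "- mu X k" X] by (simp add: W_def gstep_def)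
  ultimately show "gstep k Z W"
    using cstepD(2)[OF gstep_cstep[OF l]] pos prev[OF _ l k kl[symmetric] nl]
    by (intro gstepI) auto
qed

definition gchain :: "(nat \<Rightarrow> zmat) \<Rightarrow> bool" where
  "gchain Z \<longleftrightarrow> (\<forall>p. greedy_step (Z p) (Z (Suc p)))"

definition greedy_lim :: "zmat \<Rightarrow> zmat \<Rightarrow> bool" where
  "greedy_lim X R \<longleftrightarrow> (\<exists>Z. Z 0 = X \<and> gchain Z \<and> zmat_lim Z R)"

lemma gchain_Adm: "gchain Z \<Longrightarrow> Z p \<in> Adm"
  using grD(1) by (auto simp: gchain_def)

lemma gchain_mu_tendsto_0: assumes "gchain Z" shows "(\<lambda>p. mu (Z p) i) \<longlonglongrightarrow> 0"
proof -
  obtain k where k: "\<And>p. gstep (k p) (Z p) (Z (Suc p))"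
    using assms unfolding gchain_def greedy_step_def by metis
  show ?thesis
    by (rule mu_tendsto_0[where k = k and t = "\<lambda>p. mu (Z p) (k p)"])
      (use gstep_cstep[OF k] gstep_mu[OF k] in auto)
qed

lemma gchain_antimono: assumes "gchain Z" "p \<le> q" shows "Z q \<le> Z p"
  using lift_Suc_antimono_le[of Z p q] assms grD(3) unfolding gchain_def by blast

lemma gchain_lim_le:
  assumes "gchain Z" "zmat_lim Z R" shows "R \<le> Z p"
  unfolding le_fun_def
proof (intro allI)
  fix i j
  have "(\<lambda>q. Z q i j) \<longlonglongrightarrow> R i j" using assms(2) by (simp add: zmat_lim_def)
  moreover have "\<forall>q\<ge>p. Z q i j \<le> Z p i j"
    using gchain_antimono[OF assms(1)] by (auto simp: le_fun_def)
  ultimately show "R i j \<le> Z p i j" by (meson LIMSEQ_le_const2)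
qed

lemma gchain_convergent: assumes "gchain Z" obtains R where "zmat_lim Z R"
proof -
  have "\<exists>L. (\<lambda>p. Z p i j) \<longlonglongrightarrow> L" for i j
  proof -
    have "decseq (\<lambda>p. Z p i j)"
      using gchain_antimono[OF assms] by (auto simp: decseq_def le_fun_def)
    then show ?thesis
      using decseq_convergent[of "\<lambda>p. Z p i j" 0] AdmD(6)[OF gchain_Adm[OF assms]] by metis
  qed
  then obtain R where "\<And>i j. (\<lambda>p. Z p i j) \<longlonglongrightarrow> R i j" by metis
  then show ?thesis using that unfolding zmat_lim_def by blast
qed

lemma gchain_Suc: "gchain Z \<Longrightarrow> gchain (\<lambda>p. Z (p + m))"
  by (simp add: gchain_def)

lemma zmat_lim_shift: "zmat_lim Z R \<Longrightarrow> zmat_lim (\<lambda>p. Z (p + m)) R"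
  unfolding zmat_lim_def using LIMSEQ_ignore_initial_segment by fast

lemma zmat_lim_shift_iff: "zmat_lim (\<lambda>p. Z (p + m)) R \<longleftrightarrow> zmat_lim Z R"
  unfolding zmat_lim_def using LIMSEQ_ignore_initial_segment LIMSEQ_offset by fast

lemma greedy_limI:
  assumes "Z 0 = X" "\<And>p. gstep (l p) (Z p) (Z (Suc p))" "zmat_lim Z R" shows "greedy_lim X R"
  unfolding greedy_lim_def gchain_def greedy_step_def using assms by blast

lemma greedy_lim_cons: assumes "greedy_step X Y" "greedy_lim Y R" shows "greedy_lim X R"
proof -
  obtain Z where Z: "Z 0 = Y" "gchain Z" "zmat_lim Z R" using assms(2) by (auto simp: greedy_lim_def)
  let ?Z = "case_nat X Z"
  have "gchain ?Z"
    using Z assms(1) by (auto simp: gchain_def split: nat.split)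
  moreover have "zmat_lim ?Z R" using Z(3) zmat_lim_shift_iff[of ?Z 1 R] by simp
  ultimately show ?thesis by (auto simp: greedy_lim_def intro!: exI[of _ ?Z])
qed

lemma greedy_lim_le: "greedy_lim X R \<Longrightarrow> R \<le> X"
  using gchain_lim_le[of _ R 0] by (auto simp: greedy_lim_def)

lemma gchain_letter_occurs:
  assumes Z: "\<And>p. gstep (l p) (Z p) (Z (Suc p))" and k: "gstep k (Z 0) X'"
  shows "\<exists>p. l p mod int n = k mod int n"
proof (rule ccontr)
  assume "\<nexists>p. l p mod int n = k mod int n"
  then have ne: "l p mod int n \<noteq> k mod int n" for p by blast
  have "mu (Z p) k = mu (Z 0) k \<and> mu (Z p) (k - 1) = 0" for p
  proof (induction p)
    case 0
    then show ?case using k by (simp add: gstep_def)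
  next
    case (Suc p)
    have pos: "0 < mu (Z p) k" using Suc k by (simp add: gstep_def)
    have "(k + 1) mod int n \<noteq> l p mod int n" by (rule gstep_distinct[OF Z pos])
    then have "mu (Z (Suc p)) k = mu (Z p) k"
      using cstep_mu_other[OF gstep_cstep[OF Z], of k p] ne[of p] by metis
    moreover have "mu (Z (Suc p)) (k - 1) = mu (Z p) (k - 1)"
    proof (rule cstep_mu_other[OF gstep_cstep[OF Z], symmetric])
      show "(k - 1) mod int n \<noteq> l p mod int n"
      proof
        assume "(k - 1) mod int n = l p mod int n"
        then have "mu (Z p) (k - 1) = mu (Z p) (l p)"
          using Z[of p] by (intro mu_cong_mod) (auto simp: gstep_def)
        then show False using Suc Z[of p] by (simp add: gstep_def)
      qed
      show "(k - 1 + 1) mod int n \<noteq> l p mod int n" using ne[of p] by simp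
    qed
    ultimately show ?case using Suc by simp
  qed
  then have "(\<lambda>p. mu (Z p) k) = (\<lambda>p. mu (Z 0) k)" by auto
  moreover have "gchain Z" using Z by (auto simp: gchain_def greedy_step_def)
  ultimately have "(\<lambda>p. mu (Z 0) k) \<longlonglongrightarrow> 0" using gchain_mu_tendsto_0[of Z k] by simp
  then have "mu (Z 0) k = 0" by (simp add: LIMSEQ_const_iff)
  then show False using k by (simp add: gstep_def)
qed

text \<open>The letter of the given step occurs in the chain; commuting squares move it to the
  front, by induction on its position.\<close>

lemma greedy_lim_step: assumes "greedy_lim X R" "greedy_step X X'" shows "greedy_lim X' R"
proof -
  obtain Z where Z: "Z 0 = X" "gchain Z" "zmat_lim Z R" using assms(1) by (auto simp: greedy_lim_def)
  obtain l where l: "\<And>p. gstep (l p) (Z p) (Z (Suc p))"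
    using Z(2) unfolding gchain_def greedy_step_def by metis
  obtain k where k: "gstep k X X'" using assms(2) by (auto simp: greedy_step_def)
  obtain p where p: "l p mod int n = k mod int n"
    using gchain_letter_occurs[of l Z k X'] l k Z(1) by auto
  show ?thesis using l k p Z(1,3)
  proof (induction p arbitrary: l Z X X')
    case 0
    have "X' = Z 1"
      using gstep_unique[OF gstep_cong[OF 0(1)[of 0] 0(3)]] 0(2,4) by simp
    then show ?case using 0(1) zmat_lim_shift[OF 0(5), of 1]
      by (intro greedy_limI[of "\<lambda>p. Z (p + 1)" _ "\<lambda>p. l (p + 1)"]) auto
  next
    case (Suc p)
    show ?case
    proof (cases "k mod int n = l 0 mod int n")
      case True
      have "X' = Z 1"
        using gstep_unique[OF gstep_cong[OF Suc.prems(1)[of 0] True[symmetric]]] Suc.prems by simp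
      then show ?thesis using Suc.prems(1) zmat_lim_shift[OF Suc.prems(5), of 1]
        by (intro greedy_limI[of "\<lambda>p. Z (p + 1)" _ "\<lambda>p. l (p + 1)"]) auto
    next
      case False
      have l0: "gstep (l 0) X (Z 1)" using Suc.prems(1)[of 0] Suc.prems(4) by simp
      obtain W where W: "gstep (l 0) X' W" "gstep k (Z 1) W"
        using gstep_commute[OF Suc.prems(2) l0 False] .
      have "greedy_lim W R"
        by (rule Suc.IH[of "\<lambda>p. l (p + 1)" "\<lambda>p. Z (p + 1)"])
          (use W Suc.prems zmat_lim_shift[OF Suc.prems(5), of 1] in auto)
      then show ?thesis using W(1) greedy_lim_cons by (auto simp: greedy_step_def)
    qed
  qed
qed

text \<open>Each limit remains a limit for all members of the other chain, hence lies below them and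
  below their limit.\<close>

lemma greedy_lim_unique: assumes "greedy_lim X R" "greedy_lim X R'" shows "R = R'"
proof -
  have "R \<le> R'" if lim: "greedy_lim X R" "greedy_lim X R'" for R R'
  proof -
    obtain Z where Z: "Z 0 = X" "gchain Z" "zmat_lim Z R'" using lim(2) by (auto simp: greedy_lim_def)
    have "greedy_lim (Z p) R" for p
      by (induction p) (use Z lim(1) greedy_lim_step in \<open>auto simp: gchain_def\<close>)
    then have le: "R i j \<le> Z p i j" for i j p using greedy_lim_le by (auto simp: le_fun_def)
    show "R \<le> R'"
      unfolding le_fun_def
    proof (intro allI)
      fix i j
      have "(\<lambda>p. Z p i j) \<longlonglongrightarrow> R' i j" using Z(3) by (simp add: zmat_lim_def)
      then show "R i j \<le> R' i j" by (rule LIMSEQ_le_const) (use le in blast)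
    qed
  qed
  then show ?thesis using assms by (simp add: order_antisym)
qed

text \<open>
  The third case rests on the braid relation
  \<open>e\<^sub>k(A) e\<^sub>k\<^sub>+\<^sub>1(B) e\<^sub>k(C) = e\<^sub>k\<^sub>+\<^sub>1(BC/(A+C)) e\<^sub>k(A+C) e\<^sub>k\<^sub>+\<^sub>1(AB/(A+C))\<close>.
\<close>

lemma gr_cst_diamond:
  assumes g: "greedy_step X X2" and c: "chev_step X X1"
  obtains "X1 = X2 \<or> greedy_step X1 X2"
  | X3 where "greedy_step X1 X3" "chev_step X2 X3"
  | X3 X4 X5 where "greedy_step X2 X3" "chev_step X3 X4" "greedy_step X1 X5" "greedy_step X5 X4"
proof -
  obtain k where k: "gstep k X X2" using g by (auto simp: greedy_step_def)
  obtain i a where i: "cstep i a X X1" using c by (auto simp: chev_step_def)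
  note D = cstepD[OF i]
  have X: "X \<in> Adm" "0 < mu X k" "mu X (k - 1) = 0" "X2 = rw k (- mu X k) X"
    using k by (auto simp: gstep_def)
  have X2: "X2 \<in> Adm" using cstepD(2)[OF gstep_cstep[OF k]] .
  have X1: "X1 = rw i (- a) X" by (simp add: D(4))
  have "0 < mu X i" using cstep_mu_same[OF i refl] mu_nonneg[OF D(2), of i] D(3) by simp
  then have ik1: "(i + 1) mod int n \<noteq> k mod int n" by (rule gstep_distinct[OF k])
  consider "i mod int n = k mod int n" | "i mod int n = (k + 1) mod int n" "i mod int n \<noteq> k mod int n"
    | "i mod int n \<noteq> k mod int n" "i mod int n \<noteq> (k + 1) mod int n" by blast
  then show thesis
  proof cases
    case 1
    have muk: "mu X k = mu X1 k + a" by (rule cstep_mu_same[OF i 1[symmetric]])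
    show thesis
    proof (cases "mu X1 k = 0")
      case True
      then have "X1 = X2" using X1 X(4) muk rw_cong_mod[OF 1] by simp
      then show thesis using that(1) by blast
    next
      case False
      then have "0 < mu X1 k" using mu_nonneg[OF D(2), of k] by simp
      have "mu X1 l = 0" if l: "(l + 1) mod int n = k mod int n" for l
      proof -
        have "mu X l = mu X (k - 1)" using X l by (intro mu_cong_mod) (auto simp: mod_add_1_iff)
        then have "mu X1 l * (mu X1 i / (mu X1 i + a)) = 0"
          using cstep_mu_prev[OF i, of l] l 1 X(3) by simp
        then show ?thesis using mu_cong_mod[OF D(2) 1] \<open>0 < mu X1 k\<close> D(3) by simp
      qed
      moreover have "X2 = rw k (- mu X1 k) X1"
        using X(4) X1 rw_cong_mod[OF 1] muk by (simp add: rw_rw)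
      ultimately have "greedy_step X1 X2"
        unfolding greedy_step_def using D(2) \<open>0 < mu X1 k\<close> by (blast intro: gstepI)
      then show thesis using that(1) by blast
    qed
  next
    case 3
    have ki: "k mod int n \<noteq> i mod int n" "(k + 1) mod int n \<noteq> i mod int n" using 3 by metis+
    have muk: "mu X1 k = mu X k" using cstep_mu_other[OF i ki] by simp
    define X3 where "X3 = rw k (- mu X k) X1"
    have "mu X1 l = 0" if l: "(l + 1) mod int n = k mod int n" for l
    proof -
      have "l mod int n \<noteq> i mod int n" using l ik1 by (metis mod_add_left_eq)
      then have "mu X1 l = mu X l" using cstep_mu_other[OF i, of l] l ki by metis
      also have "mu X l = mu X (k - 1)" using X l by (intro mu_cong_mod) (auto simp: mod_add_1_iff)
      finally show ?thesis using X by simp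
    qed
    then have g3: "gstep k X1 X3" using X muk D(2) by (intro gstepI) (auto simp: X3_def)
    moreover have "X2 = rw i a X3"
      unfolding X(4) X3_def D(4) using rw_commute[OF ki(2) ik1] by simp
    ultimately show thesis
      using that(2)[of X3] cstepD(2)[OF gstep_cstep[OF g3]] X2 D(3)
      by (auto simp: greedy_step_def chev_step_def cstep_def)
  next
    case 2
    let ?m = "\<lambda>p. p mod int n"
    \<comment> \<open>This excludes \<open>n = 2\<close>, where the two generators satisfy no braid
      relation.\<close>
    have k2: "?m (k + 1 + 1) \<noteq> ?m k" using ik1 2(1) by (metis mod_add_left_eq)
    have k1: "?m (k + 1) \<noteq> ?m k" using mod_succ_neq by blast
    have k2': "?m (k + 1 + 1) \<noteq> ?m (k + 1)" using mod_succ_neq by blast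
    have c: "cstep (k + 1) a X X1" using i unfolding cstep_def rw_cong_mod[OF 2(1)] .
    have X1: "X1 = rw (k + 1) (- a) X" using X1 rw_cong_mod[OF 2(1)] by simp
    \<comment> \<open>The braid relation is applied with \<open>A = t\<close>, \<open>B = s\<close>
      and \<open>C = t * a / s1\<close>. Since \<open>s = s1 + a\<close>, this gives
      \<open>A + C = t * s / s1\<close>, and the two outer parameters on the other side are
      \<open>a\<close> and \<open>s1\<close>.\<close>
    define t s s1 where "t = mu X k" "s = mu X (k + 1)" "s1 = mu X1 (k + 1)"
    have s: "s = s1 + a" using cstep_mu_same[OF c refl] by (simp add: t_s_s1_def)
    have t: "t = mu X1 k * (s1 / (s1 + a))"
      using cstep_mu_prev[OF c refl] by (simp add: t_s_s1_def)
    have t0: "0 < t" using X(2) by (simp add: t_s_s1_def)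
    then have s1: "0 < s1"
      using t mu_nonneg[OF D(2), of "k + 1"] by (cases "s1 = 0") (auto simp: t_s_s1_def)
    have muk: "mu X1 k = t * s / s1" using t s s1 D(3) by simp
    have prev: "mu Y l = 0" if "?m (l + 1) = ?m k" "cstep (k + 1) b X Y" for l Y b
    proof -
      have "?m l \<noteq> ?m (k + 1)" using that(1) k2 by (metis mod_add_left_eq)
      then have "mu Y l = mu X l" using cstep_mu_other[OF that(2), of l] that(1) k1 by metis
      also have "mu X l = mu X (k - 1)" using X that(1) by (intro mu_cong_mod) (auto simp: mod_add_1_iff)
      finally show ?thesis using X by simp
    qed
    define X5 where "X5 = rw k (- (t * s / s1)) X1"
    have g5: "gstep k X1 X5"
      using D(2) muk t0 s s1 D(3) prev[OF _ c] by (intro gstepI) (auto simp: X5_def)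
    define X4 where "X4 = rw (k + 1) (- s1) X5"
    have "mu X5 (k + 1) = s1"
      using cstep_mu_other[OF gstep_cstep[OF g5] k1 k2] by (simp add: t_s_s1_def)
    moreover have "mu X5 l = 0" if "?m (l + 1) = ?m (k + 1)" for l
      using gstep_mu[OF g5] mu_cong_mod[OF cstepD(2)[OF gstep_cstep[OF g5]], of l k] that by simp
    ultimately have g4: "gstep (k + 1) X5 X4"
      using cstepD(2)[OF gstep_cstep[OF g5]] s1 by (intro gstepI) (auto simp: X4_def)
    define X3 where "X3 = rw (k + 1) (- s) X2"
    have "mu X2 (k + 1) = s"
      using cstep_mu_other[OF gstep_cstep[OF k] k1 k2] by (simp add: t_s_s1_def)
    moreover have "mu X2 l = 0" if "?m (l + 1) = ?m (k + 1)" for l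
      using gstep_mu[OF k] mu_cong_mod[OF X2, of l k] that by simp
    ultimately have g3: "gstep (k + 1) X2 X3"
      using X2 s s1 D(3) by (intro gstepI) (auto simp: X3_def)
    have "X3 = rw k (t * a / s1) X4"
    proof (intro ext)
      fix p q
      have eq: "t - t * s / s1 + t * a / s1 = 0" "t * s / s1 * a = t * a / s1 * s"
        using s s1 by (simp_all add: field_simps)
      consider "?m p = ?m k" | "?m p = ?m (k + 1)" "?m p \<noteq> ?m k" | "?m p \<noteq> ?m k" "?m p \<noteq> ?m (k + 1)"
        by blast
      then show "X3 p q = rw k (t * a / s1) X4 p q"
      proof cases
        case 1
        have m: "?m (p + 1) = ?m (k + 1)" "?m p \<noteq> ?m (k + 1)" "?m (p + 1) \<noteq> ?m k"
          "?m (p + 1 + 1) \<noteq> ?m k" "?m (p + 1 + 1) \<noteq> ?m (k + 1)"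
          using 1 k1 k2 k2' by (metis mod_add_left_eq)+
        show ?thesis
          unfolding X3_def X4_def X5_def X1 X(4) t_s_s1_def(1)[symmetric]
          unfolding rw_hit[OF 1] rw_hit[OF m(1)] rw_miss[OF m(2)] rw_miss[OF m(3)]
            rw_miss[OF m(4)] rw_miss[OF m(5)]
          using s s1 by (simp add: field_simps)
      next
        case 2
        have m: "?m (p + 1) \<noteq> ?m k" "?m (p + 1) \<noteq> ?m (k + 1)"
          using 2 k2 k2' by (metis mod_add_left_eq)+
        show ?thesis
          unfolding X3_def X4_def X5_def X1 X(4) t_s_s1_def(1)[symmetric]
          unfolding rw_hit[OF 2(1)] rw_miss[OF 2(2)] rw_miss[OF m(1)] rw_miss[OF m(2)]
          using s by (simp add: algebra_simps)
      next
        case 3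
        then show ?thesis
          unfolding X3_def X4_def X5_def X1 X(4) by (simp add: rw_def)
      qed
    qed
    then have "chev_step X3 X4"
      using cstepD(2)[OF gstep_cstep[OF g3]] cstepD(2)[OF gstep_cstep[OF g4]] t0 D(3) s1
      by (auto simp: chev_step_def cstep_def intro!: exI[of _ k] exI[of _ "t * a / s1"])
    then show thesis using that(3) g3 g4 g5 by (auto simp: greedy_step_def)
  qed
qed


section \<open>Invariance of the greedy limit under Chevalley division\<close>

lemma greedy_lim_gr: "greedy_lim X R \<Longrightarrow> \<exists>Y. greedy_step X Y"
  by (auto simp: greedy_lim_def gchain_def)

lemma cst_le_sum_mu:
  assumes "cstep i a X Y" shows "a \<le> (\<Sum>d<n. mu X (int d))"
proof -
  note D = cstepD[OF assms]
  define d where "d = nat (i mod int n)"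
  have d: "d < n" "int d mod int n = i mod int n" using n_ge_2 by (auto simp: d_def nat_less_iff)
  have "a \<le> mu X (int d)"
    using cstep_mu_same[OF assms d(2)] mu_nonneg[OF D(2), of "int d"] by simp
  also have "\<dots> \<le> (\<Sum>d<n. mu X (int d))"
    using d(1) mu_nonneg[OF D(1)] by (intro member_le_sum) auto
  finally show ?thesis .
qed

text \<open>
  Run greedy steps on \<open>Z\<close> and on its quotient \<open>Y\<close> in parallel, using the diamond property. In its
  braid case both sides take two steps; the second disjunct records that the second of them is due.
\<close>

definition paired :: "zmat \<Rightarrow> zmat \<Rightarrow> zmat \<Rightarrow> bool" where
  "paired R Z Y \<longleftrightarrow> greedy_lim Z R \<and>
     (chev_step Z Y \<or> (\<exists>Z' Y'. greedy_step Z Z' \<and> greedy_step Y Y' \<and> chev_step Z' Y'))"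

lemma paired_step:
  assumes p: "paired R Z Y" and Y: "\<not> greedy_lim Y R"
  shows "\<exists>Z' Y'. greedy_step Z Z' \<and> greedy_step Y Y' \<and> paired R Z' Y' \<and> \<not> greedy_lim Y' R \<and> (chev_step Z Y \<or> chev_step Z' Y')"
proof -
  have key: ?thesis if "greedy_step Z Z'" "greedy_step Y Y'" "paired R Z' Y'" "chev_step Z Y \<or> chev_step Z' Y'" for Z' Y'
    using that greedy_lim_cons Y by blast
  have lim: "greedy_lim Z R" using p by (simp add: paired_def)
  consider "chev_step Z Y" | Z' Y' where "greedy_step Z Z'" "greedy_step Y Y'" "chev_step Z' Y'"
    using p by (auto simp: paired_def)
  then show ?thesis
  proof cases
    case 1
    obtain Z1 where Z1: "greedy_step Z Z1" using greedy_lim_gr[OF lim] by blast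
    have lim1: "greedy_lim Z1 R" by (rule greedy_lim_step[OF lim Z1])
    from Z1 1 show ?thesis
    proof (cases rule: gr_cst_diamond)
      case 1
      then show ?thesis using lim1 Y greedy_lim_cons by blast
    next
      case (2 Y')
      then show ?thesis using key[OF Z1, of Y'] lim1 \<open>chev_step Z Y\<close> by (auto simp: paired_def)
    next
      case (3 Z2 Y2 Y1)
      then show ?thesis using key[OF Z1, of Y1] lim1 \<open>chev_step Z Y\<close> unfolding paired_def by blast
    qed
  next
    case (2 Z' Y')
    then show ?thesis using key[of Z' Y'] greedy_lim_step[OF lim] by (auto simp: paired_def)
  qed
qed

text \<open>If the two parallel runs ever merge, \<open>Y\<close> inherits the limit. Otherwise they
  go on forever and differ by a single factor at infinitely many times; its parameter is at most the
  sum of the ratios, which tends to zero, so the limits agree after all.\<close>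

lemma greedy_lim_cst: assumes lim: "greedy_lim Z R" and c: "chev_step Z Y" shows "greedy_lim Y R"
proof (rule ccontr)
  assume not: "\<not> greedy_lim Y R"
  \<comment> \<open>The last clause pins down the start of the sequence obtained by dependent
    choice.\<close>
  define P where "P m x \<longleftrightarrow> paired R (fst x) (snd x) \<and> \<not> greedy_lim (snd x) R \<and> (m = 0 \<longrightarrow> x = (Z, Y))"
    for m :: nat and x
  define Q where "Q m x y \<longleftrightarrow> greedy_step (fst x) (fst y) \<and> greedy_step (snd x) (snd y) \<and>
    (chev_step (fst x) (snd x) \<or> chev_step (fst y) (snd y))" for m :: nat and x y
  have "\<exists>f. \<forall>m. P m (f m) \<and> Q m (f m) (f (Suc m))"
  proof (rule dependent_nat_choice)
    show "\<exists>x. P 0 x" using lim c not by (auto simp: P_def paired_def)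
    fix x m assume "P m x"
    then obtain Z' Y' where "greedy_step (fst x) Z'" "greedy_step (snd x) Y'" "paired R Z' Y'" "\<not> greedy_lim Y' R"
      "chev_step (fst x) (snd x) \<or> chev_step Z' Y'"
      using paired_step[of R "fst x" "snd x"] by (auto simp: P_def)
    then show "\<exists>y. P (Suc m) y \<and> Q m x y"
      by (intro exI[of _ "(Z', Y')"]) (auto simp: P_def Q_def)
  qed
  then obtain f where f: "\<And>m. P m (f m)" "\<And>m. Q m (f m) (f (Suc m))" by blast
  define Zs Ys where "Zs m = fst (f m)" "Ys m = snd (f m)" for m
  have f0: "Zs 0 = Z" "Ys 0 = Y" using f(1)[of 0] by (auto simp: P_def Zs_Ys_def)
  have chZ: "gchain Zs" and chY: "gchain Ys"
    using f(2) by (auto simp: gchain_def Q_def Zs_Ys_def)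
  obtain R1 where R1: "zmat_lim Zs R1" using gchain_convergent[OF chZ] .
  obtain R2 where R2: "zmat_lim Ys R2" using gchain_convergent[OF chY] .
  have "R1 = R"
    using greedy_lim_unique[of Z R1 R] lim chZ R1 f0 unfolding greedy_lim_def by blast
  have "\<exists>q\<ge>m. chev_step (Zs q) (Ys q)" for m
    using f(2)[of m] by (auto simp: Q_def Zs_Ys_def intro: exI[of _ m] exI[of _ "Suc m"])
  then obtain g where g: "\<And>m. m \<le> g m" "\<And>m. chev_step (Zs (g m)) (Ys (g m))" by metis
  have g_lim: "filterlim g sequentially sequentially"
    by (rule filterlim_at_top_mono[OF filterlim_ident]) (simp add: g(1))
  define v where "v m = (\<Sum>d<n. mu (Zs m) (int d))" for m
  have v: "v \<longlonglongrightarrow> 0"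
    unfolding v_def using tendsto_sum[of "{..<n}" "\<lambda>d m. mu (Zs m) (int d)" "\<lambda>_. 0" sequentially]
      gchain_mu_tendsto_0[OF chZ] by simp
  have bound: "Zs (g m) i j - v (g m) * Z (i + 1) j \<le> Ys (g m) i j \<and> Ys (g m) i j \<le> Zs (g m) i j"
    for m i j
  proof -
    obtain l a where c: "cstep l a (Zs (g m)) (Ys (g m))" using g(2)[of m] by (auto simp: chev_step_def)
    note D = cstepD[OF c]
    have le: "Ys (g m) \<le> Zs (g m)" by (rule cstep_le[OF c])
    have "Zs (g m) i j \<le> Ys (g m) i j + a * Ys (g m) (i + 1) j"
      using D(3) AdmD(6)[OF D(2)] by (subst D(4)) (simp add: rw_def)
    also have "a * Ys (g m) (i + 1) j \<le> v (g m) * Z (i + 1) j"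
    proof (rule mult_mono)
      show "a \<le> v (g m)" unfolding v_def by (rule cst_le_sum_mu[OF c])
      have "Zs (g m) \<le> Zs 0" by (rule gchain_antimono[OF chZ]) simp
      then show "Ys (g m) (i + 1) j \<le> Z (i + 1) j"
        using le f0 by (metis le_fun_def order_trans)
      show "0 \<le> v (g m)" unfolding v_def using mu_nonneg[OF D(1)] by (intro sum_nonneg) auto
      show "0 \<le> Ys (g m) (i + 1) j" using AdmD(6)[OF D(2)] .
    qed
    finally show ?thesis using le by (simp add: le_fun_def)
  qed
  have "R2 i j = R i j" for i j
  proof (rule LIMSEQ_unique)
    show "(\<lambda>m. Ys (g m) i j) \<longlonglongrightarrow> R2 i j"
      using filterlim_compose[OF _ g_lim, of "\<lambda>m. Ys m i j"] R2 by (simp add: zmat_lim_def)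
    have Z: "(\<lambda>m. Zs (g m) i j) \<longlonglongrightarrow> R i j"
      using filterlim_compose[OF _ g_lim, of "\<lambda>m. Zs m i j"] R1 \<open>R1 = R\<close> by (simp add: zmat_lim_def)
    have "(\<lambda>m. Zs (g m) i j - v (g m) * Z (i + 1) j) \<longlonglongrightarrow> R i j - 0 * Z (i + 1) j"
      by (intro tendsto_intros Z filterlim_compose[OF v g_lim])
    then have "(\<lambda>m. Zs (g m) i j - v (g m) * Z (i + 1) j) \<longlonglongrightarrow> R i j" by simp
    then show "(\<lambda>m. Ys (g m) i j) \<longlonglongrightarrow> R i j"
      by (rule tendsto_sandwich[rotated 2]) (use Z bound in auto)
  qed
  then have "R2 = R" by (intro ext)
  then show False using not R2 chY f0 unfolding greedy_lim_def by blast
qed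

section \<open>Greedy division that stops\<close>

definition terminal :: "zmat \<Rightarrow> bool" where
  "terminal W \<longleftrightarrow> W \<in> Adm \<and> (\<forall>i. mu W i = 0)"

lemma gr_if_not_terminal: assumes "W \<in> Adm" "\<not> terminal W" shows "\<exists>V. greedy_step W V"
proof -
  obtain i where "0 < mu W i" using assms mu_nonneg[OF assms(1)] by (force simp: terminal_def less_le)
  then show ?thesis using Adm_left_end[OF assms(1)] assms(1) unfolding greedy_step_def gstep_def by blast
qed

lemma terminal_no_gr: "terminal W \<Longrightarrow> \<not> greedy_step W V"
  by (auto simp: terminal_def greedy_step_def gstep_def)

lemma terminal_no_cst: assumes "terminal W" shows "\<not> chev_step W V"
proof
  assume "chev_step W V"
  then obtain i a where c: "cstep i a W V" by (auto simp: chev_step_def)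
  then have "mu W i = mu V i + a" by (intro cstep_mu_same) auto
  then show False
    using assms mu_nonneg[OF cstepD(2)[OF c], of i] cstepD(3)[OF c] by (simp add: terminal_def)
qed

text \<open>Any available step can be commuted to the front of the path, saving exactly one step;
  the exact count drives the induction in \<open>terminal_path_cst\<close>.\<close>

lemma terminal_path_gr:
  assumes "(greedy_step ^^ q) X W" "terminal W" "greedy_step X X'"
  shows "\<exists>r. q = Suc r \<and> (greedy_step ^^ r) X' W"
  using assms
proof (induction q arbitrary: X X')
  case 0
  then show ?case using terminal_no_gr by auto
next
  case (Suc q)
  obtain X1 where X1: "greedy_step X X1" "(greedy_step ^^ q) X1 W" using relpowp_Suc_E2[OF Suc.prems(1)] by blast
  obtain k l where kl: "gstep k X X1" "gstep l X X'" using X1 Suc.prems by (auto simp: greedy_step_def)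
  show ?case
  proof (cases "k mod int n = l mod int n")
    case True
    then have "X1 = X'" using gstep_unique[OF gstep_cong[OF kl(1) True] kl(2)] by simp
    then show ?thesis using X1 by auto
  next
    case False
    obtain V where V: "gstep l X1 V" "gstep k X' V" using gstep_commute[OF kl False] .
    then have "greedy_step X1 V" "greedy_step X' V" unfolding greedy_step_def by blast+
    moreover from this obtain r where "q = Suc r" "(greedy_step ^^ r) V W"
      using Suc.IH[OF X1(2) Suc.prems(2), of V] by blast
    ultimately show ?thesis using relpowp_Suc_I2[of greedy_step X' V r W] by auto
  qed
qed

text \<open>Induction on the length of the path. In the braid case the comparison resumes two greedy
  steps later, where \<open>terminal_path_gr\<close> provides a path shorter by two.\<close>

lemma terminal_path_cst:
  assumes "(greedy_step ^^ q) X W" "terminal W" "chev_step X X1"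
  shows "greedy_step\<^sup>*\<^sup>* X1 W"
  using assms
proof (induction q arbitrary: X X1 rule: less_induct)
  case (less q)
  show ?case
  proof (cases q)
    case 0
    then show ?thesis using less.prems terminal_no_cst by auto
  next
    case (Suc r)
    obtain X2 where X2: "greedy_step X X2" "(greedy_step ^^ r) X2 W"
      using relpowp_Suc_E2 less.prems(1) unfolding Suc by metis
    from X2(1) less.prems(3) show ?thesis
    proof (cases rule: gr_cst_diamond)
      case 1
      then show ?thesis using relpowp_imp_rtranclp[OF X2(2)] by (auto intro: converse_rtranclp_into_rtranclp)
    next
      case (2 X3)
      then show ?thesis using less.IH[OF _ X2(2) less.prems(2), of X3] Suc
        by (auto intro: converse_rtranclp_into_rtranclp)
    next
      case (3 X3 X4 X5)
      obtain s where s: "r = Suc s" "(greedy_step ^^ s) X3 W"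
        using terminal_path_gr[OF X2(2) less.prems(2) 3(1)] by blast
      then have "greedy_step\<^sup>*\<^sup>* X4 W" using less.IH[OF _ s(2) less.prems(2) 3(2)] Suc by simp
      then show ?thesis using 3 by (blast intro: converse_rtranclp_into_rtranclp)
    qed
  qed
qed

lemma gr_path_Adm: "greedy_step\<^sup>*\<^sup>* X W \<Longrightarrow> X \<in> Adm \<Longrightarrow> W \<in> Adm \<and> W \<le> X"
  by (induction rule: rtranclp_induct) (auto dest: grD(2,3) intro: order_trans)

lemma greedy_lim_or_terminal:
  assumes "X \<in> Adm" shows "(\<exists>R. greedy_lim X R) \<or> (\<exists>W. terminal W \<and> greedy_step\<^sup>*\<^sup>* X W)"
proof (rule disjCI)
  assume not: "\<not> (\<exists>W. terminal W \<and> greedy_step\<^sup>*\<^sup>* X W)"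
  have "\<exists>f. \<forall>m. (greedy_step\<^sup>*\<^sup>* X (f m) \<and> (m = 0 \<longrightarrow> f m = X)) \<and> greedy_step (f m) (f (Suc m))"
  proof (rule dependent_nat_choice)
    fix V and m :: nat assume V: "greedy_step\<^sup>*\<^sup>* X V \<and> (m = 0 \<longrightarrow> V = X)"
    then have "V \<in> Adm" "\<not> terminal V" using gr_path_Adm assms not by auto
    then obtain V' where "greedy_step V V'" using gr_if_not_terminal by blast
    then show "\<exists>V'. (greedy_step\<^sup>*\<^sup>* X V' \<and> (Suc m = 0 \<longrightarrow> V' = X)) \<and> greedy_step V V'"
      using V by (auto intro: rtranclp.rtrancl_into_rtrancl)
  qed auto
  then obtain f where f: "f 0 = X" "gchain f" unfolding gchain_def by blast
  obtain R where "zmat_lim f R" using gchain_convergent[OF f(2)] .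
  then show "\<exists>R. greedy_lim X R" using f unfolding greedy_lim_def by blast
qed

section \<open>Infinite products are exhausted by greedy steps\<close>

abbreviation fcp :: "zmat set" where
  "fcp \<equiv> finite_chevalley_products n"

text \<open>The last generator is absorbed into \<open>X'\<close> before the induction hypothesis is
  used; a zero parameter yields no step.\<close>

lemma fcp_cst:
  assumes "F \<in> fcp" "F \<star> X' \<in> Adm" "X' \<in> U_nonneg n"
  shows "X' \<in> Adm \<and> chev_step\<^sup>*\<^sup>* (F \<star> X') X'"
proof -
  obtain m w a where F: "\<forall>k<m. 0 \<le> a k" "F = partial_prod (\<lambda>k. chevalley n (w k) (a k)) m"
    using assms(1) by (auto simp: finite_chevalley_products_def)
  show ?thesis using F assms(2,3)
  proof (induction m arbitrary: F X')
    case 0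
    then show ?case using U_nonnegD(2) by simp
  next
    case (Suc m)
    let ?P = "partial_prod (\<lambda>k. chevalley n (w k) (a k)) m"
    let ?X = "rw (w m) (a m) X'"
    have eq: "F \<star> X' = ?P \<star> ?X"
      using Suc.prems U_nonnegD(2) by (simp add: zmult_assoc chevalley_zmult)
    have a: "0 \<le> a m" using Suc.prems by simp
    have X: "?X \<in> Adm \<and> chev_step\<^sup>*\<^sup>* (F \<star> X') ?X"
      using Suc.IH[of ?P ?X] Suc.prems eq U_nonneg_rw[OF _ a] by simp
    then have X': "X' \<in> Adm"
      using Adm_rwD[of "w m" "a m" X'] a U_nonnegD[OF Suc.prems(4)] by blast
    show ?case
    proof (cases "a m = 0")
      case True
      then show ?thesis using X by simp
    next
      case False
      then have "cstep (w m) (a m) ?X X'" using X X' a by (simp add: cstep_def)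
      then have "chev_step ?X X'" by (auto simp: chev_step_def)
      then show ?thesis using X X' by (auto intro: rtranclp.rtrancl_into_rtrancl)
    qed
  qed
qed

lemma zmat_lim_tails_le:
  assumes "zmat_lim T zid" "\<And>k. W \<le> T k" shows "W \<le> zid"
  unfolding le_fun_def
proof (intro allI)
  fix i j
  have "(\<lambda>k. T k i j) \<longlonglongrightarrow> zid i j" using assms(1) by (simp add: zmat_lim_def)
  then show "W i j \<le> zid i j"
    by (rule LIMSEQ_le_const) (use assms(2) in \<open>auto simp: le_fun_def\<close>)
qed

lemma zmat_lim_Adm_ge:
  assumes "zmat_lim Z R" "\<And>k. Z k \<in> Adm" shows "zid \<le> R"
  unfolding le_fun_def
proof (intro allI)
  fix i j
  have "(\<lambda>k. Z k i j) \<longlonglongrightarrow> R i j" using assms(1) by (simp add: zmat_lim_def)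
  moreover have "zid \<le> Z k" for k using zid_le AdmD(2,6)[OF assms(2)] by blast
  ultimately show "zid i j \<le> R i j"
    by (intro LIMSEQ_le_const[of "\<lambda>k. Z k i j"]) (auto simp: le_fun_def)
qed

text \<open>Whatever greedy division leaves lies below all tails, hence below the identity. A
  terminal matrix has positive superdiagonal and is thereby excluded, and a greedy limit is squeezed
  to the identity.\<close>

lemma greedy_lim_inf_prod:
  assumes T: "\<And>k. T k = G k \<star> T (Suc k)" and G: "\<And>k. G k \<in> fcp" and U: "\<And>k. T k \<in> U_nonneg n"
    and Adm: "T 0 \<in> Adm" and lim: "zmat_lim T zid"
  shows "greedy_lim (T 0) zid"
proof -
  have T_step: "T (Suc k) \<in> Adm \<and> chev_step\<^sup>*\<^sup>* (T k) (T (Suc k))" if "T k \<in> Adm" for k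
    using fcp_cst[OF G, of k "T (Suc k)"] that T[of k] U by simp
  have T_Adm: "T k \<in> Adm" for k by (induction k) (use Adm T_step in auto)
  have cst_path: "chev_step\<^sup>*\<^sup>* (T 0) (T k)" for k
    by (induction k) (use T_step[OF T_Adm] in \<open>auto intro: rtranclp_trans\<close>)
  have lim_path: "greedy_lim Y R" if "chev_step\<^sup>*\<^sup>* X Y" "greedy_lim X R" for X Y R
    using that by (induction rule: rtranclp_induct) (auto intro: greedy_lim_cst)
  have term_path: "greedy_step\<^sup>*\<^sup>* Y W" if "chev_step\<^sup>*\<^sup>* X Y" "greedy_step\<^sup>*\<^sup>* X W" "terminal W" for X Y W
    using that
  proof (induction rule: rtranclp_induct)
    case (step Y Z)
    then show ?case using terminal_path_cst rtranclp_imp_relpowp by metis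
  qed
  show ?thesis
    using greedy_lim_or_terminal[OF Adm]
  proof
    assume "\<exists>R. greedy_lim (T 0) R"
    then obtain R where R: "greedy_lim (T 0) R" by blast
    then have "R \<le> T k" for k using lim_path[OF cst_path] greedy_lim_le by blast
    then have "R \<le> zid" by (rule zmat_lim_tails_le[OF lim])
    moreover have "zid \<le> R"
      using R gchain_Adm zmat_lim_Adm_ge unfolding greedy_lim_def by blast
    ultimately show ?thesis using R by (simp add: order_antisym)
  next
    assume "\<exists>W. terminal W \<and> greedy_step\<^sup>*\<^sup>* (T 0) W"
    then obtain W where W: "terminal W" "greedy_step\<^sup>*\<^sup>* (T 0) W" by blast
    then have "W \<le> T k" for k
      using gr_path_Adm[OF term_path[OF cst_path] T_Adm] by blast
    then have "W \<le> zid" by (rule zmat_lim_tails_le[OF lim])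
    then have "W 0 1 \<le> zid 0 1" by (simp add: le_fun_def)
    then show ?thesis using W(1) AdmD(3)[of W 0 1] by (simp add: terminal_def zid_def)
  qed
qed

section \<open>Greedy factorizations ignore right factors\<close>

lemma zinv_zid [simp]: "zinv zid = zid"
  using zmult_zinv[of zid] zid_zmult[of "zinv zid"] by (metis upper_unipotent_zid upper_unipotent_zinv)

text \<open>This quotient is the product of the first \<open>q\<close> factors divided off.\<close>

lemma gchain_quotient_bimult: assumes "gchain Y" shows "Y 0 \<star> zinv (Y q) \<in> bimult"
proof (induction q)
  case 0
  then show ?case using AdmD(2)[OF gchain_Adm[OF assms]] zid_bimult by simp
next
  case (Suc q)
  obtain k where "gstep k (Y q) (Y (Suc q))" using assms by (auto simp: gchain_def greedy_step_def)
  from gstep_cstep[OF this] have c: "cstep k (mu (Y q) k) (Y q) (Y (Suc q))" .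
  let ?c = "chevalley n k (mu (Y q) k)"
  have uu: "upper_unipotent (Y p)" for p using AdmD(2)[OF gchain_Adm[OF assms]] .
  have Yq: "Y q = ?c \<star> Y (Suc q)" using cstepD(4)[OF c] by (simp add: chevalley_zmult[OF uu])
  have "(zinv (Y q) \<star> ?c) \<star> Y (Suc q) = zinv (Y (Suc q)) \<star> Y (Suc q)"
    using uu Yq by (simp add: zmult_assoc)
  then have "zinv (Y q) \<star> ?c = zinv (Y (Suc q))"
    by (rule zmult_right_cancel[rotated 3]) (simp_all add: uu)
  then have "Y 0 \<star> zinv (Y (Suc q)) = (Y 0 \<star> zinv (Y q)) \<star> ?c" by (simp add: zmult_assoc)
  then show ?case
    using zmult_bimult[OF Suc chevalley_bimult[of "mu (Y q) k" k]] mu_nonneg[OF cstepD(1)[OF c]] by simp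
qed

lemma gchain_quotient_lim:
  assumes "gchain Y" "zmat_lim Y zid" shows "zmat_lim (\<lambda>q. Y 0 \<star> zinv (Y q)) (Y 0)"
  unfolding zmat_lim_def
proof (intro allI)
  fix i j
  have "((\<lambda>q. (Y 0 \<star> zinv (Y q)) i j) \<longlonglongrightarrow> (Y 0 \<star> zinv zid) i j)"
    using assms(2) by (intro tendsto_zmult tendsto_zinv tendsto_const) (auto simp: zmat_lim_def)
  then show "(\<lambda>q. (Y 0 \<star> zinv (Y q)) i j) \<longlonglongrightarrow> Y 0 i j"
    using AdmD(2)[OF gchain_Adm[OF assms(1)]] by simp
qed

text \<open>Here total nonnegativity is regained: a matrix exhausted by greedy steps is the limit of
  the products of its factors.\<close>

lemma gchain_bimult: assumes "gchain Y" "zmat_lim Y zid" shows "Y p \<in> bimult"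
proof -
  have "Y 0 \<in> bimult" if "gchain Y" "zmat_lim Y zid" for Y
    by (rule bimult_limit[of "\<lambda>q. Y 0 \<star> zinv (Y q)" _ sequentially])
      (use gchain_quotient_lim[OF that] gchain_quotient_bimult[OF that(1)] in \<open>auto simp: zmat_lim_def\<close>)
  from this[OF gchain_Suc[OF assms(1)] zmat_lim_shift[OF assms(2)], of p] show ?thesis by simp
qed

lemma zmult_ge_left:
  assumes "upper_unipotent X" "upper_unipotent Z" "\<And>i j. 0 \<le> X i j" "\<And>i j. 0 \<le> Z i j"
  shows "X \<le> X \<star> Z"
proof -
  have "X \<star> zid \<le> X \<star> Z"
    using assms by (intro zmult_mono zid_le) (auto simp: zid_def)
  then show ?thesis using assms by simp
qed

lemma zmult_ge_right:
  assumes "upper_unipotent X" "upper_unipotent Z" "\<And>i j. 0 \<le> X i j" "\<And>i j. 0 \<le> Z i j"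
  shows "Z \<le> X \<star> Z"
proof -
  have "zid \<star> Z \<le> X \<star> Z"
    using assms by (intro zmult_mono zid_le) (auto simp: zid_def)
  then show ?thesis using assms by simp
qed

text \<open>The factors that exhaust \<open>Y\<close> are divided off the product. These divisions
  turn out to be greedy for the product once the ratios are known to agree.\<close>

lemma gchain_zmult_cstep:
  assumes ch: "gchain Y" and lim: "zmat_lim Y zid" and Z: "Z \<in> U_nonneg n" and ent: "entire (Y 0 \<star> Z)"
    and k: "\<And>p. gstep (k p) (Y p) (Y (Suc p))"
  shows "cstep (k p) (mu (Y p) (k p)) (Y p \<star> Z) (Y (Suc p) \<star> Z)"
proof -
  note Yadm = gchain_Adm[OF ch]
  note UZ = U_nonnegD[OF Z]
  have U: "Y p \<star> Z \<in> U_nonneg n" for p by (rule bimultD(2)[OF gchain_bimult[OF ch lim] Z])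
  have c: "cstep (k p) (mu (Y p) (k p)) (Y p) (Y (Suc p))" for p by (rule gstep_cstep[OF k])
  have rw: "Y p \<star> Z = rw (k p) (mu (Y p) (k p)) (Y (Suc p) \<star> Z)" for p
    using rw_zmult[OF AdmD(2)[OF Yadm] UZ(2)] cstepD(4)[OF c[of p]] by metis
  have "Y p \<star> Z \<in> Adm" for p
  proof (induction p)
    case 0
    have "Y 0 \<le> Y 0 \<star> Z" by (intro zmult_ge_left AdmD[OF Yadm] UZ)
    then have "0 < (Y 0 \<star> Z) i j" if "i \<le> j" for i j
      using AdmD(3)[OF Yadm that] by (auto simp: le_fun_def intro: less_le_trans)
    then show ?case using U_nonnegD[OF U] ent by (auto simp: Adm_def)
  next
    case (Suc p)
    then show ?case
      using Adm_rwD[of "k p" "mu (Y p) (k p)" "Y (Suc p) \<star> Z"] rw[of p] U_nonnegD[OF U]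
        mu_nonneg[OF Yadm] by simp
  qed
  then show ?thesis unfolding cstep_def using rw[of p] cstepD(3)[OF c] by blast
qed

text \<open>Split \<open>X i q\<close>, the sum of all \<open>A i k * V k q\<close>, at
  \<open>k = j\<close>. For \<open>k \<ge> j\<close>, minors of order two of \<open>A\<close>
  compare row \<open>i\<close> with row \<open>i + 1\<close>. For \<open>k < j\<close>, the terms
  are measured against \<open>V j q\<close>, and for \<open>q\<close> tending to infinity they
  contribute products of ratios of \<open>V\<close>, an error that is small when these ratios
  are.\<close>

lemma zmult_row_ratio:
  assumes A: "A \<in> U_nonneg n" and V: "V \<in> Adm" and X: "A \<star> V = X" "X \<in> Adm" and ij: "i < j"
  shows "mu X i * A (i + 1) j \<le>
    A i j + (\<Sum>k = i..<j. A i k * (\<Prod>l<nat (j - k). mu V (k + int l)))"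
proof -
  note nA = U_nonnegD(5)[OF A] and nV = AdmD(6)[OF V]
  have key: "mu X i * A (i + 1) j \<le> A i j + (\<Sum>k = i..<j. A i k * (V k q / V j q))" if q: "j \<le> q" for q
  proof -
    define S where "S = (\<Sum>k = i..<j. A i k * V k q)"
    define B where "B = (\<Sum>k = j..q. A (i + 1) k * V k q)"
    have S0: "0 \<le> S" unfolding S_def by (intro sum_nonneg mult_nonneg_nonneg nA nV)
    have Xi: "X i q = S + (\<Sum>k = j..q. A i k * V k q)"
    proof -
      have "{i..q} = {i..<j} \<union> {j..q}" using ij q by auto
      then show ?thesis
        unfolding X(1)[symmetric] zmult_def S_def by (simp add: sum.union_disjoint ivl_disj_int)
    qed
    have BX: "B \<le> X (i + 1) q"
      unfolding X(1)[symmetric] zmult_def B_def using ij q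
      by (intro sum_mono2 mult_nonneg_nonneg nA nV) auto
    have "A (i + 1) j * (\<Sum>k = j..q. A i k * V k q) \<le> A i j * B"
      unfolding B_def sum_distrib_left
    proof (rule sum_mono)
      fix k assume "k \<in> {j..q}"
      then have "A i k * A (i + 1) j \<le> A i j * A (i + 1) k"
        using solid_nonneg_2[OF U_nonnegD(4)[OF A], of j k i] by (cases "k = j") auto
      from mult_right_mono[OF this nV[of k q]]
      show "A (i + 1) j * (A i k * V k q) \<le> A i j * (A (i + 1) k * V k q)" by (simp add: mult_ac)
    qed
    also have "\<dots> \<le> A i j * X (i + 1) q" using BX nA by (intro mult_left_mono)
    finally have 1: "A (i + 1) j * X i q \<le> A (i + 1) j * S + A i j * X (i + 1) q"
      unfolding Xi by (simp add: algebra_simps)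
    have Vq: "0 < V j q" and Xq: "0 < X (i + 1) q" using AdmD(3)[OF V q] AdmD(3)[OF X(2)] ij q by auto
    \<comment> \<open>The summand \<open>k = j\<close> alone; it turns the remainder
      \<open>S\<close> into \<open>S / V j q\<close>, a combination of row ratios of
      \<open>V\<close>.\<close>
    have "A (i + 1) j * V j q \<le> B"
      unfolding B_def using q
      by (intro member_le_sum[of j _ "\<lambda>k. A (i + 1) k * V k q"] mult_nonneg_nonneg nA nV) auto
    then have "A (i + 1) j * V j q \<le> X (i + 1) q" using BX by simp
    then have "A (i + 1) j * V j q * S \<le> X (i + 1) q * S" using S0 by (intro mult_right_mono)
    then have 2: "A (i + 1) j * S \<le> X (i + 1) q * (S / V j q)" using Vq by (simp add: field_simps)
    have "mu X i * X (i + 1) q * A (i + 1) j \<le> X i q * A (i + 1) j"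
      using mu_le[OF X(2), of i q] nA by (intro mult_right_mono)
    also have "\<dots> \<le> X (i + 1) q * (S / V j q) + A i j * X (i + 1) q"
      using 1 2 by (simp add: mult.commute)
    finally have "X (i + 1) q * (mu X i * A (i + 1) j) \<le> X (i + 1) q * (A i j + S / V j q)"
      by (simp add: algebra_simps)
    then have "mu X i * A (i + 1) j \<le> A i j + S / V j q" using Xq by simp
    then show ?thesis by (simp add: S_def sum_divide_distrib)
  qed
  have "((\<lambda>q. A i j + (\<Sum>k = i..<j. A i k * (V k q / V j q))) \<longlongrightarrow>
      A i j + (\<Sum>k = i..<j. A i k * (\<Prod>l<nat (j - k). mu V (k + int l)))) at_top"
  proof (intro tendsto_intros)
    fix k assume "k \<in> {i..<j}"
    then show "((\<lambda>q. V k q / V j q) \<longlongrightarrow> (\<Prod>l<nat (j - k). mu V (k + int l))) at_top"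
      using tendsto_row_ratio[OF V, of k "nat (j - k)"] by simp
  qed
  then show ?thesis
    by (rule tendsto_lowerbound) (use key in \<open>auto simp: eventually_at_top_linorder\<close>)
qed

text \<open>Multiplying the inequalities for the rows of \<open>Y 0\<close> by \<open>Z\<close>
  shows that the product has ratios at least as large. Conversely, factor the product into the
  divided part, which tends to \<open>Y 0\<close>, and the rest, whose ratios tend to zero, so that
  the error in \<open>zmult_row_ratio\<close> disappears.\<close>

lemma gchain_mu_zmult:
  assumes ch: "gchain Y" and lim: "zmat_lim Y zid" and Z: "Z \<in> U_nonneg n" and ent: "entire (Y 0 \<star> Z)"
  shows "mu (Y 0 \<star> Z) i = mu (Y 0) i"
proof -
  note Yadm = gchain_Adm[OF ch]
  note UZ = U_nonnegD[OF Z]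
  obtain k where k: "\<And>p. gstep (k p) (Y p) (Y (Suc p))" using ch unfolding gchain_def greedy_step_def by metis
  define X where "X p = Y p \<star> Z" for p
  have c: "cstep (k p) (mu (Y p) (k p)) (X p) (X (Suc p))" for p
    unfolding X_def by (rule gchain_zmult_cstep[OF ch lim Z ent k])
  note Xadm = cstepD(1)[OF c]
  \<comment> \<open>If no division from \<open>p\<close> on exhausted its site, the set of empty
    sites would be frozen. An empty site \<open>z\<close> would never be divided, so
    \<open>Y q z (z + 1)\<close> would stay constant and positive, although it tends to
    zero.\<close>
  have hops: "\<exists>q\<ge>p. mu (X (Suc q)) (k q) = 0" for p
  proof (rule ccontr)
    assume "\<not> (\<exists>q\<ge>p. mu (X (Suc q)) (k q) = 0)"
    then have pos: "0 < mu (X (Suc q)) (k q)" if "p \<le> q" for q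
      using that mu_nonneg[OF Xadm, of "Suc q" "k q"] by (auto simp: less_le)
    obtain z where z: "mu (X p) z = 0" using Adm_mu_zero[OF Xadm] by blast
    have zero: "mu (X q) z = 0" if "p \<le> q" for q
      using that
    proof (induction q rule: dec_induct)
      case (step q)
      then show ?case using cstep_zero_iff[OF c pos[OF step(1)], of z] by simp
    qed (rule z)
    have const: "Y q z (z + 1) = Y p z (z + 1)" if "p \<le> q" for q
      using that
    proof (induction q rule: dec_induct)
      case (step q)
      have "z mod int n \<noteq> k q mod int n"
      proof
        assume eq: "z mod int n = k q mod int n"
        have "mu (X q) z = mu (X (Suc q)) z + mu (Y q) (k q)" by (rule cstep_mu_same[OF c eq])
        then show False
          using zero[of q] step cstepD(3)[OF c, of q] mu_nonneg[OF Xadm, of "Suc q" z] by simp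
      qed
      then have "Y (Suc q) z (z + 1) = Y q z (z + 1)"
        using cstepD(4)[OF gstep_cstep[OF k], of q] rw_miss by metis
      then show ?case using step by simp
    qed simp
    have "(\<lambda>q. Y q z (z + 1)) \<longlonglongrightarrow> Y p z (z + 1)"
      by (rule tendsto_eventually[OF eventually_sequentiallyI[of p]]) (rule const)
    moreover have "(\<lambda>q. Y q z (z + 1)) \<longlonglongrightarrow> zid z (z + 1)" using lim by (simp add: zmat_lim_def)
    ultimately have "Y p z (z + 1) = zid z (z + 1)" by (rule LIMSEQ_unique)
    then show False using AdmD(3)[OF Yadm[of p], of z "z + 1"] by (simp add: zid_def)
  qed
  have mu0: "(\<lambda>p. mu (X p) r) \<longlonglongrightarrow> 0" for r by (rule mu_tendsto_0[OF c hops])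
  define A where "A q = Y 0 \<star> zinv (Y q)" for q
  have A: "A q \<in> U_nonneg n" for q
    unfolding A_def by (rule bimultD(1)[OF gchain_quotient_bimult[OF ch]])
  have AX: "A q \<star> X q = X 0" for q
    unfolding A_def X_def using AdmD(2)[OF Yadm] UZ(2)
    by (simp add: zmult_assoc) (simp add: zmult_assoc[symmetric])
  have Alim: "(\<lambda>q. A q r s) \<longlonglongrightarrow> Y 0 r s" for r s
    unfolding A_def using gchain_quotient_lim[OF ch lim] by (simp add: zmat_lim_def)
  have le: "mu (X 0) i * Y 0 (i + 1) j \<le> Y 0 i j" if ij: "i < j" for j
  proof (rule LIMSEQ_le)
    show "(\<lambda>q. mu (X 0) i * A q (i + 1) j) \<longlonglongrightarrow> mu (X 0) i * Y 0 (i + 1) j"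
      by (intro tendsto_intros Alim)
    have "(\<lambda>q. A q i j + (\<Sum>k = i..<j. A q i k * (\<Prod>l<nat (j - k). mu (X q) (k + int l))))
        \<longlonglongrightarrow> Y 0 i j + (\<Sum>k = i..<j. Y 0 i k * (\<Prod>l<nat (j - k). 0))"
      by (intro tendsto_intros Alim mu0)
    also have "(\<Sum>k = i..<j. Y 0 i k * (\<Prod>l<nat (j - k). (0::real))) = 0"
      by (intro sum.neutral) (auto simp: power_0_left)
    finally show "(\<lambda>q. A q i j + (\<Sum>k = i..<j. A q i k * (\<Prod>l<nat (j - k). mu (X q) (k + int l))))
        \<longlonglongrightarrow> Y 0 i j" by simp
    show "\<exists>N. \<forall>q\<ge>N. mu (X 0) i * A q (i + 1) j \<le>
        A q i j + (\<Sum>k = i..<j. A q i k * (\<Prod>l<nat (j - k). mu (X q) (k + int l)))"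
      using zmult_row_ratio[OF A Xadm AX Xadm ij] by blast
  qed
  show ?thesis
  proof (rule order_antisym)
    show "mu (Y 0 \<star> Z) i \<le> mu (Y 0) i"
      using mu_greatest[OF Yadm le] by (simp add: X_def)
    show "mu (Y 0) i \<le> mu (Y 0 \<star> Z) i"
    proof (rule mu_greatest)
      show "Y 0 \<star> Z \<in> Adm" using Xadm[of 0] by (simp add: X_def)
      fix j assume "i < j"
      have "mu (Y 0) i * (Y 0 \<star> Z) (i + 1) j = (\<Sum>r = i + 1..j. (mu (Y 0) i * Y 0 (i + 1) r) * Z r j)"
        by (simp add: zmult_def sum_distrib_left mult.assoc)
      also have "\<dots> \<le> (\<Sum>r = i + 1..j. Y 0 i r * Z r j)"
        by (intro sum_mono mult_right_mono mu_le Yadm UZ)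
      also have "\<dots> \<le> (Y 0 \<star> Z) i j"
        unfolding zmult_def by (intro sum_mono2 mult_nonneg_nonneg AdmD(6)[OF Yadm] UZ) auto
      finally show "mu (Y 0) i * (Y 0 \<star> Z) (i + 1) j \<le> (Y 0 \<star> Z) i j" .
    qed
  qed
qed

lemma greedy_lim_zmult:
  assumes Y: "greedy_lim Y zid" and Z: "Z \<in> U_nonneg n" and ent: "entire (Y \<star> Z)"
  shows "greedy_lim (Y \<star> Z) Z"
proof -
  obtain Ys where Ys: "Ys 0 = Y" "gchain Ys" "zmat_lim Ys zid" using Y by (auto simp: greedy_lim_def)
  obtain k where k: "\<And>p. gstep (k p) (Ys p) (Ys (Suc p))"
    using Ys(2) unfolding gchain_def greedy_step_def by metis
  have c: "cstep (k p) (mu (Ys p) (k p)) (Ys p \<star> Z) (Ys (Suc p) \<star> Z)" for p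
    using gchain_zmult_cstep[OF Ys(2,3) Z _ k] ent Ys(1) by simp
  have mu: "mu (Ys p \<star> Z) i = mu (Ys p) i" for p i
    using gchain_mu_zmult[of "\<lambda>q. Ys (q + p)" Z i, OF gchain_Suc[OF Ys(2)] zmat_lim_shift[OF Ys(3)] Z]
      AdmD(5)[OF cstepD(1)[OF c]] by simp
  have "gstep (k p) (Ys p \<star> Z) (Ys (Suc p) \<star> Z)" for p
    unfolding gstep_def mu using cstepD(1)[OF c] k[of p] cstepD(4)[OF c, of p]
    by (auto simp: gstep_def) (metis rw_inverse(2))
  moreover have "zmat_lim (\<lambda>p. Ys p \<star> Z) Z"
    unfolding zmat_lim_def
  proof (intro allI)
    fix i j
    have "(\<lambda>p. (Ys p \<star> Z) i j) \<longlonglongrightarrow> (zid \<star> Z) i j"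
      using Ys(3) by (intro tendsto_zmult tendsto_const) (auto simp: zmat_lim_def)
    then show "(\<lambda>p. (Ys p \<star> Z) i j) \<longlonglongrightarrow> Z i j" using U_nonnegD(2)[OF Z] by simp
  qed
  ultimately show ?thesis by (intro greedy_limI[of "\<lambda>p. Ys p \<star> Z"]) (auto simp: Ys(1))
qed

end

section \<open>Reduced words in the affine symmetric group\<close>

lemma word_perm_Nil [simp]: "word_perm n [] = id"
  and word_perm_Cons: "word_perm n (i # u) = simple_refl n i \<circ> word_perm n u"
  by (simp_all add: word_perm_def)

lemma word_perm_append: "word_perm n (u @ v) = word_perm n u \<circ> word_perm n v"
  by (induction u) (simp_all add: word_perm_Cons comp_assoc)

lemma word_perm_snoc: "word_perm n (u @ [i]) = word_perm n u \<circ> simple_refl n i"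
  by (simp add: word_perm_append word_perm_Cons)

lemma affine_length_le: "affine_length n (word_perm n u) \<le> length u"
  unfolding affine_length_def by (rule Least_le) blast

lemma affine_length_attained:
  obtains v where "length v = affine_length n (word_perm n u)" "word_perm n v = word_perm n u"
  using LeastI_ex[of "\<lambda>k. \<exists>v. length v = k \<and> word_perm n v = word_perm n u"]
  unfolding affine_length_def by blast

context loop
begin

lemma simple_refl_cases:
  "(p mod int n = i mod int n \<and> simple_refl n i p = p + 1) \<or>
   (p mod int n = (i + 1) mod int n \<and> simple_refl n i p = p - 1) \<or>
   (p mod int n \<noteq> i mod int n \<and> p mod int n \<noteq> (i + 1) mod int n \<and> simple_refl n i p = p)"
  by (auto simp: simple_refl_def)

lemma simple_refl_shift: "simple_refl n i (p + m * int n) = simple_refl n i p + m * int n"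
  by (simp add: simple_refl_def)

lemma simple_refl_involution [simp]: "simple_refl n i (simple_refl n i p) = p"
proof -
  have "(p - 1) mod int n = i mod int n" if "p mod int n = (i + 1) mod int n"
    using that mod_add_1_eq_iff[of "p - 1" i] by simp
  moreover have "(p + 1) mod int n \<noteq> i mod int n" if "p mod int n = i mod int n"
    using mod_succ_neq[OF that] .
  moreover have "p mod int n \<noteq> i mod int n" if "p mod int n = (i + 1) mod int n"
    using that mod_succ_neq[of i i] by simp
  ultimately show ?thesis by (auto simp: simple_refl_def)
qed

lemma simple_refl_less:
  assumes "a < b" "\<not> (a mod int n = i mod int n \<and> b = a + 1)"
  shows "simple_refl n i a < simple_refl n i b"
proof -
  have ne: False if "a mod int n = i mod int n" "b mod int n = (i + 1) mod int n" "b = a + 2"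
    using that mod_add_1_eq_iff[of "a + 1" i] mod_succ_neq[of a i] by (simp add: algebra_simps)
  have ne2: False if "a mod int n = i mod int n" "b mod int n = i mod int n" "b = a + 1"
    using mod_succ_neq[OF that(1)] that(2,3) by blast
  have ne3: False if "a mod int n = (i + 1) mod int n" "b mod int n = (i + 1) mod int n" "b = a + 1"
    using mod_succ_neq[OF that(1)] that(2,3) by blast
  have ne4: False if "a mod int n \<noteq> i mod int n" "b mod int n = (i + 1) mod int n" "b = a + 1"
    using that by simp
  show ?thesis
    using simple_refl_cases[of a i] simple_refl_cases[of b i] assms ne ne2 ne3 ne4 by smt
qed

lemma word_perm_shift: "word_perm n u (p + m * int n) = word_perm n u p + m * int n"
  by (induction u) (simp_all add: word_perm_Cons simple_refl_shift)

text \<open>One representative of each translation class of inversions, as residue and distance;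
  their number plays the part of the Coxeter length.\<close>

definition inversions :: "(int \<Rightarrow> int) \<Rightarrow> (int \<times> int) set" where
  "inversions f = {(r, d). 0 \<le> r \<and> r < int n \<and> 0 < d \<and> f (r + d) < f r}"

text \<open>\<open>h\<close> moves a pair of positions by the reflection and reduces it to its
  representative. Applied twice it gives the pair back, and the order of positions is reversed only
  for the exceptional pair \<open>k\<close>.\<close>

lemma inversions_comp_simple_refl:
  fixes i :: int and f :: "int \<Rightarrow> int"
  assumes f: "\<And>p m. f (p + m * int n) = f p + m * int n"
  defines "k \<equiv> (i mod int n, 1)"
    and "h \<equiv> \<lambda>(r, d). (simple_refl n i r mod int n, simple_refl n i (r + d) - simple_refl n i r)"
  shows "h ` (inversions (f \<circ> simple_refl n i) - {k}) \<subseteq> inversions f - {k}"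
    "inj_on h (inversions (f \<circ> simple_refl n i) - {k})"
proof -
  let ?s = "simple_refl n i"
  have n0: "int n > 0" using n_ge_2 by simp
  have hh: "h (h (r, d)) = (r, d)" if r: "0 \<le> r" "r < int n" for r d
  proof -
    define m where "m = ?s r div int n"
    have r': "?s r mod int n = ?s r + (- m) * int n"
      unfolding m_def by (simp add: minus_div_mult_eq_mod[symmetric])
    have 1: "?s (?s r mod int n) = r + (- m) * int n"
      unfolding r' simple_refl_shift by simp
    have "?s r mod int n + (?s (r + d) - ?s r) = ?s (r + d) + (- m) * int n" unfolding r' by simp
    then have 2: "?s (?s r mod int n + (?s (r + d) - ?s r)) = r + d + (- m) * int n"
      by (simp only: simple_refl_shift simple_refl_involution)
    have "(r + (- m) * int n) mod int n = r" unfolding mod_mult_self1 using r by simp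
    then show ?thesis unfolding h_def case_prod_conv 1 2 by simp
  qed
  have hhx: "h (h x) = x" if "x \<in> inversions (f \<circ> ?s) - {k}" for x
    using that hh by (auto simp: inversions_def)
  show "inj_on h (inversions (f \<circ> ?s) - {k})"
    by (rule inj_onI) (metis hhx)
  \<comment> \<open>The exceptional pair gets a negative distance, so no pair with positive distance
    is carried to it.\<close>
  have ik: "h k = ((i + 1) mod int n, - 1)"
  proof -
    have a: "?s (i mod int n) = i mod int n + 1" by (simp add: simple_refl_def)
    have "(i mod int n + 1) mod int n = (i + 1) mod int n" by (simp add: mod_add_left_eq)
    then have b: "?s (i mod int n + 1) = i mod int n"
      using mod_succ_neq[of i i] by (simp add: simple_refl_def mod_add_left_eq)
    show ?thesis unfolding h_def k_def case_prod_conv a b by (simp add: mod_add_left_eq)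
  qed
  show "h ` (inversions (f \<circ> ?s) - {k}) \<subseteq> inversions f - {k}"
  proof (rule image_subsetI)
    fix x assume x: "x \<in> inversions (f \<circ> ?s) - {k}"
    obtain r d where rd: "x = (r, d)" by (cases x)
    have r: "0 \<le> r" "r < int n" "0 < d" "f (?s (r + d)) < f (?s r)" "(r, d) \<noteq> k"
      using x by (auto simp: rd inversions_def)
    have "\<not> (r mod int n = i mod int n \<and> r + d = r + 1)" using r by (auto simp: k_def)
    then have less: "?s r < ?s (r + d)" using r by (intro simple_refl_less) auto
    define m where "m = ?s r div int n"
    have r': "?s r mod int n = ?s r + (- m) * int n"
      unfolding m_def by (simp add: minus_div_mult_eq_mod[symmetric])
    have "?s r mod int n + (?s (r + d) - ?s r) = ?s (r + d) + (- m) * int n" unfolding r' by simp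
    then have "f (?s r mod int n + (?s (r + d) - ?s r)) < f (?s r mod int n)"
      unfolding r' using r(4) by (simp only: f)
    moreover have "h (r, d) \<noteq> k"
    proof
      assume "h (r, d) = k"
      then have "(r, d) = ((i + 1) mod int n, - 1)" using hh[OF r(1,2), of d] ik by simp
      then show False using r(3) by simp
    qed
    ultimately show "h x \<in> inversions f - {k}"
      using less n0 by (simp add: rd inversions_def h_def)
  qed
qed

lemma inversions_word_perm:
  "finite (inversions (word_perm n u)) \<and> card (inversions (word_perm n u)) \<le> length u"
proof (induction u rule: rev_induct)
  case Nil
  have "inversions id = {}" by (auto simp: inversions_def)
  then show ?case by (simp add: id_def)
next
  case (snoc i u)
  let ?f = "word_perm n u" and ?k = "(i mod int n, 1)"
  let ?S = "inversions (?f \<circ> simple_refl n i)"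
  note inv = inversions_comp_simple_refl[of ?f i, OF word_perm_shift]
  have fin: "finite (inversions ?f - {?k})" using snoc by simp
  have fin': "finite (?S - {?k})" using finite_imageD[OF finite_subset[OF inv(1) fin] inv(2)] .
  have "card (?S - {?k}) \<le> card (inversions ?f - {?k})"
    using card_inj_on_le[OF inv(2,1) fin] .
  also have "\<dots> \<le> card (inversions ?f)" using snoc by (intro card_mono) auto
  finally have "card ?S \<le> Suc (length u)"
    using snoc card_Diff1_le[of ?S ?k] fin' card.remove[of ?S ?k] by (cases "?k \<in> ?S") auto
  moreover have "finite ?S" using fin' by simp
  ultimately have "finite ?S \<and> card ?S \<le> length (u @ [i])" by simp
  then show ?case unfolding word_perm_snoc .
qed

text \<open>Transport of inversions is used for the permutation and for its product with the
  reflection; the two injections make the counts equal up to the new inversion.\<close>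

lemma card_inversions_snoc:
  assumes "word_perm n u i < word_perm n u (i + 1)"
  shows "card (inversions (word_perm n (u @ [i]))) = Suc (card (inversions (word_perm n u)))"
proof -
  let ?f = "word_perm n u" and ?k = "(i mod int n, 1)"
  let ?S = "inversions (?f \<circ> simple_refl n i)"
  have finS: "finite ?S" using inversions_word_perm[of "u @ [i]"] by (simp add: word_perm_snoc)
  have fin: "finite (inversions ?f)" using inversions_word_perm by blast
  obtain m where m: "i mod int n = i + m * int n"
    by (rule mod_eq_shiftE[of "i mod int n" i]) auto
  have m1: "i mod int n + 1 = (i + 1) + m * int n" using m by simp
  have k: "?f (i mod int n) < ?f (i mod int n + 1)"
    unfolding m1 unfolding m word_perm_shift using assms by simp
  have s: "simple_refl n i (i mod int n) = i mod int n + 1"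
    by (simp add: simple_refl_def)
  then have s': "simple_refl n i (i mod int n + 1) = i mod int n"
    using simple_refl_involution by metis
  have "?k \<in> ?S" using k s s' n_ge_2 by (simp add: inversions_def)
  then have "card ?S = Suc (card (?S - {?k}))" by (rule card.remove[OF finS])
  moreover have "inversions ?f - {?k} = inversions ?f" using k by (auto simp: inversions_def)
  moreover have "card (?S - {?k}) = card (inversions ?f - {?k})"
  proof (rule order_antisym)
    note inv = inversions_comp_simple_refl[of ?f i, OF word_perm_shift]
    show "card (?S - {?k}) \<le> card (inversions ?f - {?k})"
      using card_inj_on_le[OF inv(2,1)] fin by simp
    have eq: "(?f \<circ> simple_refl n i) \<circ> simple_refl n i = ?f" by (auto simp: fun_eq_iff)
    have "(?f \<circ> simple_refl n i) (p + m * int n) = (?f \<circ> simple_refl n i) p + m * int n" for p m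
      by (simp add: simple_refl_shift word_perm_shift)
    note inv = inversions_comp_simple_refl[of "?f \<circ> simple_refl n i" i, OF this, unfolded eq]
    show "card (inversions ?f - {?k}) \<le> card (?S - {?k})"
      using card_inj_on_le[OF inv(2,1)] finS by simp
  qed
  ultimately show ?thesis unfolding word_perm_snoc by (simp only:)
qed

lemma infinite_reduced_wordI:
  assumes "\<And>k. word_perm n (map w [0..<k]) (w k) < word_perm n (map w [0..<k]) (w k + 1)"
  shows "infinite_reduced_word n w"
  unfolding infinite_reduced_word_def
proof (intro allI)
  fix k
  let ?f = "word_perm n (map w [0..<k])"
  have "card (inversions (word_perm n (map w [0..<k]))) = k" for k
  proof (induction k)
    case 0
    have "inversions id = {}" by (auto simp: inversions_def)
    then show ?case by (simp add: id_def)
  next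
    case (Suc k)
    then show ?case using card_inversions_snoc[OF assms, of k] by simp
  qed
  then have card: "card (inversions ?f) = k" .
  obtain v where v: "length v = affine_length n ?f" "word_perm n v = ?f"
    by (rule affine_length_attained)
  then have "k \<le> affine_length n ?f" using inversions_word_perm[of v] card by simp
  moreover have "affine_length n ?f \<le> k" using affine_length_le[of n "map w [0..<k]"] by simp
  ultimately show "affine_length n ?f = k" by simp
qed

text \<open>Without the letter \<open>i\<close> all reflections preserve the window
  \<open>{i + 1..i + int n}\<close>, hence generate finitely many permutations, whose lengths are
  bounded by some \<open>N\<close>.\<close>

lemma infinite_reduced_word_letters:
  assumes w: "infinite_reduced_word n w" shows "\<exists>k\<ge>m. w k mod int n = i mod int n"
proof (rule ccontr)
  assume "\<not> ?thesis"
  then have avoid: "w k mod int n \<noteq> i mod int n" if "m \<le> k" for k using that by blast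
  define B where "B = {i + 1..i + int n}"
  define Q where "Q = {u. \<forall>j\<in>set u. j mod int n \<noteq> i mod int n}"
  have n0: "int n > 0" using n_ge_2 by simp
  have B_step: "simple_refl n j p \<in> B" if "p \<in> B" "j mod int n \<noteq> i mod int n" for j p
  proof -
    have "p \<noteq> i + int n" if "p mod int n = j mod int n"
      using that \<open>j mod int n \<noteq> i mod int n\<close> by auto
    moreover have "p \<noteq> i + 1" if "p mod int n = (j + 1) mod int n"
      using that \<open>j mod int n \<noteq> i mod int n\<close> by auto
    ultimately show ?thesis
      using simple_refl_cases[of p j] \<open>p \<in> B\<close> by (auto simp: B_def)
  qed
  have B: "word_perm n u p \<in> B" if "u \<in> Q" "p \<in> B" for u p
    using that
  proof (induction u)
    case (Cons j u)
    then show ?case using B_step by (simp add: Q_def word_perm_Cons)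
  qed simp
  have "finite (word_perm n ` Q)"
  proof (rule finite_imageD)
    show "finite ((\<lambda>f. restrict f B) ` (word_perm n ` Q))"
    proof (rule finite_subset)
      show "(\<lambda>f. restrict f B) ` (word_perm n ` Q) \<subseteq> B \<rightarrow>\<^sub>E B" using B by auto
      show "finite (B \<rightarrow>\<^sub>E B)" by (intro finite_PiE) (simp_all add: B_def)
    qed
    show "inj_on (\<lambda>f. restrict f B) (word_perm n ` Q)"
    proof (intro inj_onI ext)
      fix f g p
      assume "f \<in> word_perm n ` Q" "g \<in> word_perm n ` Q" and eq: "restrict f B = restrict g B"
      then obtain u v where uv: "f = word_perm n u" "g = word_perm n v" by blast
      define q where "q = i + 1 + (p - (i + 1)) mod int n"
      have q: "q \<in> B"
        using pos_mod_bound[OF n0, of "p - (i + 1)"] pos_mod_sign[OF n0, of "p - (i + 1)"]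
        unfolding q_def B_def by (simp only: atLeastAtMost_iff) linarith
      have "p mod int n = q mod int n" by (simp add: q_def mod_add_right_eq)
      then obtain c where c: "p = q + c * int n" by (rule mod_eq_shiftE)
      have "f q = g q" using eq q by (metis restrict_apply')
      then show "f p = g p" unfolding uv c word_perm_shift by simp
    qed
  qed
  then have "finite (affine_length n ` word_perm n ` Q)" by simp
  then obtain N where N: "\<And>u. u \<in> Q \<Longrightarrow> affine_length n (word_perm n u) \<le> N"
    using finite_nat_set_iff_bounded_le by (metis image_eqI)
  \<comment> \<open>The word \<open>v\<close> has \<open>N + 1\<close> letters, but its permutation
    has length at most \<open>N\<close>, so the prefix can be shortened.\<close>
  define u v where "u = map w [0..<m]" "v = map w [m..<m + N + 1]"
  have "v \<in> Q" using avoid by (auto simp: Q_def u_v_def)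
  obtain v' where v': "length v' = affine_length n (word_perm n v)" "word_perm n v' = word_perm n v"
    by (rule affine_length_attained)
  have "map w [0..<m + N + 1] = u @ v"
    unfolding u_v_def map_append[symmetric]
    by (rule arg_cong[of _ _ "map w"]) (rule upt_add_eq_append[of 0 m "N + 1", simplified add.assoc[symmetric]], simp)
  then have "word_perm n (map w [0..<m + N + 1]) = word_perm n (u @ v')"
    using v' by (simp add: word_perm_append)
  then have "affine_length n (word_perm n (map w [0..<m + N + 1])) \<le> length (u @ v')"
    using affine_length_le by metis
  also have "\<dots> \<le> m + N" using N[OF \<open>v \<in> Q\<close>] v' by (simp add: u_v_def)
  finally have "affine_length n (word_perm n (map w [0..<m + N + 1])) \<le> m + N" .
  moreover have "affine_length n (word_perm n (map w [0..<m + N + 1])) = m + N + 1"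
    using w unfolding infinite_reduced_word_def by blast
  ultimately show False by simp
qed

text \<open>Invariant: if a particle sits at \<open>p\<close>, the current permutation sends
  \<open>p + 1\<close> above the images of all positions up to \<open>p\<close>. At the divided site
  this is the required ascent. Quantifying over all \<open>a \<le> p\<close> lets the invariant
  survive a move from \<open>p + 1\<close> to \<open>p\<close>, where the reflection may raise
  \<open>a\<close> by one.\<close>

lemma greedy_word_reduced:
  assumes Z: "\<And>k. gstep (w k) (Z k) (Z (Suc k))"
  shows "infinite_reduced_word n w"
proof (rule infinite_reduced_wordI)
  define f where "f k = word_perm n (map w [0..<k])" for k
  have f_Suc: "f (Suc k) = f k \<circ> simple_refl n (w k)" for k by (simp add: f_def word_perm_snoc)
  have inv: "\<forall>p. 0 < mu (Z k) p \<longrightarrow> (\<forall>a\<le>p. f k a < f k (p + 1))" for k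
  proof (induction k)
    case 0
    then show ?case by (simp add: f_def)
  next
    case (Suc k)
    let ?s = "simple_refl n (w k)"
    note c = gstep_cstep[OF Z[of k]]
    show ?case
    proof (intro allI impI)
      fix p a assume p: "0 < mu (Z (Suc k)) p" and a: "a \<le> p"
      have pw: "p mod int n \<noteq> w k mod int n"
        using p gstep_mu[OF Z[of k]] mu_cong_mod[OF cstepD(2)[OF c], of p "w k"] by auto
      have sa: "?s a \<le> a + 1" using simple_refl_cases[of a "w k"] by auto
      show "f (Suc k) a < f (Suc k) (p + 1)"
      proof (cases "(p + 1) mod int n = w k mod int n")
        case True
        have "mu (Z k) (p + 1) = mu (Z k) (w k)" by (rule mu_cong_mod[OF cstepD(1)[OF c] True])
        then have "0 < mu (Z k) (p + 1)" using cstepD(3)[OF c] by simp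
        moreover have "?s a \<le> p + 1" using sa a by simp
        ultimately have "f k (?s a) < f k (p + 1 + 1)" using Suc by blast
        then show ?thesis using True by (simp add: f_Suc simple_refl_def)
      next
        case False
        have "0 < mu (Z k) p" using p cstep_mu_other[OF c pw False] by simp
        moreover have "?s a \<le> p"
          using simple_refl_cases[of a "w k"] a pw by (cases "a = p") auto
        ultimately have "f k (?s a) < f k (p + 1)" using Suc by blast
        moreover have "?s (p + 1) = p + 1" using pw False by (simp add: simple_refl_def)
        ultimately show ?thesis by (simp add: f_Suc)
      qed
    qed
  qed
  show "word_perm n (map w [0..<k]) (w k) < word_perm n (map w [0..<k]) (w k + 1)" for k
    using inv[of k] Z[of k] by (simp add: f_def gstep_def)
qed


section \<open>Finite products\<close>

lemma zid_fcp: "zid \<in> fcp"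
  by (auto simp: finite_chevalley_products_def intro!: exI[of _ 0])

lemma fcp_zmult_chevalley: assumes "F \<in> fcp" "0 \<le> a" shows "F \<star> chevalley n i a \<in> fcp"
proof -
  obtain m w b where F: "\<forall>k<m. 0 \<le> b k" "F = partial_prod (\<lambda>k. chevalley n (w k) (b k)) m"
    using assms(1) by (auto simp: finite_chevalley_products_def)
  have "partial_prod (\<lambda>k. chevalley n ((w(m := i)) k) ((b(m := a)) k)) l =
      partial_prod (\<lambda>k. chevalley n (w k) (b k)) l" if "l \<le> m" for l
    using that by (induction l) auto
  then have "F \<star> chevalley n i a =
      partial_prod (\<lambda>k. chevalley n ((w(m := i)) k) ((b(m := a)) k)) (Suc m)"
    using F(2) by simp
  moreover have "\<forall>k<Suc m. 0 \<le> (b(m := a)) k" using F(1) assms(2) by simp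
  ultimately show ?thesis unfolding finite_chevalley_products_def by blast
qed

lemma fcp_induct [consumes 1, case_names zid chevalley]:
  assumes "F \<in> fcp" and "P zid"
    and "\<And>F i a. F \<in> fcp \<Longrightarrow> P F \<Longrightarrow> 0 \<le> a \<Longrightarrow> P (F \<star> chevalley n i a)"
  shows "P F"
proof -
  obtain m w b where F: "\<forall>k<m. 0 \<le> b k" "F = partial_prod (\<lambda>k. chevalley n (w k) (b k)) m"
    using assms(1) by (auto simp: finite_chevalley_products_def)
  have "partial_prod (\<lambda>k. chevalley n (w k) (b k)) l \<in> fcp \<and>
      P (partial_prod (\<lambda>k. chevalley n (w k) (b k)) l)" if "l \<le> m" for l
    using that by (induction l) (use F(1) assms(2,3) zid_fcp fcp_zmult_chevalley in auto)
  then show ?thesis using F(2) by blast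
qed

lemma fcp_bimult: "F \<in> fcp \<Longrightarrow> F \<in> bimult"
  by (induction rule: fcp_induct) (auto intro: zid_bimult zmult_bimult chevalley_bimult)

lemma chevalley_fcp: "0 \<le> a \<Longrightarrow> chevalley n i a \<in> fcp"
  using fcp_zmult_chevalley[OF zid_fcp, of a i] by simp

lemma fcp_uu: "F \<in> fcp \<Longrightarrow> upper_unipotent F"
  using fcp_bimult bimultD(1) U_nonnegD(2) by blast

lemma fcp_zmult:
  assumes "G \<in> fcp" "F \<in> fcp" shows "F \<star> G \<in> fcp"
  using assms
proof (induction rule: fcp_induct)
  case zid
  then show ?case using fcp_uu by simp
next
  case (chevalley G i a)
  then show ?case using fcp_zmult_chevalley[of "F \<star> G" a i] by (simp add: zmult_assoc)
qed

text \<open>Bandedness separates finite products from \<Omega>, whose elements have no zeros above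
  the diagonal.\<close>

lemma fcp_banded:
  assumes "F \<in> fcp" shows "\<exists>m. \<forall>i j. i + int m < j \<longrightarrow> F i j = 0"
  using assms
proof (induction rule: fcp_induct)
  case zid
  then show ?case by (auto simp: zid_def intro!: exI[of _ 0])
next
  case (chevalley F i a)
  then obtain m where m: "\<And>p q. p + int m < q \<Longrightarrow> F p q = 0" by blast
  then have "(F \<star> chevalley n i a) p q = 0" if "p + int (Suc m) < q" for p q
    using that by (simp add: zmult_chevalley fcp_uu[OF chevalley(1)])
  then show ?case by blast
qed

lemma fcp_not_full: assumes "F \<in> fcp" "\<And>i j. i \<le> j \<Longrightarrow> 0 < F i j" shows False
proof -
  obtain m where "\<And>i j. i + int m < j \<Longrightarrow> F i j = 0" using fcp_banded[OF assms(1)] by blast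
  then have "F 0 (int m + 1) = 0" by simp
  then show False using assms(2)[of 0 "int m + 1"] by simp
qed

section \<open>Whitney's factorization\<close>

text \<open>Minors of order two spread the zero to the right along row \<open>z\<close>, then
  upwards in each column.\<close>

lemma zero_block:
  assumes X: "solid_nonneg X" "X z (z + 1) = 0" and uu: "upper_unipotent X" and ij: "i \<le> z" "z < j"
  shows "X i j = 0"
proof -
  have z: "X z j = 0"
  proof (cases "j = z + 1")
    case False
    then have "X z j * X (z + 1) (z + 1) \<le> X z (z + 1) * X (z + 1) j"
      using ij by (intro solid_nonneg_2 X) auto
    then show ?thesis using uu X(2) solid_nonneg_entry[OF X(1), of z j] by simp
  qed (use X in simp)
  show ?thesis
    using ij(1)
  proof (induction i rule: int_le_induct)
    case (step i)
    have "X (i - 1) j * X (i - 1 + 1) i \<le> X (i - 1) i * X (i - 1 + 1) j"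
      using step ij by (intro solid_nonneg_2 X) auto
    then show ?case using step uu solid_nonneg_entry[OF X(1), of "i - 1" j] by simp
  qed (rule z)
qed

lemma minor_rw_solid_other:
  assumes "\<not> (0 < m \<and> (b + int (m - 1)) mod int n = i mod int n)"
  shows "minor (rw i s X) m (\<lambda>l. b + int l) c = minor X m (\<lambda>l. b + int l) c"
proof -
  have "\<not> (Suc l = m \<and> (b + int l) mod int n = i mod int n)" for l using assms by auto
  then show ?thesis unfolding minor_rw_solid unfolding minor_det_fun by (intro det_fun_cong) auto
qed

text \<open>The Schur complement argument again, with the fixed column \<open>L\<close> in place of
  a limit: the entries above row \<open>a\<close> vanish there, so only the last row of the minor
  changes. Minors reaching column \<open>L\<close> or beyond have a zero column in the
  quotient.\<close>

lemma solid_nonneg_rw_corner: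
  assumes X: "zperiodic n X" "solid_nonneg X" and t: "t = X a L / X (a + 1) L" and pos: "0 < X (a + 1) L"
    and zero: "\<And>p. p < a \<Longrightarrow> X p L = 0"
    and zero': "\<And>p c. p \<le> a \<Longrightarrow> L \<le> c \<Longrightarrow> rw a (- t) X p c = 0"
  shows "solid_nonneg (rw a (- t) X)"
  unfolding solid_nonneg_def
proof (intro allI impI)
  fix b m and c :: "nat \<Rightarrow> int"
  assume c: "strict_mono_on {..<m} c"
  show "0 \<le> minor (rw a (- t) X) m (\<lambda>l. b + int l) c"
  proof (cases "0 < m \<and> (b + int (m - 1)) mod int n = a mod int n")
    case False
    then show ?thesis using minor_rw_solid_other[OF False] X c by (simp add: solid_nonneg_def)
  next
    case True
    then obtain m' where m: "m = Suc m'" by (cases m) auto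
    define e where "e = b + int m'"
    have "e mod int n = a mod int n" using True m by (simp add: e_def)
    then obtain s where s: "e = a + s * int n" by (rule mod_eq_shiftE)
    define j where "j = L + s * int n"
    have per: "X (p + s * int n) (q + s * int n) = X p q" for p q by (rule zperiodic_shift[OF X(1)])
    show ?thesis
    proof (cases "c m' < j")
      case False
      have "rw a (- t) X (b + int l) (c m') = 0" if "l < m" for l
      proof -
        have "rw a (- t) X (b + int l) (c m') =
            rw a (- t) X (b + int l - s * int n) (c m' - s * int n)"
          using zperiodic_shift[OF zperiodic_rw[OF X(1)], of a "- t" "b + int l - s * int n" s "c m' - s * int n"]
          by simp
        also have "\<dots> = 0" using that m s False by (intro zero') (auto simp: e_def j_def)
        finally show ?thesis .
      qed
      then have "minor (rw a (- t) X) m (\<lambda>l. b + int l) c = 0"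
        unfolding minor_det_fun using m by (intro det_fun_zero_col[of m']) auto
      then show ?thesis by simp
    next
      case True
      have e1: "X (e + 1) j = X (a + 1) L" using per[of "a + 1" L] by (simp add: s j_def algebra_simps)
      have "0 \<le> det_fun (Suc m') (\<lambda>l q. X (b + int l) (c q) -
          X (b + int l) j / X (e + 1) j * X (e + 1) (c q))"
        unfolding e_def using c m True pos e1 by (intro solid_schur_nonneg X) (auto simp: e_def)
      also have "\<dots> = minor (rw a (- t) X) m (\<lambda>l. b + int l) c"
        unfolding minor_rw_solid m
      proof (rule det_fun_cong)
        fix l q assume l: "l < Suc m'"
        have "X (b + int l) j = (if l = m' then X a L else 0)"
        proof -
          have "X (b + int l) j = X (b + int l - s * int n) L"
            using per[of "b + int l - s * int n" L] by (simp add: j_def)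
          then show ?thesis using l s zero[of "b + int l - s * int n"] by (auto simp: e_def)
        qed
        moreover have "(b + int m') mod int n = a mod int n"
          using \<open>e mod int n = a mod int n\<close> by (simp add: e_def)
        ultimately show "X (b + int l) (c q) - X (b + int l) j / X (e + 1) j * X (e + 1) (c q) =
          X (b + int l) (c q) + (if Suc l = Suc m' \<and> (b + int l) mod int n = a mod int n
            then - t * X (b + int l + 1) (c q) else 0)"
          using e1 by (cases "l = m'") (simp_all add: t e_def)
      qed
      finally show ?thesis .
    qed
  qed
qed

text \<open>
  Elimination of the entry in the last nontrivial column, topmost row, of a diagonal block.
\<close>

lemma fcp_if_superdiag_zero:
  assumes "zperiodic n X" "upper_unipotent X" "solid_nonneg X" and "X z (z + 1) = 0"
  shows "X \<in> fcp"
  using assms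
proof (induction "card {(i, j). z < i \<and> i < j \<and> j \<le> z + int n \<and> X i j \<noteq> 0}" arbitrary: X
    rule: less_induct)
  case less
  define S where "S X = {(i, j). z < i \<and> i < j \<and> j \<le> z + int n \<and> X i j \<noteq> 0}" for X :: zmat
  have fin: "finite (S X)" for X
    by (rule finite_subset[of _ "{z..z + int n} \<times> {z..z + int n}"]) (auto simp: S_def)
  note uu = less.prems(2) and solid = less.prems(3)
  have nn: "0 \<le> X i j" for i j using solid_nonneg_entry[OF solid] .
  \<comment> \<open>Together with periodicity this makes \<open>X\<close> block diagonal with blocks
    of size \<open>n\<close>, so nonzero entries of a single block serve as induction
    measure.\<close>
  have block: "X i j = 0" if "i \<le> z" "z < j" for i j
    using zero_block[OF solid less.prems(4) uu that] .
  have block': "X i j = 0" if "i \<le> z + int n" "z + int n < j" for i j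
  proof -
    have "X (i - int n) (j - int n) = 0" using that by (intro block) auto
    then show ?thesis using zperiodic_shift[OF less.prems(1), of "i - int n" 1 "j - int n"] by simp
  qed
  show ?case
  proof (cases "S X = {}")
    case True
    have "X i j = zid i j" for i j
    proof (cases "i < j")
      case ij: True
      define m where "m = (i - z - 1) div int n"
      define p where "p = i - m * int n"
      have "p = z + 1 + (i - z - 1) mod int n"
        unfolding p_def m_def using div_mult_mod_eq[of "i - z - 1" "int n"] by linarith
      moreover have "0 \<le> (i - z - 1) mod int n" "(i - z - 1) mod int n < int n" using n_ge_2 by auto
      ultimately have p: "z < p" "p \<le> z + int n" by auto
      have "X i j = X p (j - m * int n)"
        using zperiodic_shift[OF less.prems(1), of p m "j - m * int n"] by (simp add: p_def)
      also have "\<dots> = 0"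
      proof (cases "j - m * int n \<le> z + int n")
        case True
        then have "(p, j - m * int n) \<notin> S X" using \<open>S X = {}\<close> by simp
        then show ?thesis using True p ij by (simp add: S_def p_def)
      qed (use block' p in auto)
      finally show ?thesis using ij by (simp add: zid_def)
    next
      case False
      then show ?thesis using uu by (cases "i = j") (auto simp: zid_def upper_unipotent_lower)
    qed
    then have "X = zid" by (intro ext)
    then show ?thesis using zid_fcp by simp
  next
    case False
    define L where "L = Max (snd ` S X)"
    have L: "L \<in> snd ` S X" "\<And>x. x \<in> S X \<Longrightarrow> snd x \<le> L"
      using fin False by (auto simp: L_def)
    define R where "R = {i. (i, L) \<in> S X}"
    have R: "finite R" "R \<noteq> {}"
      using L(1) finite_subset[of R "fst ` S X"] fin by (force simp: R_def)+
    define a where "a = Min R"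
    have a: "(a, L) \<in> S X" "\<And>i. (i, L) \<in> S X \<Longrightarrow> a \<le> i"
      using Min_in[OF R] Min_le[OF R(1)] by (auto simp: a_def R_def)
    have aL: "z < a" "a < L" "L \<le> z + int n" "0 < X a L"
      using a(1) nn[of a L] by (auto simp: S_def less_le)
    have Z1: "X p L = 0" if "p < a" for p
    proof (cases "z < p")
      case True
      then have "(p, L) \<notin> S X" using a(2)[of p] that by auto
      then show ?thesis using True that aL by (simp add: S_def)
    qed (use block aL in auto)
    have Z2: "X p c = 0" if "p \<le> L" "L < c" for p c
    proof (cases "z < p \<and> c \<le> z + int n")
      case True
      then have "(p, c) \<notin> S X" using L(2)[of "(p, c)"] that by auto
      then show ?thesis using True that by (simp add: S_def)
    next
      case False
      then show ?thesis using block[of p c] block'[of p c] that aL by auto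
    qed
    \<comment> \<open>Guarantees a positive pivot \<open>X (a + 1) L\<close>, so that
      \<open>t\<close> below is defined and clears \<open>(a, L)\<close>.\<close>
    have sub: "X a L \<le> X a (a + 1) * X (a + 1) L"
    proof (cases "L = a + 1")
      case False
      then show ?thesis using solid_nonneg_2[OF solid, of "a + 1" L a] aL uu by simp
    qed (use uu in simp)
    have pos: "0 < X (a + 1) L" "0 < X a (a + 1)"
      using sub aL(4) nn[of "a + 1" L] nn[of a "a + 1"] by (auto simp: less_le)
    define t where "t = X a L / X (a + 1) L"
    have t: "0 < t" using aL pos by (simp add: t_def)
    define X' where "X' = rw a (- t) X"
    have X'z: "X' p c = 0" if p: "p \<le> a" and c: "L \<le> c" for p c
    proof (cases "L < c")
      case True
      then show ?thesis using Z2[of p c] Z2[of "p + 1" c] p aL by (simp add: X'_def rw_def)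
    next
      case False
      then have [simp]: "c = L" using c by simp
      show ?thesis
      proof (cases "p = a")
        case True
        then show ?thesis using pos by (simp add: X'_def rw_def t_def)
      next
        case False
        then have "p + 1 < a" if "p mod int n = a mod int n"
          using p mod_succ_neq[OF that] by (cases "p + 1 = a") auto
        then show ?thesis using Z1[of p] Z1[of "p + 1"] p False by (auto simp: X'_def rw_def)
      qed
    qed
    have solid': "solid_nonneg X'"
      unfolding X'_def
      by (rule solid_nonneg_rw_corner[OF less.prems(1) solid t_def pos(1) Z1 X'z[unfolded X'_def]])
    have "S X' \<subseteq> S X - {(a, L)}"
    proof
      fix x assume x: "x \<in> S X'"
      obtain i j where ij: "x = (i, j)" by (cases x)
      have r: "z < i" "i < j" "j \<le> z + int n" "X' i j \<noteq> 0" using x ij by (auto simp: S_def)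
      have ne: "(i, j) \<noteq> (a, L)" using X'z[of a L] r by auto
      \<comment> \<open>There is no fill-in: if \<open>X a j = 0\<close> with \<open>j < L\<close>,
        the minor of the rows \<open>a\<close>, \<open>a + 1\<close> and columns \<open>j\<close>,
        \<open>L\<close> forces \<open>X (a + 1) j = 0\<close>.\<close>
      have "X i j \<noteq> 0"
      proof
        assume z0: "X i j = 0"
        have ia: "i mod int n = a mod int n" using r(4) z0 by (auto simp: X'_def rw_def split: if_splits)
        have "i = a"
        proof -
          obtain s where s: "i = a + s * int n" using ia by (rule mod_eq_shiftE)
          have "\<bar>s * int n\<bar> < int n" using s r aL by linarith
          then have "s = 0" using n_ge_2 by (cases "s = 0") (auto simp: abs_mult)
          then show ?thesis using s by simp
        qed
        have "X (a + 1) j = 0"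
        proof (cases "j = a + 1")
          case True
          then show ?thesis using z0 \<open>i = a\<close> pos by simp
        next
          case False
          then have j: "a + 1 < j" using r \<open>i = a\<close> by simp
          consider "j < L" | "j = L" | "L < j" by linarith
          then show ?thesis
          proof cases
            case 1
            have "X a L * X (a + 1) j \<le> X a j * X (a + 1) L" by (rule solid_nonneg_2[OF solid 1])
            then have "X a L * X (a + 1) j \<le> 0" using z0 \<open>i = a\<close> by simp
            then show ?thesis using aL(4) nn[of "a + 1" j] by (simp add: mult_le_0_iff)
          next
            case 2
            then show ?thesis using z0 \<open>i = a\<close> aL by simp
          next
            case 3
            then show ?thesis using Z2 aL by simp
          qed
        qed
        then show False using r(4) z0 \<open>i = a\<close> by (simp add: X'_def rw_def)
      qed
      then show "x \<in> S X - {(a, L)}" using r ne ij by (simp add: S_def)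
    qed
    then have "card (S X') < card (S X)"
      using a(1) fin by (intro psubset_card_mono) auto
    moreover have "X' z (z + 1) = 0"
    proof (cases "z mod int n = a mod int n")
      case True
      obtain s where s: "z = a + s * int n" using True by (rule mod_eq_shiftE)
      have "a - z < int n" using aL by simp
      then have "a = z + 0 * int n"
      proof -
        have "s = 0 \<or> s \<le> - 1 \<or> 1 \<le> s" by linarith
        moreover have False if "s \<le> - 1"
        proof -
          have "s * int n \<le> - 1 * int n" using that by (intro mult_right_mono) auto
          then show False using s \<open>a - z < int n\<close> by linarith
        qed
        moreover have False if "1 \<le> s"
        proof -
          have "1 * int n \<le> s * int n" using that by (intro mult_right_mono) auto
          then show False using s aL n_ge_2 by linarith
        qed
        ultimately show ?thesis using s by auto
      qed
      then show ?thesis using aL by simp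
    next
      case False
      then show ?thesis using less.prems(4) by (simp add: X'_def rw_def)
    qed
    ultimately have "X' \<in> fcp"
      using less.hyps[of X'] solid' zperiodic_rw[OF less.prems(1)] upper_unipotent_rw[OF uu]
      by (simp add: S_def X'_def)
    moreover have "X = chevalley n a t \<star> X'"
      using uu by (simp add: chevalley_zmult X'_def)
    ultimately show ?thesis using fcp_zmult chevalley_fcp[of t a] t by simp
  qed
qed

section \<open>Tails of infinite products\<close>

lemma partial_prod_bimult: "(\<And>k. Y k \<in> bimult) \<Longrightarrow> partial_prod Y k \<in> bimult"
  by (induction k) (auto intro: zid_bimult zmult_bimult)

text \<open>The tails arise by dividing the limit by partial products. They are limits of products
  of later factors, which puts them into \<open>bimult\<close>, and they tend to the identity by
  continuity of \<open>zinv\<close>.\<close>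

lemma inf_prod_tails:
  assumes Y: "\<And>k. Y k \<in> bimult" and lim: "has_right_inf_prod Y X"
  obtains T where "T 0 = X" "\<And>k. T k = Y k \<star> T (Suc k)" "\<And>k. T k \<in> bimult" "zmat_lim T zid"
    "\<And>k. X = partial_prod Y k \<star> T k"
proof
  let ?P = "partial_prod Y"
  define T where "T k = zinv (?P k) \<star> X" for k
  have Plim: "(\<lambda>k. ?P k i j) \<longlonglongrightarrow> X i j" for i j
    using lim by (simp add: has_right_inf_prod_def zmat_lim_def)
  have Pb: "?P k \<in> bimult" for k by (rule partial_prod_bimult[OF Y])
  have uP: "upper_unipotent (?P k)" and uY: "upper_unipotent (Y k)" for k
    using U_nonnegD(2)[OF bimultD(1)] Pb Y by blast+
  have Xb: "X \<in> bimult" by (rule bimult_limit[OF Plim]) (auto simp: Pb)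
  have uX: "upper_unipotent X" using U_nonnegD(2)[OF bimultD(1)[OF Xb]] .
  show "T 0 = X" using uX by (simp add: T_def zinv_zid)
  show "X = ?P k \<star> T k" for k
    using uP uX by (simp add: T_def zmult_assoc[symmetric])
  have step: "zinv (?P k) = Y k \<star> zinv (?P (Suc k))" for k
  proof (rule zmult_left_cancel[of "?P k"])
    have "?P k \<star> (Y k \<star> zinv (?P (Suc k))) = ?P (Suc k) \<star> zinv (?P (Suc k))"
      by (simp add: zmult_assoc)
    then show "?P k \<star> zinv (?P k) = ?P k \<star> (Y k \<star> zinv (?P (Suc k)))"
      using zmult_zinv[OF uP, of k] zmult_zinv[OF uP, of "Suc k"] by (simp only:)
  qed (use uP uY in simp_all)
  show "T k = Y k \<star> T (Suc k)" for k
    unfolding T_def by (subst step) (rule zmult_assoc)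
  show "T k \<in> bimult" for k
  proof (rule bimult_limit)
    show "((\<lambda>m. (zinv (?P k) \<star> ?P (m + k)) i j) \<longlonglongrightarrow> T k i j)" for i j
      unfolding T_def by (intro tendsto_zmult tendsto_const LIMSEQ_ignore_initial_segment Plim)
    have "zinv (?P k) \<star> ?P (m + k) \<in> bimult" for m
    proof (induction m)
      case 0
      then show ?case using zid_bimult uP by simp
    next
      case (Suc m)
      have "zinv (?P k) \<star> ?P (Suc m + k) = (zinv (?P k) \<star> ?P (m + k)) \<star> Y (m + k)"
        by (simp add: zmult_assoc)
      then show ?case using zmult_bimult[OF Suc Y] by simp
    qed
    then show "\<forall>\<^sub>F m in sequentially. zinv (?P k) \<star> ?P (m + k) \<in> bimult" by simp
  qed simp
  show "zmat_lim T zid"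
    unfolding zmat_lim_def
  proof (intro allI)
    fix i j
    have "(\<lambda>k. T k i j) \<longlonglongrightarrow> (zinv X \<star> X) i j"
      unfolding T_def by (intro tendsto_zmult tendsto_zinv tendsto_const Plim)
    then show "(\<lambda>k. T k i j) \<longlonglongrightarrow> zid i j" using uX by simp
  qed
qed

text \<open>A positive superdiagonal entry of a tail cannot persist, as the tails tend to the
  identity; so a later factor \<open>Y m\<close> is positive at \<open>(i, i + 1)\<close>. Combined
  with the entry of \<open>T (Suc m)\<close> from \<open>i + 1\<close> on, this reaches any distance
  by induction.\<close>

lemma tails_full:
  assumes T: "\<And>k. T k = Y k \<star> T (Suc k)" and Y: "\<And>k. Y k \<in> U_nonneg n" and U: "\<And>k. T k \<in> U_nonneg n"
    and lim: "zmat_lim T zid" and pos: "\<And>k i. 0 < T k i (i + 1)" and ij: "i \<le> j"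
  shows "0 < T k i j"
proof -
  note uY = U_nonnegD(2,5)[OF Y] and uT = U_nonnegD(2,5)[OF U]
  have dec: "T m i j \<le> T k i j" if "k \<le> m" for k m i j
    using that
  proof (induction m rule: dec_induct)
    case (step m)
    have "T (Suc m) \<le> T m" unfolding T[of m] by (intro zmult_ge_right uY uT)
    then show ?case using step by (auto simp: le_fun_def intro: order_trans)
  qed simp
  have "0 < T k i (i + int d)" for d
  proof (induction d arbitrary: k i)
    case 0
    then show ?case using uT(1) by simp
  next
    case (Suc d)
    have "\<exists>m\<ge>k. 0 < Y m i (i + 1)"
    proof (rule ccontr)
      assume "\<not> ?thesis"
      then have zero: "Y m i (i + 1) = 0" if "k \<le> m" for m
        using that uY(2)[of m i "i + 1"] by (auto simp: less_le)
      have const: "T m i (i + 1) = T k i (i + 1)" if "k \<le> m" for m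
        using that
      proof (induction m rule: dec_induct)
        case (step m)
        have "T m i (i + 1) = Y m i (i + 1) + T (Suc m) i (i + 1)"
          by (subst T) (rule zmult_superdiag[OF uY(1) uT(1)])
        then show ?case using step zero by simp
      qed simp
      have "(\<lambda>m. T m i (i + 1)) \<longlonglongrightarrow> T k i (i + 1)"
        by (rule tendsto_eventually[OF eventually_sequentiallyI[of k]]) (rule const)
      moreover have "(\<lambda>m. T m i (i + 1)) \<longlonglongrightarrow> zid i (i + 1)" using lim by (simp add: zmat_lim_def)
      ultimately have "T k i (i + 1) = zid i (i + 1)" by (rule LIMSEQ_unique)
      then show False using pos[of k i] by (simp add: zid_def)
    qed
    then obtain m where m: "k \<le> m" "0 < Y m i (i + 1)" by blast
    let ?j = "i + int (Suc d)"
    have "0 < Y m i (i + 1) * T (Suc m) (i + 1) ?j"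
      using m(2) Suc[of "Suc m" "i + 1"] by (simp add: algebra_simps)
    also have "\<dots> \<le> (Y m \<star> T (Suc m)) i ?j"
      unfolding zmult_def
      by (rule member_le_sum[of "i + 1" _ "\<lambda>r. Y m i r * T (Suc m) r ?j"])
        (auto intro: mult_nonneg_nonneg uY(2) uT(2))
    also have "\<dots> = T m i ?j" using T[of m] by simp
    also have "\<dots> \<le> T k i ?j" by (rule dec[OF m(1)])
    finally show ?case .
  qed
  from this[of "nat (j - i)"] show ?thesis using ij by simp
qed

text \<open>A single rate of decay, because a tail is shown to decay at a given rate only after
  discarding a number of factors that depends on the rate.\<close>

definition bounded_growth :: "real \<Rightarrow> zmat \<Rightarrow> bool" where
  "bounded_growth e X \<longleftrightarrow> (\<exists>C\<ge>0. \<forall>i j. X i j \<le> C * e ^ nat (j - i))"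

lemma entire_iff: assumes "upper_unipotent X" shows "entire X \<longleftrightarrow> (\<forall>e>0. bounded_growth e X)"
proof -
  have "0 \<le> C" if "\<forall>i j. X i j \<le> C * e ^ nat (j - i)" for C e
    using that[rule_format, of 0 0] assms by simp
  then show ?thesis unfolding entire_def bounded_growth_def by blast
qed

text \<open>At distance \<open>d\<close> there are \<open>d + 1 \<le> 2 ^ d\<close> summands, and
  halving the rate absorbs them.\<close>

lemma bounded_growth_zmult:
  assumes "bounded_growth (e / 2) X" "bounded_growth (e / 2) Y" "0 < e"
    and nn: "\<And>i j. 0 \<le> X i j" "\<And>i j. 0 \<le> Y i j"
  shows "bounded_growth e (X \<star> Y)"
proof -
  obtain C D where C: "0 \<le> C" "\<And>i j. X i j \<le> C * (e / 2) ^ nat (j - i)"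
    and D: "0 \<le> D" "\<And>i j. Y i j \<le> D * (e / 2) ^ nat (j - i)"
    using assms by (auto simp: bounded_growth_def)
  have "(X \<star> Y) i j \<le> (C * D) * e ^ nat (j - i)" for i j
  proof (cases "i \<le> j")
    case True
    have "(X \<star> Y) i j \<le> (\<Sum>k = i..j. (C * D) * (e / 2) ^ nat (j - i))"
      unfolding zmult_def
    proof (rule sum_mono)
      fix k assume k: "k \<in> {i..j}"
      have "X i k * Y k j \<le> (C * (e / 2) ^ nat (k - i)) * (D * (e / 2) ^ nat (j - k))"
        using C D nn assms(3) by (intro mult_mono) auto
      also have "\<dots> = (C * D) * (e / 2) ^ (nat (k - i) + nat (j - k))" by (simp add: power_add)
      also have "nat (k - i) + nat (j - k) = nat (j - i)" using k by auto
      finally show "X i k * Y k j \<le> (C * D) * (e / 2) ^ nat (j - i)" .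
    qed
    also have "\<dots> = (C * D) * (e / 2) ^ nat (j - i) * real (Suc (nat (j - i)))"
      using True by (simp add: nat_add_distrib nat_diff_distrib' Suc_nat_eq_nat_zadd1 algebra_simps)
    also have "\<dots> \<le> (C * D) * (e / 2) ^ nat (j - i) * 2 ^ nat (j - i)"
    proof (rule mult_left_mono)
      show "real (Suc (nat (j - i))) \<le> 2 ^ nat (j - i)"
        using less_exp[of "nat (j - i)"] by (metis Suc_leI of_nat_le_iff of_nat_numeral of_nat_power)
      show "0 \<le> (C * D) * (e / 2) ^ nat (j - i)" using C D assms(3) by simp
    qed
    also have "\<dots> = (C * D) * e ^ nat (j - i)" by (simp add: power_divide)
    finally show ?thesis .
  next
    case False
    then show ?thesis using C D assms(3) by (simp add: zmult_lower)
  qed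
  then show ?thesis unfolding bounded_growth_def using C D by (intro exI[of _ "C * D"]) auto
qed

lemma entire_zmult:
  assumes "X \<in> U_nonneg n" "Y \<in> U_nonneg n" "entire X" "entire Y" shows "entire (X \<star> Y)"
proof -
  note X = U_nonnegD[OF assms(1)] and Y = U_nonnegD[OF assms(2)]
  have "bounded_growth e (X \<star> Y)" if "0 < e" for e
    using assms(3,4) that entire_iff X(2) Y(2) by (intro bounded_growth_zmult X Y) auto
  then show ?thesis using X Y by (simp add: entire_iff)
qed

lemma entire_chevalley: assumes "0 \<le> a" shows "entire (chevalley n i a)"
  unfolding entire_def
proof (intro allI impI)
  fix e :: real assume e: "0 < e"
  have "chevalley n i a p q \<le> (1 + a / e) * e ^ nat (q - p)" for p q
    using e assms by (auto simp: chevalley_def field_simps)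
  then show "\<exists>C. \<forall>p q. chevalley n i a p q \<le> C * e ^ nat (q - p)" by blast
qed

lemma entire_zid: "entire zid"
  unfolding entire_def by (auto simp: zid_def intro!: exI[of _ 1])

lemma entire_fcp: "F \<in> fcp \<Longrightarrow> entire F"
  by (induction rule: fcp_induct)
    (auto intro: entire_zid entire_zmult entire_chevalley chevalley_U_nonneg bimultD(1)[OF fcp_bimult])

lemma U_nonneg_growth:
  assumes X: "X \<in> U_nonneg n" and e: "\<And>i. X i (i + 1) \<le> e" "0 \<le> e"
  shows "X i j \<le> e ^ nat (j - i)"
proof (cases "i \<le> j")
  case True
  have "X i (i + int d) \<le> e ^ d" for d
  proof (induction d arbitrary: i)
    case 0
    then show ?case using U_nonnegD(2)[OF X] by simp
  next
    case (Suc d)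
    have "X i (i + int (Suc d)) \<le> X i (i + 1) * X (i + 1) (i + 1 + int d)"
      using U_nonneg_submult[OF X, of i "i + 1" "i + int (Suc d)"] by (simp add: algebra_simps)
    also have "\<dots> \<le> e * e ^ d" using Suc e U_nonnegD(5)[OF X] by (intro mult_mono) auto
    finally show ?case by simp
  qed
  from this[of "nat (j - i)"] show ?thesis using True by simp
next
  case False
  then show ?thesis using U_nonnegD(2)[OF X] by (simp add: upper_unipotent_lower)
qed

lemma zperiodic_superdiag:
  assumes "zperiodic n X" shows "X i (i + 1) = X (int (nat (i mod int n))) (int (nat (i mod int n)) + 1)"
proof -
  have i: "int (nat (i mod int n)) = i mod int n" using n_ge_2 by simp
  obtain m where m: "i mod int n = i + m * int n"
    by (rule mod_eq_shiftE[of "i mod int n" i]) auto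
  show ?thesis using zperiodic_shift[OF assms, of i m "i + 1"] unfolding i unfolding m by (simp add: algebra_simps)
qed

lemma tails_growth:
  assumes U: "\<And>k. T k \<in> U_nonneg n" and lim: "zmat_lim T zid" and e: "0 < e"
  shows "\<exists>m. bounded_growth e (T m)"
proof -
  have "\<forall>\<^sub>F m in sequentially. \<forall>d\<in>{..<n}. T m (int d) (int d + 1) < e"
  proof (intro eventually_ball_finite ballI)
    fix d :: nat
    have "(\<lambda>m. T m (int d) (int d + 1)) \<longlonglongrightarrow> zid (int d) (int d + 1)"
      using lim by (simp add: zmat_lim_def)
    then show "\<forall>\<^sub>F m in sequentially. T m (int d) (int d + 1) < e"
      using e by (intro order_tendstoD) (auto simp: zid_def)
  qed simp
  then obtain m where m: "\<And>d. d < n \<Longrightarrow> T m (int d) (int d + 1) < e"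
    by (auto simp: eventually_sequentially)
  have "T m i (i + 1) \<le> e" for i
    using m[of "nat (i mod int n)"] zperiodic_superdiag[OF U_nonnegD(1)[OF U], of m i] n_ge_2
    by (simp add: nat_less_iff)
  then have "T m i j \<le> 1 * e ^ nat (j - i)" for i j
    using U_nonneg_growth[OF U] e by simp
  then show ?thesis unfolding bounded_growth_def by (meson zero_le_one)
qed

text \<open>For each rate, split at a tail whose superdiagonal entries are below
  \<open>e / 2\<close>; submultiplicativity bounds this tail, and finitely many entire factors
  remain.\<close>

lemma entire_tails:
  assumes Y: "\<And>k. Y k \<in> bimult" "\<And>k. entire (Y k)"
    and U: "\<And>k. T k \<in> U_nonneg n" and lim: "zmat_lim T zid"
    and X: "X \<in> U_nonneg n" "\<And>k. X = partial_prod Y k \<star> T k"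
  shows "entire X"
proof -
  have P: "partial_prod Y k \<in> U_nonneg n" for k
    by (rule bimultD(1)[OF partial_prod_bimult[OF Y(1)]])
  have ent: "entire (partial_prod Y k)" for k
    by (induction k) (auto intro: entire_zid entire_zmult P Y bimultD(1))
  have "bounded_growth e X" if e: "0 < e" for e
  proof -
    obtain m where m: "bounded_growth (e / 2) (T m)"
      using tails_growth[OF U lim half_gt_zero[OF e]] by blast
    have "bounded_growth (e / 2) (partial_prod Y m)"
      using ent e by (simp add: entire_iff[OF U_nonnegD(2)[OF P]])
    then show ?thesis
      unfolding X(2)[of m] using m e U_nonnegD(5)[OF P] U_nonnegD(5)[OF U]
      by (intro bounded_growth_zmult)
  qed
  then show ?thesis using U_nonnegD(2)[OF X(1)] by (simp add: entire_iff)
qed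

section \<open>Characterization of \<open>\<Omega>\<close>\<close>

abbreviation \<Omega> :: "zmat set" where
  "\<Omega> \<equiv> Omega n"

lemma greedy_lim_imp_Omega: assumes "greedy_lim X zid" shows "X \<in> \<Omega>"
proof -
  obtain Z where Z: "Z 0 = X" "gchain Z" "zmat_lim Z zid" using assms by (auto simp: greedy_lim_def)
  obtain w where w: "\<And>k. gstep (w k) (Z k) (Z (Suc k))"
    using Z(2) unfolding gchain_def greedy_step_def by metis
  note c = gstep_cstep[OF w]
  note uZ = AdmD(2)[OF gchain_Adm[OF Z(2)]]
  define a where "a k = mu (Z k) (w k)" for k
  let ?P = "partial_prod (\<lambda>k. chevalley n (w k) (a k))"
  have uP: "upper_unipotent (?P k)" for k by (induction k) auto
  have "?P k \<star> Z k = X" for k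
  proof (induction k)
    case 0
    then show ?case using zid_zmult[OF uZ[of 0]] Z(1) by simp
  next
    case (Suc k)
    have "chevalley n (w k) (a k) \<star> Z (Suc k) = Z k"
      using cstepD(4)[OF c, of k] by (simp add: a_def chevalley_zmult[OF uZ])
    then show ?case using Suc by (simp add: zmult_assoc)
  qed
  then have "?P k = Z 0 \<star> zinv (Z k)" for k
    using uP uZ Z(1) by (metis zmult_assoc zmult_zid zmult_zinv)
  then have prod: "has_right_inf_prod (\<lambda>k. chevalley n (w k) (a k)) X"
    using gchain_quotient_lim[OF Z(2,3)] Z(1) by (simp add: has_right_inf_prod_def zmat_lim_def)
  have pos: "0 < a k" for k using cstepD(3)[OF c] by (simp add: a_def)
  \<comment> \<open>The superdiagonal sum over one period: each division takes \<open>a k\<close>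
    out of it, which bounds the sum of all parameters.\<close>
  define s where "s Y = (\<Sum>d<n. Y (int d) (int d + 1))" for Y :: zmat
  have s_step: "s (Z k) = a k + s (Z (Suc k))" for k
  proof -
    define d where "d = nat (w k mod int n)"
    have d: "d < n" "int d mod int n = w k mod int n" using n_ge_2 by (auto simp: d_def nat_less_iff)
    have iff: "int e mod int n = w k mod int n \<longleftrightarrow> e = d" if "e < n" for e
      using that d by (metis mod_less of_nat_eq_iff zmod_int)
    have "Z k (int e) (int e + 1) = Z (Suc k) (int e) (int e + 1) + (if e = d then a k else 0)"
      if "e < n" for e
      using iff[OF that] uZ by (subst cstepD(4)[OF c]) (simp add: rw_def a_def)
    then have "s (Z k) = (\<Sum>e<n. Z (Suc k) (int e) (int e + 1) + (if e = d then a k else 0))"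
      unfolding s_def by (intro sum.cong) auto
    also have "\<dots> = s (Z (Suc k)) + a k" using d by (simp add: s_def sum.distrib)
    finally show ?thesis by simp
  qed
  have "(\<Sum>j<k. a j) + s (Z k) = s X" for k
  proof (induction k)
    case (Suc k)
    then show ?case using s_step[of k] by simp
  qed (simp add: Z(1))
  moreover have "0 \<le> s (Z k)" for k
    unfolding s_def using AdmD(6)[OF gchain_Adm[OF Z(2)]] by (intro sum_nonneg)
  ultimately have "(\<Sum>j<k. a j) \<le> s X" for k by (metis le_add_same_cancel1)
  then have "summable a" using pos by (intro summableI_nonneg_bounded[of a "s X"]) (auto intro: less_imp_le)
  moreover have "infinite_reduced_word n w" by (rule greedy_word_reduced[of w Z]) (rule w)
  ultimately show ?thesis unfolding Omega_def l1_pos_def using prod pos by blast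
qed

lemma Adm_tails_greedy:
  assumes X: "X \<in> U_nonneg n" "entire X" "\<And>i j. i \<le> j \<Longrightarrow> 0 < X i j"
    and Y: "\<And>k. Y k \<in> fcp" and lim: "has_right_inf_prod Y X"
  shows "greedy_lim X zid"
proof -
  obtain T where T: "T 0 = X" "\<And>k. T k = Y k \<star> T (Suc k)" "\<And>k. T k \<in> bimult" "zmat_lim T zid"
    using inf_prod_tails[OF fcp_bimult[OF Y] lim] by metis
  have "X \<in> Adm" unfolding Adm_def using U_nonnegD(1,2,4)[OF X(1)] X(2,3) by blast
  then show ?thesis
    using greedy_lim_inf_prod[of T Y, OF T(2) Y bimultD(1)[OF T(3)]] T(1,4) by simp
qed

text \<open>Reducedness enters through the recurrence of every letter, which makes the superdiagonal
  entries of all tails positive.\<close>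

lemma OmegaD:
  assumes "X \<in> \<Omega>"
  shows "X \<in> bimult" "X \<in> Adm" "greedy_lim X zid"
proof -
  obtain w a where wa: "infinite_reduced_word n w" "a \<in> l1_pos"
    "has_right_inf_prod (\<lambda>k. chevalley n (w k) (a k)) X"
    using assms by (auto simp: Omega_def)
  have a: "0 < a k" for k using wa(2) by (simp add: l1_pos_def)
  define Y where "Y k = chevalley n (w k) (a k)" for k
  have Yf: "Y k \<in> fcp" for k unfolding Y_def using a by (intro chevalley_fcp) (simp add: less_imp_le)
  note Yb = fcp_bimult[OF Yf] and YU = bimultD(1)[OF fcp_bimult[OF Yf]]
  have lim: "has_right_inf_prod Y X" using wa(3) by (simp add: Y_def[abs_def])
  obtain T where T: "T 0 = X" "\<And>k. T k = Y k \<star> T (Suc k)" "\<And>k. T k \<in> bimult" "zmat_lim T zid"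
    "\<And>k. X = partial_prod Y k \<star> T k"
    using inf_prod_tails[OF Yb lim] by metis
  note TU = bimultD(1)[OF T(3)]
  have sup: "T k i (i + 1) = Y k i (i + 1) + T (Suc k) i (i + 1)" for k i
    by (subst T(2)) (rule zmult_superdiag[OF U_nonnegD(2)[OF YU] U_nonnegD(2)[OF TU]])
  have pos: "0 < T k i (i + 1)" for k i
  proof -
    obtain m where m: "k \<le> m" "w m mod int n = i mod int n"
      using infinite_reduced_word_letters[OF wa(1)] by blast
    have "T m i (i + 1) \<le> T k i (i + 1)"
      using m(1)
    proof (induction m rule: dec_induct)
      case (step m)
      then show ?case using sup[of m i] U_nonnegD(5)[OF YU, of m i "i + 1"] by simp
    qed simp
    moreover have "0 < T m i (i + 1)"
      using sup[of m i] U_nonnegD(5)[OF TU, of "Suc m" i "i + 1"] a[of m] m(2)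
      by (simp add: Y_def chevalley_def)
    ultimately show ?thesis by simp
  qed
  show Xb: "X \<in> bimult" using T(1,3) by metis
  have full: "0 < X i j" if "i \<le> j" for i j
    using tails_full[OF T(2) YU TU T(4) pos that, of 0] T(1) by simp
  have ent: "entire X"
    by (rule entire_tails[OF Yb entire_fcp[OF Yf] TU T(4) bimultD(1)[OF Xb] T(5)])
  show "X \<in> Adm" unfolding Adm_def using U_nonnegD(1,2,4)[OF bimultD(1)[OF Xb]] full ent by blast
  show "greedy_lim X zid" by (rule Adm_tails_greedy[OF bimultD(1)[OF Xb] ent full Yf lim])
qed

lemma Omega_U: "X \<in> \<Omega> \<Longrightarrow> X \<in> U_nonneg n"
  using OmegaD(1) bimultD(1) by blast

text \<open>Prepending \<open>F\<close> gives another convergent product of finite factors;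
  positivity of the entries is inherited from \<open>X \<le> F \<star> X\<close>.\<close>

lemma fcp_Omega_zmult: assumes F: "F \<in> fcp" and X: "X \<in> \<Omega>" shows "F \<star> X \<in> \<Omega>"
proof (rule greedy_lim_imp_Omega)
  note FU = bimultD(1)[OF fcp_bimult[OF F]]
  have U: "F \<star> X \<in> U_nonneg n" by (rule bimultD(2)[OF fcp_bimult[OF F] Omega_U[OF X]])
  have ent: "entire (F \<star> X)"
    by (rule entire_zmult[OF FU Omega_U[OF X] entire_fcp[OF F] AdmD(5)[OF OmegaD(2)[OF X]]])
  have "X \<le> F \<star> X" by (intro zmult_ge_right U_nonnegD[OF FU] U_nonnegD[OF Omega_U[OF X]])
  then have full: "0 < (F \<star> X) i j" if "i \<le> j" for i j
    using AdmD(3)[OF OmegaD(2)[OF X] that] by (auto simp: le_fun_def intro: less_le_trans)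
  obtain w a where wa: "a \<in> l1_pos" "has_right_inf_prod (\<lambda>k. chevalley n (w k) (a k)) X"
    using X by (auto simp: Omega_def)
  define Y where "Y = case_nat F (\<lambda>k. chevalley n (w k) (a k))"
  have Yf: "Y k \<in> fcp" for k
    using F wa(1) chevalley_fcp by (auto simp: Y_def l1_pos_def less_imp_le split: nat.split)
  have P: "partial_prod Y (Suc k) = F \<star> partial_prod (\<lambda>k. chevalley n (w k) (a k)) k" for k
    by (induction k) (auto simp: Y_def zmult_assoc fcp_uu[OF F])
  have "(\<lambda>k. partial_prod Y (Suc k) i j) \<longlonglongrightarrow> (F \<star> X) i j" for i j
    unfolding P using wa(2)
    by (intro tendsto_zmult tendsto_const) (auto simp: has_right_inf_prod_def zmat_lim_def)
  then have "(\<lambda>k. partial_prod Y k i j) \<longlonglongrightarrow> (F \<star> X) i j" for i j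
    by (rule LIMSEQ_imp_Suc)
  then have "has_right_inf_prod Y (F \<star> X)" unfolding has_right_inf_prod_def zmat_lim_def by blast
  then show "greedy_lim (F \<star> X) zid" using Adm_tails_greedy[of "F \<star> X" Y, OF U ent full Yf] by blast
qed

text \<open>If some tail has a zero on its superdiagonal, Whitney's factorization makes it a finite
  product. Otherwise all entries are positive and greedy division exhausts \<open>X\<close>.\<close>

lemma fcp_inf_prod:
  assumes Y: "\<And>k. Y k \<in> fcp" and lim: "has_right_inf_prod Y X" shows "X \<in> fcp \<or> X \<in> \<Omega>"
proof -
  note Yb = fcp_bimult[OF Y] and YU = bimultD(1)[OF fcp_bimult[OF Y]]
  obtain T where T: "T 0 = X" "\<And>k. T k = Y k \<star> T (Suc k)" "\<And>k. T k \<in> bimult" "zmat_lim T zid"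
    "\<And>k. X = partial_prod Y k \<star> T k"
    using inf_prod_tails[OF Yb lim] by metis
  note TU = bimultD(1)[OF T(3)]
  have XU: "X \<in> U_nonneg n" using TU[of 0] T(1) by simp
  show ?thesis
  proof (cases "\<exists>k z. T k z (z + 1) = 0")
    case True
    then obtain k z where "T k z (z + 1) = 0" by blast
    then have "T k \<in> fcp" using fcp_if_superdiag_zero U_nonnegD[OF TU] by blast
    moreover have "partial_prod Y k \<in> fcp" by (induction k) (auto intro: zid_fcp fcp_zmult Y)
    ultimately have "partial_prod Y k \<star> T k \<in> fcp" by (intro fcp_zmult)
    then show ?thesis unfolding T(5)[of k, symmetric] ..
  next
    case False
    then have pos: "0 < T k i (i + 1)" for k i
      using U_nonnegD(5)[OF TU, of k i "i + 1"] by (simp add: less_le)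
    have full: "0 < X i j" if "i \<le> j" for i j
      using tails_full[OF T(2) YU TU T(4) pos that, of 0] T(1) by simp
    have ent: "entire X" by (rule entire_tails[OF Yb entire_fcp[OF Y] TU T(4) XU T(5)])
    show ?thesis using greedy_lim_imp_Omega[OF Adm_tails_greedy[OF XU ent full Y lim]] by simp
  qed
qed

lemma Omega_divide_chevalley:
  assumes X: "X \<in> \<Omega>" and t: "0 < t" and X': "X' \<in> U_nonneg n" and eq: "X = chevalley n i t \<star> X'"
  shows "X' \<in> \<Omega>"
proof -
  have rw: "X = rw i t X'" using eq chevalley_zmult U_nonnegD(2)[OF X'] by simp
  have "rw i t X' \<in> Adm" using OmegaD(2)[OF X] unfolding rw .
  then have "X' \<in> Adm" using Adm_rwD less_imp_le[OF t] U_nonnegD(1,2,4)[OF X'] by blast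
  then have "cstep i t X X'" unfolding cstep_def using OmegaD(2)[OF X] rw t by blast
  then have "chev_step X X'" by (auto simp: chev_step_def)
  then show ?thesis using greedy_lim_cst[OF OmegaD(3)[OF X]] greedy_lim_imp_Omega by blast
qed

text \<open>Both cofactors are the greedy limit of the same matrix.\<close>

lemma Omega_factor_unique:
  assumes "Y \<in> \<Omega>" "Y' \<in> \<Omega>" "Z \<in> U_nonneg n" "Z' \<in> U_nonneg n" "Y \<star> Z = Y' \<star> Z'" "entire (Y \<star> Z)"
  shows "Z = Z'"
proof (rule greedy_lim_unique)
  show "greedy_lim (Y \<star> Z) Z" by (rule greedy_lim_zmult[OF OmegaD(3)[OF assms(1)] assms(3,6)])
  show "greedy_lim (Y \<star> Z) Z'"
    using assms(6) unfolding assms(5) by (rule greedy_lim_zmult[OF OmegaD(3)[OF assms(2)] assms(4)])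
qed

lemma Omega_no_divisor:
  assumes "X \<in> \<Omega>" "Y \<in> \<Omega>" "Z \<in> U_nonneg n" "X = Y \<star> Z" shows "Z = zid"
proof (rule Omega_factor_unique[OF assms(2,1,3) zid_U_nonneg])
  show "Y \<star> Z = X \<star> zid" using zmult_zid[OF AdmD(2)[OF OmegaD(2)[OF assms(1)]]] assms(4) by metis
  show "entire (Y \<star> Z)" using AdmD(5)[OF OmegaD(2)[OF assms(1)]] assms(4) by metis
qed

lemma fcp_no_Omega_divisor:
  assumes "Y \<in> \<Omega>" "Z \<in> U_nonneg n" shows "Y \<star> Z \<notin> fcp"
proof
  assume F: "Y \<star> Z \<in> fcp"
  have "Y \<le> Y \<star> Z" by (intro zmult_ge_left U_nonnegD[OF Omega_U[OF assms(1)]] U_nonnegD[OF assms(2)])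
  then have "0 < (Y \<star> Z) i j" if "i \<le> j" for i j
    using AdmD(3)[OF OmegaD(2)[OF assms(1)] that] by (auto simp: le_fun_def intro: less_le_trans)
  then show False using fcp_not_full[OF F] by blast
qed

end

section \<open>Transfinite iteration of a decreasing map\<close>

definition greatest_lower :: "'a::order \<Rightarrow> 'a set \<Rightarrow> bool" where
  "greatest_lower w C \<longleftrightarrow> (\<forall>y\<in>C. w \<le> y) \<and> (\<forall>v. (\<forall>y\<in>C. v \<le> y) \<longrightarrow> v \<le> w)"

lemma greatest_lowerD: "greatest_lower w C \<Longrightarrow> y \<in> C \<Longrightarrow> w \<le> y" "greatest_lower w C \<Longrightarrow> (\<And>y. y \<in> C \<Longrightarrow> v \<le> y) \<Longrightarrow> v \<le> w"
  by (auto simp: greatest_lower_def)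

text \<open>The Bourbaki-Witt tower: the transfinite iterates of \<open>f\<close> from
  \<open>x\<close>, with greatest lower bounds as limit stages.\<close>

inductive_set tower :: "('a::order \<Rightarrow> 'a) \<Rightarrow> 'a \<Rightarrow> 'a set" for f x where
  base: "x \<in> tower f x"
| step: "y \<in> tower f x \<Longrightarrow> f y \<in> tower f x"
| glb: "(\<And>y. y \<in> C \<Longrightarrow> y \<in> tower f x) \<Longrightarrow> C \<noteq> {} \<Longrightarrow> greatest_lower w C \<Longrightarrow> w \<in> tower f x"

lemma tower_trans: "z \<in> tower f y \<Longrightarrow> y \<in> tower f x \<Longrightarrow> z \<in> tower f x"
proof (induction rule: tower.induct)
  case (glb C w)
  then show ?case using tower.glb[of C f x w] by blast
qed (auto intro: tower.step)

locale decreasing_map =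
  fixes f :: "'a::order \<Rightarrow> 'a"
  assumes dec: "f y \<le> y"
begin

lemma tower_le: "y \<in> tower f x \<Longrightarrow> y \<le> x"
proof (induction rule: tower.induct)
  case (glb C w)
  then obtain y where "y \<in> C" by blast
  then show ?case using glb greatest_lowerD(1) order_trans by blast
qed (use dec in \<open>auto intro: order_trans\<close>)

lemma tower_split: "z \<in> tower f x \<Longrightarrow> z = x \<or> z \<in> tower f (f x)"
proof (induction rule: tower.induct)
  case (step y)
  then show ?case by (auto intro: tower.step tower.base)
next
  case (glb C w)
  show ?case
  proof (cases "C - {x} = {}")
    case True
    then have "x \<in> C" "C \<subseteq> {x}" using glb by auto
    then have "w \<le> x" "x \<le> w" using glb(3) greatest_lowerD by blast+
    then show ?thesis by simp
  next
    case False
    then obtain y where y: "y \<in> C" "y \<noteq> x" by blast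
    then have "y \<in> tower f (f x)" using glb by blast
    then have yx: "y \<le> x" using tower_le dec order_trans by blast
    have "greatest_lower w (C - {x})"
      unfolding greatest_lower_def
    proof (intro conjI allI impI ballI)
      fix v assume v: "\<forall>y\<in>C - {x}. v \<le> y"
      then have "v \<le> z" if "z \<in> C" for z
        using that y yx by (cases "z = x") (auto intro: order_trans)
      then show "v \<le> w" using glb(3) greatest_lowerD(2) by blast
    qed (use glb(3) greatest_lowerD(1) in blast)
    moreover have "z \<in> tower f (f x)" if "z \<in> C - {x}" for z using that glb(4) by blast
    ultimately have "w \<in> tower f (f x)" using tower.glb[of "C - {x}" f "f x" w] False by blast
    then show ?thesis by blast
  qed
qed simp

text \<open>Nothing lies strictly between \<open>c\<close> and \<open>f c\<close>. The assumption
  says that stages above \<open>c\<close> cannot jump past it; \<open>tower_step_ge\<close> proves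
  it by induction on \<open>c\<close>.\<close>

lemma tower_cases_aux:
  assumes E: "\<And>w. w \<in> tower f x \<Longrightarrow> c < w \<Longrightarrow> c \<le> f w" and c: "c \<in> tower f x"
  shows "w \<in> tower f x \<Longrightarrow> c \<le> w \<or> w \<le> f c"
proof (induction rule: tower.induct)
  case base
  then show ?case using tower_le[OF c] by blast
next
  case (step w)
  then show ?case
  proof (elim disjE)
    assume "c \<le> w"
    then show ?thesis using E[OF step(1)] by (cases "c = w") auto
  next
    assume "w \<le> f c"
    then show ?thesis using dec[of w] by (auto intro: order_trans)
  qed
next
  case (glb C w)
  show ?case
  proof (cases "\<forall>y\<in>C. c \<le> y")
    case True
    then show ?thesis using glb(3) greatest_lowerD(2) by blast
  next
    case False
    then obtain y where "y \<in> C" "y \<le> f c" using glb(4) by blast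
    then show ?thesis using glb(3) greatest_lowerD(1) order_trans by blast
  qed
qed

lemma tower_step_ge: "c \<in> tower f x \<Longrightarrow> w \<in> tower f x \<Longrightarrow> c < w \<Longrightarrow> c \<le> f w"
proof (induction arbitrary: w rule: tower.induct)
  case base
  then show ?case using tower_le[of w x] by auto
next
  case (step c)
  have "c \<le> w \<or> w \<le> f c" by (rule tower_cases_aux[OF step(2,1,3)])
  then have "c \<le> w" using step(4) by auto
  then show ?case using step(2)[OF step(3)] dec[of c] by (cases "c = w") (auto intro: order_trans)
next
  case (glb C v)
  have "\<exists>y\<in>C. \<not> w \<le> y"
    using greatest_lowerD(2)[OF glb(3), of w] glb(6) by (meson leD)
  then obtain y where y: "y \<in> C" "\<not> w \<le> y" by blast
  have "y \<le> w \<or> w \<le> f y" by (rule tower_cases_aux[OF glb(4)[OF y(1)] glb(1)[OF y(1)] glb(5)])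
  then have "y < w" using y(2) dec[of y] by (auto simp: less_le intro: order_trans)
  then have "y \<le> f w" using glb(4)[OF y(1) glb(5)] by blast
  then show ?case using greatest_lowerD(1)[OF glb(3) y(1)] by (rule order_trans[rotated])
qed

lemma tower_cases: "c \<in> tower f x \<Longrightarrow> w \<in> tower f x \<Longrightarrow> c \<le> w \<or> w \<le> f c"
  using tower_cases_aux tower_step_ge by metis

lemma tower_linear: "c \<in> tower f x \<Longrightarrow> w \<in> tower f x \<Longrightarrow> c \<le> w \<or> w \<le> c"
  using tower_cases[of c x w] dec[of c] by (auto intro: order_trans)

text \<open>The iteration cannot get below a fixed point, since a stage strictly above it cannot
  step past it.\<close>

lemma tower_fixpoint_least:
  assumes c: "c \<in> tower f x" "f c = c" shows "w \<in> tower f x \<Longrightarrow> c \<le> w"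
proof (induction rule: tower.induct)
  case base
  then show ?case using tower_le c by blast
next
  case (step w)
  then show ?case using tower_step_ge[OF c(1) step(1)] c(2) by (cases "c = w") auto
next
  case (glb C w)
  then show ?case using greatest_lowerD(2)[OF glb(3)] by blast
qed

text \<open>The reversed tower is well-ordered. Take the greatest lower bound \<open>m\<close> of
  all upper bounds of \<open>B\<close> in the tower: if \<open>m\<close> is not in \<open>B\<close>,
  then \<open>f m\<close> is again an upper bound, so \<open>m\<close> is fixed and therefore the
  least stage, which puts it into \<open>B\<close>.\<close>

lemma tower_greatest:
  assumes B: "B \<subseteq> tower f x" "B \<noteq> {}"
    and ex: "\<And>C. C \<subseteq> tower f x \<Longrightarrow> C \<noteq> {} \<Longrightarrow> \<exists>w. greatest_lower w C"
  obtains m where "m \<in> B" "\<And>b. b \<in> B \<Longrightarrow> b \<le> m"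
proof -
  define Ub where "Ub = {w \<in> tower f x. \<forall>b\<in>B. b \<le> w}"
  have Ub: "Ub \<subseteq> tower f x" "x \<in> Ub" using B tower_le by (auto simp: Ub_def intro: tower.base)
  then obtain m where m: "greatest_lower m Ub" using ex[of Ub] by blast
  have mt: "m \<in> tower f x" by (rule tower.glb[of Ub]) (use m Ub in auto)
  have bm: "b \<le> m" if "b \<in> B" for b
    using that by (intro greatest_lowerD(2)[OF m]) (auto simp: Ub_def)
  have "m \<in> B"
  proof (rule ccontr)
    assume "m \<notin> B"
    have "b \<le> f m" if b: "b \<in> B" for b
      using tower_cases[of m x b] mt B(1) bm[OF b] b \<open>m \<notin> B\<close> by (auto dest: order_antisym)
    then have "f m \<in> Ub" using mt by (auto simp: Ub_def intro: tower.step)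
    then have "f m = m" using greatest_lowerD(1)[OF m] dec[of m] by (simp add: order_antisym)
    obtain b where b: "b \<in> B" using B(2) by blast
    then have "m \<le> b" using tower_fixpoint_least[OF mt \<open>f m = m\<close>] B(1) by blast
    then show False using bm[OF b] b \<open>m \<notin> B\<close> by (simp add: order_antisym)
  qed
  then show thesis using that bm by blast
qed

end

section \<open>Limits along directed sets\<close>

lemma eventually_directed:
  assumes "A \<noteq> {}"
    and "\<And>a b. a \<in> A \<Longrightarrow> b \<in> A \<Longrightarrow> \<exists>c\<in>A. \<forall>d\<in>A. R c d \<longrightarrow> R a d \<and> R b d"
  shows "eventually P (INF a\<in>A. principal {b \<in> A. R a b}) \<longleftrightarrow> (\<exists>a\<in>A. \<forall>b\<in>A. R a b \<longrightarrow> P b)"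
proof -
  have "eventually P (INF a\<in>A. principal {b \<in> A. R a b}) \<longleftrightarrow>
      (\<exists>a\<in>A. eventually P (principal {b \<in> A. R a b}))"
  proof (rule eventually_INF_base[OF assms(1)])
    fix a b assume "a \<in> A" "b \<in> A"
    then obtain c where "c \<in> A" "\<forall>d\<in>A. R c d \<longrightarrow> R a d \<and> R b d" using assms(2) by blast
    then show "\<exists>c\<in>A. principal {d \<in> A. R c d} \<le> inf (principal {d \<in> A. R a d}) (principal {d \<in> A. R b d})"
      by (intro bexI[of _ c]) auto
  qed
  then show ?thesis by (auto simp: eventually_principal)
qed

lemma directed_neq_bot:
  assumes "A \<noteq> {}" "\<And>a. a \<in> A \<Longrightarrow> R a a"
    and "\<And>a b. a \<in> A \<Longrightarrow> b \<in> A \<Longrightarrow> \<exists>c\<in>A. \<forall>d\<in>A. R c d \<longrightarrow> R a d \<and> R b d"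
  shows "(INF a\<in>A. principal {b \<in> A. R a b}) \<noteq> bot"
  unfolding trivial_limit_def using eventually_directed[OF assms(1,3), where P = "\<lambda>_. False"] assms(2) by auto

lemma zmat_glb_exists:
  fixes C :: "zmat set"
  assumes "C \<noteq> {}" "\<And>Z i j. Z \<in> C \<Longrightarrow> 0 \<le> Z i j"
  shows "\<exists>w. greatest_lower w C"
proof
  have bdd: "bdd_below ((\<lambda>Z. Z i j) ` C)" for i j
    using assms(2) by (intro bdd_belowI2[of _ 0])
  show "greatest_lower (\<lambda>i j. INF Z\<in>C. Z i j) C"
    unfolding greatest_lower_def le_fun_def
    by (auto intro!: cINF_lower[OF bdd] cINF_greatest[OF assms(1)])
qed

lemma greatest_lower_approx:
  fixes C :: "zmat set"
  assumes "greatest_lower w C" "C \<noteq> {}" "0 < e" shows "\<exists>Z\<in>C. Z i j < w i j + e"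
proof (rule ccontr)
  assume not: "\<not> ?thesis"
  \<comment> \<open>Raising this single entry would keep a lower bound; so greatest lower bounds of
    matrices are entrywise infima.\<close>
  define v where "v = w(i := (w i)(j := w i j + e))"
  have "v \<le> Z" if "Z \<in> C" for Z
    using greatest_lowerD(1)[OF assms(1) that] not that by (auto simp: v_def le_fun_def not_less)
  then have "v i j \<le> w i j" using greatest_lowerD(2)[OF assms(1)] by (auto simp: le_fun_def)
  then show False using assms(3) by (simp add: v_def)
qed

lemma tendsto_glb:
  fixes g :: "'b \<Rightarrow> zmat"
  assumes glb: "greatest_lower w (g ` A)" and A: "A \<noteq> {}" and anti: "\<And>a b. a \<in> A \<Longrightarrow> b \<in> A \<Longrightarrow> R a b \<Longrightarrow> g b \<le> g a"
    and dir: "\<And>a b. a \<in> A \<Longrightarrow> b \<in> A \<Longrightarrow> \<exists>c\<in>A. \<forall>d\<in>A. R c d \<longrightarrow> R a d \<and> R b d"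
  shows "((\<lambda>a. g a i j) \<longlongrightarrow> w i j) (INF a\<in>A. principal {b \<in> A. R a b})"
proof -
  let ?F = "INF a\<in>A. principal {b \<in> A. R a b}"
  have ev: "eventually P ?F \<longleftrightarrow> (\<exists>a\<in>A. \<forall>b\<in>A. R a b \<longrightarrow> P b)" for P
    by (rule eventually_directed[OF A dir])
  show ?thesis
  proof (rule decreasing_tendsto)
    have "w i j \<le> g a i j" if "a \<in> A" for a
      using greatest_lowerD(1)[OF glb imageI[OF that]] by (simp add: le_fun_def)
    then show "\<forall>\<^sub>F a in ?F. w i j \<le> g a i j" unfolding ev using A by blast
  next
    fix x assume "w i j < x"
    then obtain a where a: "a \<in> A" "g a i j < x"
      using greatest_lower_approx[OF glb, of "x - w i j" i j] A by auto
    have "g b i j < x" if "b \<in> A" "R a b" for b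
    proof -
      have "g b i j \<le> g a i j" using anti[OF a(1) that] by (simp add: le_fun_def)
      then show ?thesis using a(2) by simp
    qed
    then show "\<forall>\<^sub>F a in ?F. g a i j < x" unfolding ev using a(1) by blast
  qed
qed

context loop
begin

section \<open>Splitting off factors in \<open>\<Omega>\<close>\<close>

text \<open>The choice is immaterial for entire matrices by \<open>Omega_factor_unique\<close>. The
  default \<open>Z\<close> makes the fixed points exactly the matrices from which nothing can be
  split off, in view of \<open>Omega_zmult_neq\<close>.\<close>

definition strip :: "zmat \<Rightarrow> zmat" where
  "strip Z = (if \<exists>Z'\<in>U_nonneg n. \<exists>Y\<in>\<Omega>. Z = Y \<star> Z'
    then SOME Z'. Z' \<in> U_nonneg n \<and> (\<exists>Y\<in>\<Omega>. Z = Y \<star> Z') else Z)"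

lemma strip_cases:
  obtains Y where "Y \<in> \<Omega>" "strip Z \<in> U_nonneg n" "Z = Y \<star> strip Z"
  | "strip Z = Z" "\<And>Y Z'. Y \<in> \<Omega> \<Longrightarrow> Z' \<in> U_nonneg n \<Longrightarrow> Z \<noteq> Y \<star> Z'"
proof (cases "\<exists>Z'\<in>U_nonneg n. \<exists>Y\<in>\<Omega>. Z = Y \<star> Z'")
  case True
  then have ex: "\<exists>Z'. Z' \<in> U_nonneg n \<and> (\<exists>Y\<in>\<Omega>. Z = Y \<star> Z')" by blast
  have "strip Z = (SOME Z'. Z' \<in> U_nonneg n \<and> (\<exists>Y\<in>\<Omega>. Z = Y \<star> Z'))"
    unfolding strip_def by (rule if_P[OF True])
  then have "strip Z \<in> U_nonneg n \<and> (\<exists>Y\<in>\<Omega>. Z = Y \<star> strip Z)" using someI_ex[OF ex] by (simp only:)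
  then show thesis using that(1) by blast
next
  case False
  then have "strip Z = Z" unfolding strip_def by (rule if_not_P)
  then show thesis using that(2) False by blast
qed

lemma strip_le: "strip Z \<le> Z"
proof (cases rule: strip_cases[of Z])
  case (1 Y)
  have "strip Z \<le> Y \<star> strip Z"
    by (intro zmult_ge_right U_nonnegD[OF Omega_U[OF 1(1)]] U_nonnegD[OF 1(2)])
  then show ?thesis using 1(3) by metis
qed simp

lemma strip_eq:
  assumes "Y \<in> \<Omega>" "Z \<in> U_nonneg n" "entire (Y \<star> Z)" shows "strip (Y \<star> Z) = Z"
proof (cases rule: strip_cases[of "Y \<star> Z"])
  case (1 Y')
  then show ?thesis using Omega_factor_unique[OF 1(1) assms(1) 1(2) assms(2)] assms(3) by metis
qed (use assms in blast)

lemma Omega_zmult_neq: assumes "Y \<in> \<Omega>" "Z \<in> U_nonneg n" shows "Y \<star> Z \<noteq> Z"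
proof
  assume "Y \<star> Z = Z"
  then have "Y 0 (0 + 1) = 0"
    using zmult_superdiag[OF U_nonnegD(2)[OF Omega_U[OF assms(1)]] U_nonnegD(2)[OF assms(2)], of 0] by simp
  then show False using AdmD(3)[OF OmegaD(2)[OF assms(1)], of 0 1] by simp
qed

lemma strip_fcp: "F \<in> fcp \<Longrightarrow> strip F = F"
  by (cases rule: strip_cases[of F]) (use fcp_no_Omega_divisor in metis)+

sublocale strip: decreasing_map strip
  by unfold_locales (rule strip_le)

lemma tower_U_entire:
  assumes X: "X \<in> U_nonneg n" "entire X" shows "Z \<in> tower strip X \<Longrightarrow> Z \<in> U_nonneg n \<and> entire Z"
proof -
  have "Z \<in> U_nonneg n" if "Z \<in> tower strip X" for Z
    using that
  proof (induction rule: tower.induct)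
    case (step Z)
    show ?case by (cases rule: strip_cases[of Z]) (use step in auto)
  next
    case (glb C w)
    \<comment> \<open>Along this filter the chain descends to its greatest lower bound, so limit
      stages inherit closed conditions.\<close>
    let ?F = "INF a\<in>C. principal {b \<in> C. b \<le> a}"
    have dir: "\<exists>c\<in>C. \<forall>d\<in>C. d \<le> c \<longrightarrow> d \<le> a \<and> d \<le> b" if "a \<in> C" "b \<in> C" for a b
      using strip.tower_linear[of a X b] glb(1) that order_trans by metis
    have ev: "eventually P ?F \<longleftrightarrow> (\<exists>a\<in>C. \<forall>b\<in>C. b \<le> a \<longrightarrow> P b)" for P
      by (rule eventually_directed[OF glb(2) dir])
    show ?case
    proof (rule U_nonneg_limit[of "\<lambda>Z. Z" w ?F])
      show "((\<lambda>Z. Z i j) \<longlongrightarrow> w i j) ?F" for i j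
        using glb(2,3) by (intro tendsto_glb[of w "\<lambda>Z. Z" C] dir) auto
      show "?F \<noteq> bot" using glb(2) dir by (intro directed_neq_bot) auto
      show "\<forall>\<^sub>F Z in ?F. Z \<in> U_nonneg n"
        unfolding ev using glb(4,2) by blast
    qed
  qed (rule X)
  then show "Z \<in> tower strip X \<Longrightarrow> Z \<in> U_nonneg n \<and> entire Z"
    using entire_le[OF X(2) strip.tower_le] by blast
qed

text \<open>Stripping the product acts on the left factor alone: membership of \<open>V\<close> in
  \<open>bimult\<close> keeps the cofactor totally nonnegative, uniqueness identifies it, and limits
  of chains commute with right multiplication by \<open>V\<close>.\<close>

lemma tower_zmult:
  assumes X: "X \<in> U_nonneg n" "entire X" and V: "V \<in> bimult" "entire V"
  shows "Z \<in> tower strip X \<Longrightarrow> Z \<star> V \<in> tower strip (X \<star> V)"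
proof (induction rule: tower.induct)
  case base
  then show ?case by (rule tower.base)
next
  case (step Z)
  note Z = tower_U_entire[OF X step(1)]
  show ?case
  proof (cases rule: strip_cases[of Z])
    case (1 Y)
    have eq: "Z \<star> V = Y \<star> (strip Z \<star> V)" using 1(3) zmult_assoc by metis
    have "entire (Z \<star> V)" using Z V bimultD(1) by (intro entire_zmult) auto
    then have "strip (Y \<star> (strip Z \<star> V)) = strip Z \<star> V"
      using eq by (intro strip_eq 1(1) bimultD(3)[OF V(1) 1(2)]) simp
    then show ?thesis using tower.step[OF step(2)] eq by simp
  qed (use step in simp)
next
  case (glb C w)
  note VU = U_nonnegD[OF bimultD(1)[OF V(1)]]
  have CU: "Z \<in> U_nonneg n" if "Z \<in> C" for Z using tower_U_entire[OF X glb(1)[OF that]] by blast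
  let ?F = "INF a\<in>C. principal {b \<in> C. b \<le> a}"
  have dir: "\<exists>c\<in>C. \<forall>d\<in>C. d \<le> c \<longrightarrow> d \<le> a \<and> d \<le> b" if "a \<in> C" "b \<in> C" for a b
    using strip.tower_linear[of a X b] glb(1) that order_trans by metis
  have lim: "((\<lambda>Z. (Z \<star> V) i j) \<longlongrightarrow> (w \<star> V) i j) ?F" for i j
    using glb(2,3) by (intro tendsto_zmult tendsto_const tendsto_glb[of w "\<lambda>Z. Z" C] dir) auto
  have ev: "eventually P ?F \<longleftrightarrow> (\<exists>a\<in>C. \<forall>b\<in>C. b \<le> a \<longrightarrow> P b)" for P
    by (rule eventually_directed[OF glb(2) dir])
  have bot: "?F \<noteq> bot" using glb(2) dir by (intro directed_neq_bot) auto
  have wU: "w \<in> U_nonneg n"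
    using tower_U_entire[OF X, of w] glb(1,2,3) by (blast intro: tower.glb)
  have "greatest_lower (w \<star> V) ((\<lambda>Z. Z \<star> V) ` C)"
    unfolding greatest_lower_def
  proof (intro conjI ballI allI impI)
    fix Z assume "Z \<in> (\<lambda>Z. Z \<star> V) ` C"
    then show "w \<star> V \<le> Z"
      using greatest_lowerD(1)[OF glb(3)] by (auto intro!: zmult_mono U_nonnegD[OF wU] VU)
  next
    fix W assume W: "\<forall>Z\<in>(\<lambda>Z. Z \<star> V) ` C. W \<le> Z"
    show "W \<le> w \<star> V"
      unfolding le_fun_def
    proof (intro allI)
      fix i j
      have "W i j \<le> (Z \<star> V) i j" if "Z \<in> C" for Z using W that by (auto simp: le_fun_def)
      then have "\<forall>\<^sub>F Z in ?F. W i j \<le> (Z \<star> V) i j" unfolding ev using glb(2) by blast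
      then show "W i j \<le> (w \<star> V) i j" by (rule tendsto_lowerbound[OF lim _ bot])
    qed
  qed
  moreover have "W \<in> tower strip (X \<star> V)" if "W \<in> (\<lambda>Z. Z \<star> V) ` C" for W
    using that glb(4) by blast
  moreover have "(\<lambda>Z. Z \<star> V) ` C \<noteq> {}" using glb(2) by blast
  ultimately show ?case
    using tower.glb[of "(\<lambda>Z. Z \<star> V) ` C" strip "X \<star> V" "w \<star> V"] by blast
qed

text \<open>A class closed under both kinds of products, made to contain \<open>L_r n\<close>. The
  conditions \<open>bimult\<close> and \<open>entire\<close> are included because multiplicativity
  of stripping rests on them.\<close>

definition strip_finite :: "zmat set" where
  "strip_finite = {X \<in> bimult. entire X \<and> (\<exists>F\<in>fcp. F \<in> tower strip X)}"

lemma fcp_strip_finite: "F \<in> fcp \<Longrightarrow> F \<in> strip_finite"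
  by (auto simp: strip_finite_def fcp_bimult entire_fcp intro: tower.base)

text \<open>If nothing can be split off, \<open>X\<close> is both the greatest and the least stage
  of its tower, hence equal to the finite stage.\<close>

lemma strip_finite_strip:
  assumes "X \<in> strip_finite" "X \<notin> fcp"
  shows "\<exists>Y\<in>\<Omega>. strip X \<in> U_nonneg n \<and> X = Y \<star> strip X"
proof (cases rule: strip_cases[of X])
  case 2
  obtain F where F: "F \<in> fcp" "F \<in> tower strip X" using assms by (auto simp: strip_finite_def)
  have "X \<le> F" by (rule strip.tower_fixpoint_least[OF tower.base 2(1) F(2)])
  then have "X = F" using strip.tower_le[OF F(2)] by simp
  then show ?thesis using F assms by simp
qed blast

lemma strip_fcp_zmult:
  assumes F: "F \<in> fcp" and Y: "Y \<in> \<Omega>" and Z: "Z \<in> U_nonneg n" and ent: "entire (F \<star> (Y \<star> Z))"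
  shows "strip (F \<star> (Y \<star> Z)) = Z"
  using strip_eq[OF fcp_Omega_zmult[OF F Y] Z] ent by (simp add: zmult_assoc)

text \<open>The tower of the product descends to \<open>F \<star> V\<close>. If \<open>V\<close> is
  not finite, \<open>F\<close> merges with the leading factor of \<open>V\<close>, the next stage is
  \<open>strip V\<close>, and from there the tower of \<open>V\<close> takes over.\<close>

lemma strip_finite_zmult: assumes X: "X \<in> strip_finite" and V: "V \<in> strip_finite" shows "X \<star> V \<in> strip_finite"
proof -
  have b: "X \<in> bimult" "V \<in> bimult" "entire X" "entire V" using X V by (auto simp: strip_finite_def)
  note U = bimultD(1)[OF b(1)] bimultD(1)[OF b(2)]
  obtain F where F: "F \<in> fcp" "F \<in> tower strip X" using X by (auto simp: strip_finite_def)
  obtain G where G: "G \<in> fcp" "G \<in> tower strip V" using V by (auto simp: strip_finite_def)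
  have FV: "F \<star> V \<in> tower strip (X \<star> V)" by (rule tower_zmult[OF U(1) b(3,2,4) F(2)])
  have entXV: "entire (X \<star> V)" by (rule entire_zmult[OF U b(3,4)])
  have "\<exists>F\<in>fcp. F \<in> tower strip (X \<star> V)"
  proof (cases "V \<in> fcp")
    case True
    then show ?thesis using fcp_zmult[OF True F(1)] FV by blast
  next
    case False
    obtain Y where Y: "Y \<in> \<Omega>" "strip V \<in> U_nonneg n" "V = Y \<star> strip V"
      using strip_finite_strip[OF V False] by blast
    have ent: "entire (F \<star> V)" using tower_U_entire[OF bimultD(1)[OF zmult_bimult[OF b(1,2)]] entXV FV] by blast
    have "strip (F \<star> (Y \<star> strip V)) = strip V"
      using strip_fcp_zmult[OF F(1) Y(1,2)] ent Y(3) by simp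
    then have "strip V \<in> tower strip (X \<star> V)" using tower.step[OF FV] Y(3) by simp
    moreover have "G \<in> tower strip (strip V)"
      using strip.tower_split[OF G(2)] G(1) False by blast
    ultimately show ?thesis using tower_trans G(1) by blast
  qed
  then show ?thesis using zmult_bimult[OF b(1,2)] entXV by (simp add: strip_finite_def)
qed

text \<open>Up to a finite left factor every tail is a stage of the tower. If almost all factors are
  finite, a tail is finite or in \<Omega> and one more step suffices. Otherwise the stages pass
  below all tails and the tower ends at the identity.\<close>

lemma strip_finite_inf_prod: assumes Y: "\<And>k. Y k \<in> strip_finite" and lim: "has_right_inf_prod Y X" shows "X \<in> strip_finite"
proof -
  have Yb: "Y k \<in> bimult" "entire (Y k)" for k using Y by (auto simp: strip_finite_def)
  obtain T where T: "T 0 = X" "\<And>k. T k = Y k \<star> T (Suc k)" "\<And>k. T k \<in> bimult" "zmat_lim T zid"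
    "\<And>k. X = partial_prod Y k \<star> T k"
    using inf_prod_tails[OF Yb(1) lim] by metis
  note TU = bimultD(1)[OF T(3)]
  let ?P = "partial_prod Y"
  have XU: "X \<in> U_nonneg n" using TU[of 0] T(1) by simp
  have ent: "entire X" by (rule entire_tails[OF Yb TU T(4) XU T(5)])
  have P: "?P k \<in> strip_finite" for k by (induction k) (auto intro: strip_finite_zmult Y fcp_strip_finite zid_fcp)
  have Pb: "?P k \<in> bimult" "entire (?P k)" for k using P by (auto simp: strip_finite_def)
  note PU = bimultD(1)[OF Pb(1)]
  have entT: "entire (T k)" for k
  proof (rule entire_le[OF ent])
    have "T k \<le> ?P k \<star> T k" by (intro zmult_ge_right U_nonnegD[OF PU] U_nonnegD[OF TU])
    then show "T k \<le> X" using T(5)[of k] by simp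
  qed
  have mem: "\<exists>F\<in>fcp. F \<star> T k \<in> tower strip X" for k
  proof -
    obtain F where F: "F \<in> fcp" "F \<in> tower strip (?P k)" using P[of k] by (auto simp: strip_finite_def)
    have "F \<star> T k \<in> tower strip (?P k \<star> T k)"
      by (rule tower_zmult[OF PU Pb(2) T(3) entT F(2)])
    then show ?thesis using F(1) T(5)[of k] by auto
  qed
  have "\<exists>F\<in>fcp. F \<in> tower strip X"
  proof (cases "\<exists>m. \<forall>k\<ge>m. Y k \<in> fcp")
    case True
    then obtain m where m: "\<And>k. m \<le> k \<Longrightarrow> Y k \<in> fcp" by blast
    define Y' where "Y' k = Y (k + m)" for k
    have "partial_prod Y' k = zinv (?P m) \<star> ?P (k + m)" for k
    proof (induction k)
      case 0
      then show ?case using U_nonnegD(2)[OF PU] by simp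
    next
      case (Suc k)
      then show ?case by (simp add: Y'_def zmult_assoc)
    qed
    moreover have "(\<lambda>k. (zinv (?P m) \<star> ?P (k + m)) i j) \<longlonglongrightarrow> (zinv (?P m) \<star> X) i j" for i j
      using lim by (intro tendsto_zmult tendsto_const LIMSEQ_ignore_initial_segment)
        (auto simp: has_right_inf_prod_def zmat_lim_def)
    moreover have "zinv (?P m) \<star> X = T m"
      using U_nonnegD(2)[OF PU] U_nonnegD(2)[OF TU]
      by (subst T(5)[of m]) (simp add: zmult_assoc[symmetric])
    ultimately have "has_right_inf_prod Y' (T m)" by (simp add: has_right_inf_prod_def zmat_lim_def)
    then have Tm: "T m \<in> fcp \<or> T m \<in> \<Omega>" by (intro fcp_inf_prod[of Y']) (simp_all add: Y'_def m)
    obtain F where F: "F \<in> fcp" "F \<star> T m \<in> tower strip X" using mem by blast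
    from Tm show ?thesis
    proof
      assume "T m \<in> fcp"
      then show ?thesis using fcp_zmult F by blast
    next
      assume "T m \<in> \<Omega>"
      then have FT: "F \<star> T m \<in> \<Omega>" by (rule fcp_Omega_zmult[OF F(1)])
      have eq: "F \<star> T m \<star> zid = F \<star> T m" by (rule zmult_zid[OF AdmD(2)[OF OmegaD(2)[OF FT]]])
      have "strip (F \<star> T m \<star> zid) = zid"
        by (rule strip_eq[OF FT zid_U_nonneg]) (use AdmD(5)[OF OmegaD(2)[OF FT]] eq in simp)
      then have "zid \<in> tower strip X" using tower.step[OF F(2)] eq by simp
      then show ?thesis using zid_fcp by blast
    qed
  next
    case False
    \<comment> \<open>The bottom of the whole tower, which is itself a stage.\<close>
    have "\<exists>w. greatest_lower w (tower strip X)"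
    proof (rule zmat_glb_exists)
      show "tower strip X \<noteq> {}" using tower.base by blast
    qed (use tower_U_entire[OF XU ent] U_nonnegD(5) in blast)
    then obtain w where w: "greatest_lower w (tower strip X)" by blast
    have wt: "w \<in> tower strip X"
      by (rule tower.glb[of "tower strip X"]) (use w tower.base in auto)
    have dec: "T (Suc k) \<le> T k" for k
      unfolding T(2)[of k] by (intro zmult_ge_right U_nonnegD[OF bimultD(1)[OF Yb(1)]] U_nonnegD[OF TU])
    have "w \<le> T k" for k
    proof -
      obtain l where l: "k \<le> l" "Y l \<notin> fcp" using False by blast
      obtain V where V: "V \<in> \<Omega>" "strip (Y l) \<in> U_nonneg n" "Y l = V \<star> strip (Y l)"
        using strip_finite_strip[OF Y l(2)] by blast
      obtain F where F: "F \<in> fcp" "F \<star> T l \<in> tower strip X" using mem by blast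
      define W where "W = strip (Y l) \<star> T (Suc l)"
      have WU: "W \<in> U_nonneg n" unfolding W_def by (rule bimultD(3)[OF T(3) V(2)])
      have Tl: "T l = V \<star> W" using T(2)[of l] V(3) zmult_assoc W_def by metis
      \<comment> \<open>The finite factor \<open>F\<close> merges with \<open>V\<close>, so one
        stripping removes both and leaves a stage below \<open>T l\<close>.\<close>
      have "strip (F \<star> (V \<star> W)) = W"
        using tower_U_entire[OF XU ent F(2)] Tl by (intro strip_fcp_zmult F(1) V(1) WU) simp
      then have "W \<in> tower strip X" using tower.step[OF F(2)] Tl by simp
      then have "w \<le> W" by (rule greatest_lowerD(1)[OF w])
      also have "W \<le> T l"
        unfolding Tl by (intro zmult_ge_right U_nonnegD[OF Omega_U[OF V(1)]] U_nonnegD[OF WU])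
      also have "T l \<le> T k" using lift_Suc_antimono_le[of T k l] dec l(1) by blast
      finally show ?thesis .
    qed
    then have "w \<le> zid" by (rule zmat_lim_tails_le[OF T(4)])
    moreover have "zid \<le> w"
      using tower_U_entire[OF XU ent wt] U_nonnegD by (intro zid_le) auto
    ultimately have "w = zid" by simp
    then show ?thesis using wt zid_fcp by blast
  qed
  then show ?thesis using T(1) T(3)[of 0] ent by (simp add: strip_finite_def)
qed

lemma L_r_subset_strip_finite: "L_r n \<subseteq> strip_finite"
  unfolding L_r_def
proof (rule Inter_lower, intro CollectI conjI allI impI ballI)
  show "strip_finite \<subseteq> U_nonneg n" using bimultD(1) by (auto simp: strip_finite_def)
qed (auto intro: fcp_strip_finite chevalley_fcp strip_finite_zmult strip_finite_inf_prod)

end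

section \<open>Initial segments of well-orders\<close>

lemma well_order_facts:
  assumes "Well_order r"
  shows "a \<in> Field r \<Longrightarrow> (a, a) \<in> r" "(a, b) \<in> r \<Longrightarrow> (b, c) \<in> r \<Longrightarrow> (a, c) \<in> r"
    "a \<in> Field r \<Longrightarrow> b \<in> Field r \<Longrightarrow> (a, b) \<in> r \<or> (b, a) \<in> r"
    "(a, b) \<in> r \<Longrightarrow> (b, a) \<in> r \<Longrightarrow> a = b"
proof -
  interpret wo_rel r using assms by (simp add: wo_rel_def)
  show "a \<in> Field r \<Longrightarrow> (a, a) \<in> r" using REFL by (auto simp: refl_on_def)
  show "(a, b) \<in> r \<Longrightarrow> (b, c) \<in> r \<Longrightarrow> (a, c) \<in> r" using TRANS by (auto dest: transD)
  show "a \<in> Field r \<Longrightarrow> b \<in> Field r \<Longrightarrow> (a, b) \<in> r \<or> (b, a) \<in> r" using TOTALS by blast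
  show "(a, b) \<in> r \<Longrightarrow> (b, a) \<in> r \<Longrightarrow> a = b" using ANTISYM by (auto dest: antisymD)
qed

lemma ofilterD:
  assumes "Order_Relation.ofilter r A"
  shows "a \<in> A \<Longrightarrow> a \<in> Field r" "a \<in> A \<Longrightarrow> (b, a) \<in> r \<Longrightarrow> b \<in> A"
  using assms by (auto simp: Order_Relation.ofilter_def Order_Relation.under_def)

text \<open>The cases correspond to the three clauses of \<open>wo_partial_prods\<close>.\<close>

lemma ofilter_cases:
  assumes wo: "Well_order r" and A: "Order_Relation.ofilter r A"
  obtains "A = {}" | a where "a \<in> A" "A = under r a"
  | "A \<noteq> {}" "\<forall>a\<in>A. \<exists>b\<in>A. a \<noteq> b \<and> (a, b) \<in> r"
proof (cases "\<forall>a\<in>A. \<exists>b\<in>A. a \<noteq> b \<and> (a, b) \<in> r")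
  case nomax: True
  show thesis
  proof (cases "A = {}")
    case True
    then show thesis by (rule that(1))
  next
    case False
    then show thesis using nomax by (rule that(3))
  qed
next
  case False
  then obtain m where "m \<in> A" "\<forall>b\<in>A. m = b \<or> (m, b) \<notin> r" by auto
  then have m: "m \<in> A" "\<And>b. b \<in> A \<Longrightarrow> (m, b) \<in> r \<Longrightarrow> b = m" by auto
  have "A = under r m"
  proof
    show "A \<subseteq> under r m"
    proof
      fix b assume b: "b \<in> A"
      then have "(b, m) \<in> r \<or> (m, b) \<in> r"
        using well_order_facts(3)[OF wo] ofilterD(1)[OF A] m(1) by blast
      then show "b \<in> under r m"
        using m b well_order_facts(1)[OF wo ofilterD(1)[OF A b]] by (auto simp: under_def)
    qed
    show "under r m \<subseteq> A" using ofilterD(2)[OF A m(1)] by (auto simp: under_def)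
  qed
  with m(1) show thesis by (rule that(2))
qed

text \<open>Transfinite induction over the initial segments that contain \<open>B0\<close>. At a
  limit the hypothesis holds only eventually, because the early segments need not contain
  \<open>B0\<close>.\<close>

lemma ofilter_induct [consumes 4, case_names start succ limit]:
  assumes wo: "Well_order r" and B0: "Order_Relation.ofilter r B0"
    and B: "Order_Relation.ofilter r B" "B0 \<subseteq> B"
    and start: "Q B0"
    and succ: "\<And>a. a \<in> Field r \<Longrightarrow> B0 \<subseteq> underS r a \<Longrightarrow> Q (underS r a) \<Longrightarrow> Q (under r a)"
    and limit: "\<And>B. Order_Relation.ofilter r B \<Longrightarrow> B \<noteq> {} \<Longrightarrow>
      \<forall>a\<in>B. \<exists>b\<in>B. a \<noteq> b \<and> (a, b) \<in> r \<Longrightarrow> (\<exists>c\<in>B. \<forall>b\<in>B. (c, b) \<in> r \<longrightarrow> B0 \<subseteq> under r b \<and> Q (under r b)) \<Longrightarrow>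
      Q B"
  shows "Q B"
proof -
  have wr: "wo_rel r" using wo by (simp add: wo_rel_def)
  have sub: "Q B" if B: "Order_Relation.ofilter r B" "B0 \<subseteq> B"
    and IH: "\<And>b. b \<in> B \<Longrightarrow> B0 \<subseteq> under r b \<Longrightarrow> Q (under r b)" for B
  proof (cases "B = B0")
    case False
    from ofilter_cases[OF wo B(1)] show ?thesis
    proof cases
      case 3
      obtain c where c: "c \<in> B" "c \<notin> B0" using False B(2) by blast
      have "B0 \<subseteq> under r b" if b: "b \<in> B" "(c, b) \<in> r" for b
      proof
        fix x assume x: "x \<in> B0"
        have "(x, c) \<in> r \<or> (c, x) \<in> r"
          using well_order_facts(3)[OF wo] ofilterD(1)[OF B0 x] ofilterD(1)[OF B(1) c(1)] by blast
        then have "(x, c) \<in> r" using ofilterD(2)[OF B0 x] c(2) by blast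
        then show "x \<in> under r b" using well_order_facts(2)[OF wo] b(2) by (auto simp: under_def)
      qed
      then show ?thesis using limit[OF B(1) 3] IH c(1) by blast
    qed (use False B(2) IH in auto)
  qed (use start in simp)
  have "B0 \<subseteq> under r a \<longrightarrow> Q (under r a)" if "a \<in> Field r" for a
    using that
  proof (induction a rule: wo_rel.well_order_induct[OF wr])
    case (1 a)
    show ?case
    proof
      assume le: "B0 \<subseteq> under r a"
      show "Q (under r a)"
      proof (cases "a \<in> B0")
        case True
        then have "B0 = under r a" using le ofilterD(2)[OF B0] by (auto simp: under_def)
        then show ?thesis using start by simp
      next
        case False
        then have le': "B0 \<subseteq> underS r a" using le by (auto simp: under_def underS_def)
        have "Q (underS r a)"
        proof (rule sub[OF wo_rel.underS_ofilter[OF wr] le'])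
          fix b assume "b \<in> underS r a" "B0 \<subseteq> under r b"
          then show "Q (under r b)" using 1 by (auto simp: underS_def Field_def)
        qed
        then show ?thesis using succ[OF 1(2) le'] by blast
      qed
    qed
  qed
  then show ?thesis using sub[OF B] ofilterD(1)[OF B(1)] by blast
qed

lemma directed_ofilter:
  assumes wo: "Well_order r" and A: "Order_Relation.ofilter r A" and ab: "a \<in> A" "b \<in> A"
  shows "\<exists>c\<in>A. \<forall>d\<in>A. (c, d) \<in> r \<longrightarrow> (a, d) \<in> r \<and> (b, d) \<in> r"
  using well_order_facts(2,3)[OF wo] ofilterD(1)[OF A] ab by metis

lemma eventually_ofilter:
  assumes wo: "Well_order r" and A: "Order_Relation.ofilter r A" "A \<noteq> {}"
  shows "eventually P (INF a\<in>A. principal {b \<in> A. (a, b) \<in> r}) \<longleftrightarrow>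
    (\<exists>a\<in>A. \<forall>b\<in>A. (a, b) \<in> r \<longrightarrow> P b)"
  by (rule eventually_directed[OF A(2) directed_ofilter[OF wo A(1)]])

lemma ofilter_filter_neq_bot:
  assumes wo: "Well_order r" and A: "Order_Relation.ofilter r A" "A \<noteq> {}"
  shows "(INF a\<in>A. principal {b \<in> A. (a, b) \<in> r}) \<noteq> bot"
  by (rule directed_neq_bot[OF A(2) _ directed_ofilter[OF wo A(1)]])
    (use well_order_facts(1)[OF wo] ofilterD(1)[OF A(1)] in blast)+

context loop
begin

section \<open>Factorizations are determined by iterated stripping\<close>

text \<open>The remainder \<open>Z A\<close> after an initial segment \<open>A\<close> is a stage of
  the tower. Sending an index to the remainder just before its factor reverses the order and reaches
  every stage that is not fixed, so the index order and the factors are determined by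
  \<open>X\<close>.\<close>

lemma factorization_canonical:
  fixes r :: "'b rel"
  assumes X: "X \<in> U_nonneg n" "entire X" and fac: "Omega_factorization n r Y F X"
  shows "F \<in> tower strip X"
    "\<exists>g. bij_betw g (Field r) {Z \<in> tower strip X. strip Z \<noteq> Z} \<and>
      (\<forall>a\<in>Field r. \<forall>b\<in>Field r. (a, b) \<in> r \<longleftrightarrow> g b \<le> g a) \<and>
      (\<forall>a\<in>Field r. g a = Y a \<star> strip (g a))"
proof -
  let ?D = "tower strip X"
  let ?of = "Order_Relation.ofilter r"
  have wo: "Well_order r" and Y: "\<And>a. a \<in> Field r \<Longrightarrow> Y a \<in> \<Omega>" and F: "F \<in> fcp"
    using fac by (auto simp: Omega_factorization_def)
  obtain P where P: "wo_partial_prods r Y P" and XP: "X = P (Field r) \<star> F"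
    using fac by (auto simp: Omega_factorization_def has_wo_prod_def)
  have P0: "P {} = zid" and Psucc: "\<And>a. a \<in> Field r \<Longrightarrow> P (under r a) = P (underS r a) \<star> Y a"
    and Plim: "\<And>A i j. ?of A \<Longrightarrow> A \<noteq> {} \<Longrightarrow> (\<forall>a\<in>A. \<exists>b\<in>A. a \<noteq> b \<and> (a, b) \<in> r) \<Longrightarrow>
      ((\<lambda>b. P (under r b) i j) \<longlongrightarrow> P A i j) (INF a\<in>A. principal {b \<in> A. (a, b) \<in> r})"
    using P unfolding wo_partial_prods_def by blast+
  have wr: "wo_rel r" using wo by (simp add: wo_rel_def)
  have of0: "?of {}" by (simp add: Order_Relation.ofilter_def)
  have ofF: "?of (Field r)" by (rule wo_rel.Field_ofilter[OF wr])
  have ofu: "?of (under r a)" and ofs: "?of (underS r a)" for a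
    by (rule wo_rel.under_ofilter[OF wr], rule wo_rel.underS_ofilter[OF wr])
  have Pb: "P A \<in> bimult" if A: "?of A" for A
    using wo of0 A empty_subsetI
  proof (induction rule: ofilter_induct)
    case start
    then show ?case using P0 zid_bimult by simp
  next
    case (succ a)
    then show ?case using Psucc zmult_bimult OmegaD(1)[OF Y] by simp
  next
    case (limit B)
    show ?case
      by (rule bimult_limit[OF Plim[OF limit(1-3)] ofilter_filter_neq_bot[OF wo limit(1,2)]])
        (use limit(4) in \<open>auto simp: eventually_ofilter[OF wo limit(1,2)]\<close>)
  qed
  note uP = U_nonnegD(2)[OF bimultD(1)[OF Pb]]
  \<comment> \<open>The product of the factors between two initial segments; it makes remainders
    totally nonnegative and decreasing.\<close>
  have Qb: "zinv (P A) \<star> P B \<in> bimult" if A: "?of A" and B: "?of B" "A \<subseteq> B" for A B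
    using wo A B
  proof (induction rule: ofilter_induct)
    case start
    then show ?case using uP[OF A] zid_bimult by simp
  next
    case (succ a)
    then show ?case
      using zmult_bimult[OF succ(3) OmegaD(1)[OF Y[OF succ(1)]]] Psucc[OF succ(1)]
      by (simp add: zmult_assoc)
  next
    case (limit B)
    show ?case
      by (rule bimult_limit[OF tendsto_zmult[OF tendsto_const Plim[OF limit(1-3)]]
            ofilter_filter_neq_bot[OF wo limit(1,2)]])
        (use limit(4) in \<open>auto simp: eventually_ofilter[OF wo limit(1,2)]\<close>)
  qed
  define Z where "Z A = zinv (P A) \<star> X" for A
  have uX: "upper_unipotent X" using U_nonnegD(2)[OF X(1)] .
  have ZU: "Z A \<in> U_nonneg n" if A: "?of A" for A
  proof -
    have "Z A = (zinv (P A) \<star> P (Field r)) \<star> F" by (simp add: Z_def XP zmult_assoc)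
    moreover have "A \<subseteq> Field r" using ofilterD(1)[OF A] by blast
    ultimately show ?thesis
      using bimultD(2)[OF Qb[OF A ofF]] bimultD(1)[OF fcp_bimult[OF F]] by simp
  qed
  have Zdiff: "Z A = (zinv (P A) \<star> P B) \<star> Z B" if "?of B" for A B
    using uP[OF that] uX unfolding Z_def by (simp add: zmult_assoc) (simp add: zmult_assoc[symmetric])
  have Zle: "Z B \<le> Z A" if "?of A" "?of B" "A \<subseteq> B" for A B
    unfolding Zdiff[OF that(2), of A]
    by (intro zmult_ge_right U_nonnegD[OF bimultD(1)[OF Qb[OF that]]] U_nonnegD[OF ZU[OF that(2)]])
  have Z0: "Z {} = X" using uX by (simp add: Z_def P0)
  have ZF: "Z (Field r) = F"
  proof -
    have "Z (Field r) = (zinv (P (Field r)) \<star> P (Field r)) \<star> F" by (simp add: Z_def XP zmult_assoc)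
    then show ?thesis using uP[OF ofF] fcp_uu[OF F] by simp
  qed
  have entZ: "entire (Z A)" if "?of A" for A
    using Zle[OF of0 that] Z0 entire_le[OF X(2)] by simp
  have Zstep: "Z (underS r a) = Y a \<star> Z (under r a)" if a: "a \<in> Field r" for a
  proof -
    have "zinv (P (underS r a)) \<star> P (under r a) = Y a"
      using uP[OF ofs] Psucc[OF a] U_nonnegD(2)[OF Omega_U[OF Y[OF a]]]
      by (simp add: zmult_assoc[symmetric])
    then show ?thesis using Zdiff[OF ofu[of a], of "underS r a"] by simp
  qed
  have Zstrip: "strip (Z (underS r a)) = Z (under r a)" if a: "a \<in> Field r" for a
    unfolding Zstep[OF a]
    by (rule strip_eq[OF Y[OF a] ZU[OF ofu]]) (use entZ[OF ofs, of a] Zstep[OF a] in simp)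
  have Zglb: "greatest_lower (Z B) ((\<lambda>b. Z (under r b)) ` B)"
    if B: "?of B" "B \<noteq> {}" "\<forall>a\<in>B. \<exists>b\<in>B. a \<noteq> b \<and> (a, b) \<in> r" for B
    unfolding greatest_lower_def
  proof (intro conjI ballI allI impI)
    fix W assume "W \<in> (\<lambda>b. Z (under r b)) ` B"
    then obtain b where b: "b \<in> B" "W = Z (under r b)" by blast
    have "under r b \<subseteq> B" using ofilterD(2)[OF B(1) b(1)] by (auto simp: under_def)
    then show "Z B \<le> W" using Zle[OF ofu B(1)] b by simp
  next
    fix V assume V: "\<forall>W\<in>(\<lambda>b. Z (under r b)) ` B. V \<le> W"
    show "V \<le> Z B"
      unfolding le_fun_def
    proof (intro allI)
      fix i j
      let ?Fl = "INF a\<in>B. principal {b \<in> B. (a, b) \<in> r}"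
      have lim: "((\<lambda>b. Z (under r b) i j) \<longlongrightarrow> Z B i j) ?Fl"
        unfolding Z_def by (intro tendsto_zmult tendsto_zinv tendsto_const Plim B)
      have "V i j \<le> Z (under r b) i j" if "b \<in> B" for b using V that by (auto simp: le_fun_def)
      then have "\<forall>\<^sub>F b in ?Fl. V i j \<le> Z (under r b) i j"
        unfolding eventually_ofilter[OF wo B(1,2)] using B(2) by blast
      then show "V i j \<le> Z B i j"
        by (rule tendsto_lowerbound[OF lim _ ofilter_filter_neq_bot[OF wo B(1,2)]])
    qed
  qed
  have ZD: "Z A \<in> ?D" if A: "?of A" for A
    using wo of0 A empty_subsetI
  proof (induction rule: ofilter_induct)
    case start
    then show ?case using Z0 tower.base by simp
  next
    case (succ a)
    then show ?case using tower.step[OF succ(3)] Zstrip[OF succ(1)] by simp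
  next
    case (limit B)
    obtain c where c: "c \<in> B" "\<And>b. b \<in> B \<Longrightarrow> (c, b) \<in> r \<Longrightarrow> Z (under r b) \<in> ?D"
      using limit(4) by blast
    \<comment> \<open>Membership in the tower is known only from \<open>c\<close> on, so the bound
      is taken over this cofinal part.\<close>
    define C where "C = {b \<in> B. (c, b) \<in> r}"
    have "greatest_lower (Z B) ((\<lambda>b. Z (under r b)) ` C)"
      unfolding greatest_lower_def
    proof (intro conjI ballI allI impI)
      fix W assume "W \<in> (\<lambda>b. Z (under r b)) ` C"
      then show "Z B \<le> W" by (intro greatest_lowerD(1)[OF Zglb[OF limit(1-3)]]) (auto simp: C_def)
    next
      fix V assume V: "\<forall>W\<in>(\<lambda>b. Z (under r b)) ` C. V \<le> W"
      show "V \<le> Z B"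
      proof (rule greatest_lowerD(2)[OF Zglb[OF limit(1-3)]])
        fix W assume "W \<in> (\<lambda>b. Z (under r b)) ` B"
        then obtain b where b: "b \<in> B" "W = Z (under r b)" by blast
        have cF: "c \<in> Field r" "b \<in> Field r" using ofilterD(1)[OF limit(1)] b c by auto
        show "V \<le> W"
        proof (cases "(c, b) \<in> r")
          case True
          then show ?thesis using V b by (auto simp: C_def)
        next
          case False
          then have bc: "(b, c) \<in> r" using well_order_facts(3)[OF wo cF] by blast
          then have "under r b \<subseteq> under r c"
            using well_order_facts(2)[OF wo] by (auto simp: under_def)
          then have "Z (under r c) \<le> W" using Zle[OF ofu ofu] b by simp
          moreover have "c \<in> C" using c(1) well_order_facts(1)[OF wo cF(1)] by (simp add: C_def)
          then have "V \<le> Z (under r c)" using V by blast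
          ultimately show ?thesis by (rule order_trans[rotated])
        qed
      qed
    qed
    moreover have "C \<noteq> {}"
      using c(1) well_order_facts(1)[OF wo ofilterD(1)[OF limit(1) c(1)]] by (auto simp: C_def)
    moreover have "W \<in> ?D" if "W \<in> (\<lambda>b. Z (under r b)) ` C" for W
      using that c(2) by (auto simp: C_def)
    ultimately show ?case
      using tower.glb[of "(\<lambda>b. Z (under r b)) ` C" strip X "Z B"] by blast
  qed
  show FD: "F \<in> ?D" using ZD[OF ofF] ZF by simp
  define g where "g a = Z (underS r a)" for a
  have gD: "g a \<in> ?D" for a unfolding g_def by (rule ZD[OF ofs])
  have gstrip: "g a = Y a \<star> strip (g a)" "strip (g a) = Z (under r a)" if "a \<in> Field r" for a
    using Zstep[OF that] Zstrip[OF that] by (simp_all add: g_def)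
  have gne: "strip (g a) \<noteq> g a" if a: "a \<in> Field r" for a
    using Omega_zmult_neq[OF Y[OF a] ZU[OF ofu, of a]] gstrip[OF a] by metis
  have gless: "g b \<le> strip (g a) \<and> \<not> g a \<le> g b" if ab: "a \<in> Field r" "(a, b) \<in> r" "a \<noteq> b" for a b
  proof -
    have "under r a \<subseteq> underS r b"
      using well_order_facts(2,4)[OF wo] ab unfolding under_def underS_def by blast
    then have le: "g b \<le> strip (g a)" using Zle[OF ofu ofs] gstrip(2)[OF ab(1)] by (simp add: g_def)
    moreover have "\<not> g a \<le> g b"
    proof
      assume "g a \<le> g b"
      then have "g a \<le> strip (g a)" using le by (rule order_trans)
      then show False using strip_le[of "g a"] gne[OF ab(1)] by (simp add: order_antisym)
    qed
    ultimately show ?thesis ..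
  qed
  have gmono: "(a, b) \<in> r \<longleftrightarrow> g b \<le> g a" if ab: "a \<in> Field r" "b \<in> Field r" for a b
  proof
    assume "(a, b) \<in> r"
    then show "g b \<le> g a"
      using gless[OF ab(1)] strip_le[of "g a"] by (cases "a = b") (auto intro: order_trans)
  next
    assume le: "g b \<le> g a"
    show "(a, b) \<in> r"
    proof (rule ccontr)
      assume not: "(a, b) \<notin> r"
      then have "(b, a) \<in> r" "b \<noteq> a"
        using well_order_facts(1,3)[OF wo] ab by blast+
      then show False using gless[OF ab(2)] le by blast
    qed
  qed
  have inj: "inj_on g (Field r)"
  proof (rule inj_onI)
    fix a b assume ab: "a \<in> Field r" "b \<in> Field r" "g a = g b"
    then have "(a, b) \<in> r" "(b, a) \<in> r" using gmono by auto
    then show "a = b" by (rule well_order_facts(4)[OF wo])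
  qed
  have surj: "Z0 \<in> g ` Field r" if Z0: "Z0 \<in> ?D" "strip Z0 \<noteq> Z0" for Z0
  proof -
    \<comment> \<open>The indices whose remainder has not yet come down to \<open>Z0\<close>. The
      first index outside \<open>A\<close> has remainder \<open>Z0\<close>; if there is none,
      \<open>Z0\<close> is the fixed stage \<open>F\<close>.\<close>
    define A where "A = {a \<in> Field r. \<not> g a \<le> Z0}"
    have A: "?of A"
      unfolding Order_Relation.ofilter_def
    proof (intro conjI ballI)
      show "A \<subseteq> Field r" by (auto simp: A_def)
      fix a assume a: "a \<in> A"
      show "under r a \<subseteq> A"
      proof
        fix b assume "b \<in> under r a"
        then have ba: "(b, a) \<in> r" by (simp add: under_def)
        then have b: "b \<in> Field r" by (auto simp: Field_def)
        then have "g a \<le> g b" using gmono ba a by (simp add: A_def)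
        then show "b \<in> A" using a b by (auto simp: A_def intro: order_trans)
      qed
    qed
    have le: "Z0 \<le> Z (under r a)" if a: "a \<in> A" for a
    proof -
      have aF: "a \<in> Field r" "\<not> g a \<le> Z0" using a by (auto simp: A_def)
      then have "Z0 \<le> strip (g a)" using strip.tower_cases[OF gD[of a] Z0(1)] by blast
      then show ?thesis using gstrip(2)[OF aF(1)] by simp
    qed
    have ZA: "Z0 \<le> Z A"
      using ofilter_cases[OF wo A]
    proof cases
      case 1
      then show ?thesis using Z0(1) Z0 strip.tower_le[of Z0 X] \<open>Z {} = X\<close> by simp
    next
      case (2 a)
      then show ?thesis using le[OF 2(1)] by simp
    next
      case 3
      show ?thesis by (rule greatest_lowerD(2)[OF Zglb[OF A 3]]) (use le in blast)
    qed
    show ?thesis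
    proof (cases "A = Field r")
      case True
      then have "Z0 \<le> F" using ZA ZF by simp
      moreover have "F \<le> Z0" by (rule strip.tower_fixpoint_least[OF FD strip_fcp[OF F] Z0(1)])
      ultimately have "Z0 = F" by (rule order_antisym)
      then show ?thesis using Z0(2) strip_fcp[OF F] by simp
    next
      case False
      then obtain b where b: "b \<in> Field r" "A = underS r b" using wo_rel.ofilter_underS_Field[OF wr, of A] A by blast
      have "b \<notin> A" using b(2) by (simp add: underS_def)
      then have "g b \<le> Z0" using b(1) by (simp add: A_def)
      moreover have "Z0 \<le> g b" using ZA b(2) by (simp add: g_def)
      ultimately show ?thesis using b(1) by (metis image_eqI order_antisym)
    qed
  qed
  have "bij_betw g (Field r) {Z \<in> ?D. strip Z \<noteq> Z}"
    unfolding bij_betw_def using inj gD gne surj by blast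
  then show "\<exists>g. bij_betw g (Field r) {Z \<in> ?D. strip Z \<noteq> Z} \<and>
      (\<forall>a\<in>Field r. \<forall>b\<in>Field r. (a, b) \<in> r \<longleftrightarrow> g b \<le> g a) \<and>
      (\<forall>a\<in>Field r. g a = Y a \<star> strip (g a))"
    using gmono gstrip(1) by blast
qed

text \<open>Composing one enumeration of the stages with the inverse of the other gives the
  isomorphism; equal stages with equal cofactors have equal factors by cancellation.\<close>

lemma factorization_unique:
  fixes r :: "'a rel" and r' :: "'b rel"
  assumes X: "X \<in> U_nonneg n" "entire X"
    and fac: "Omega_factorization n r Y F X" and fac': "Omega_factorization n r' Y' F' X"
  shows "same_factors r Y r' Y' \<and> F' = F"
proof
  let ?D = "{Z \<in> tower strip X. strip Z \<noteq> Z}"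
  have F: "F \<in> fcp" "F' \<in> fcp" and Y: "\<And>a. a \<in> Field r \<Longrightarrow> Y a \<in> \<Omega>" "\<And>a. a \<in> Field r' \<Longrightarrow> Y' a \<in> \<Omega>"
    using fac fac' by (auto simp: Omega_factorization_def)
  note c = factorization_canonical[OF X fac] and c' = factorization_canonical[OF X fac']
  show "F' = F"
    using strip.tower_fixpoint_least[OF c(1) strip_fcp[OF F(1)] c'(1)]
      strip.tower_fixpoint_least[OF c'(1) strip_fcp[OF F(2)] c(1)] by simp
  obtain g where g: "bij_betw g (Field r) ?D"
    "\<And>a b. a \<in> Field r \<Longrightarrow> b \<in> Field r \<Longrightarrow> (a, b) \<in> r \<longleftrightarrow> g b \<le> g a"
    "\<And>a. a \<in> Field r \<Longrightarrow> g a = Y a \<star> strip (g a)" using c(2) by blast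
  obtain g' where g': "bij_betw g' (Field r') ?D"
    "\<And>a b. a \<in> Field r' \<Longrightarrow> b \<in> Field r' \<Longrightarrow> (a, b) \<in> r' \<longleftrightarrow> g' b \<le> g' a"
    "\<And>a. a \<in> Field r' \<Longrightarrow> g' a = Y' a \<star> strip (g' a)" using c'(2) by blast
  define f where "f = inv_into (Field r') g' \<circ> g"
  have f: "bij_betw f (Field r) (Field r')"
    unfolding f_def by (rule bij_betw_trans[OF g(1) bij_betw_inv_into[OF g'(1)]])
  have g'f: "g' (f a) = g a" if "a \<in> Field r" for a
    using bij_betw_inv_into_right[OF g'(1), of "g a"] bij_betwE[OF g(1)] that by (simp add: f_def)
  have fF: "f a \<in> Field r'" if "a \<in> Field r" for a using bij_betwE[OF f] that by blast
  have "BNF_Wellorder_Embedding.iso r r' f"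
    unfolding iso_iff2 using f g(2) g'(2)[OF fF fF] g'f by simp
  moreover have "Y' (f a) = Y a" if a: "a \<in> Field r" for a
  proof (rule zmult_right_cancel)
    have "g a \<in> tower strip X" using bij_betwE[OF g(1)] a by blast
    then have "strip (g a) \<in> U_nonneg n" using tower_U_entire[OF X] tower.step by blast
    then show "upper_unipotent (strip (g a))" by (rule U_nonnegD)
    show "upper_unipotent (Y' (f a))" by (rule U_nonnegD[OF Omega_U[OF Y(2)[OF fF[OF a]]]])
    show "upper_unipotent (Y a)" by (rule U_nonnegD[OF Omega_U[OF Y(1)[OF a]]])
    show "Y' (f a) \<star> strip (g a) = Y a \<star> strip (g a)"
      using g(3)[OF a] g'(3)[OF fF[OF a]] g'f[OF a] by simp
  qed
  ultimately show "same_factors r Y r' Y'" unfolding same_factors_def by blast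
qed

section \<open>Existence of factorizations\<close>

text \<open>Choose an entry that drops under \<open>strip\<close> and a rational number inside the
  drop. Drops of different stages in one entry are disjoint, so the choice is injective. This is why
  natural numbers suffice as indices.\<close>

lemma tower_nonfixed_countable:
  "\<exists>h :: zmat \<Rightarrow> nat. inj_on h {Z \<in> tower strip X. strip Z \<noteq> Z}"
proof -
  have "\<exists>x :: int \<times> int \<times> rat. strip Z (fst x) (fst (snd x)) < of_rat (snd (snd x)) \<and>
      of_rat (snd (snd x)) < Z (fst x) (fst (snd x))" if Z: "strip Z \<noteq> Z" for Z
  proof -
    obtain i j where "strip Z i j \<noteq> Z i j" using Z by (metis ext)
    moreover have "strip Z i j \<le> Z i j" using strip_le[of Z] by (simp add: le_fun_def)
    ultimately obtain q where "strip Z i j < of_rat q" "of_rat q < Z i j"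
      using of_rat_dense[of "strip Z i j" "Z i j"] by auto
    then show ?thesis by (intro exI[of _ "(i, j, q)"]) simp
  qed
  then obtain x :: "zmat \<Rightarrow> int \<times> int \<times> rat" where
    x: "\<And>Z. strip Z \<noteq> Z \<Longrightarrow> strip Z (fst (x Z)) (fst (snd (x Z))) < of_rat (snd (snd (x Z)))"
    "\<And>Z. strip Z \<noteq> Z \<Longrightarrow> of_rat (snd (snd (x Z))) < Z (fst (x Z)) (fst (snd (x Z)))"
    by metis
  have less: False
    if "Z \<in> tower strip X" "strip Z \<noteq> Z" "W \<in> tower strip X" "strip W \<noteq> W" "x Z = x W" "\<not> Z \<le> W" for Z W
  proof -
    have "W \<le> strip Z" using strip.tower_cases[OF that(1,3)] that(6) by blast
    then have "W (fst (x Z)) (fst (snd (x Z))) \<le> strip Z (fst (x Z)) (fst (snd (x Z)))"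
      by (simp add: le_fun_def)
    then show False using x(1)[OF that(2)] x(2)[OF that(4)] that(5) by simp
  qed
  have "inj_on x {Z \<in> tower strip X. strip Z \<noteq> Z}"
  proof (rule inj_onI)
    fix Z W assume "Z \<in> {Z \<in> tower strip X. strip Z \<noteq> Z}" "W \<in> {Z \<in> tower strip X. strip Z \<noteq> Z}" "x Z = x W"
    then have "Z \<le> W" "W \<le> Z" using less by (metis (mono_tags, lifting) mem_Collect_eq)+
    then show "Z = W" by (rule order_antisym)
  qed
  then have "inj_on (to_nat \<circ> x) {Z \<in> tower strip X. strip Z \<noteq> Z}"
    by (rule comp_inj_on) (rule inj_on_subset[OF inj_to_nat subset_UNIV])
  then show ?thesis by blast
qed

text \<open>The factors are read off the tower: each stage that is not fixed contributes the factor
  split off there.\<close>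

lemma factorization_exists:
  assumes "X \<in> strip_finite" shows "\<exists>(r :: nat rel) Y F. Omega_factorization n r Y F X"
proof -
  have X: "X \<in> U_nonneg n" "entire X" using assms bimultD(1) by (auto simp: strip_finite_def)
  obtain F where F: "F \<in> fcp" "F \<in> tower strip X" using assms by (auto simp: strip_finite_def)
  let ?D = "tower strip X"
  define Fl where "Fl = {Z \<in> ?D. strip Z \<noteq> Z}"
  obtain h :: "zmat \<Rightarrow> nat" where h: "inj_on h Fl"
    using tower_nonfixed_countable[of X] by (auto simp: Fl_def)
  define I where "I = h ` Fl"
  define \<kappa> where "\<kappa> = inv_into Fl h"
  have \<kappa>: "\<kappa> a \<in> Fl" "h (\<kappa> a) = a" if "a \<in> I" for a
    using that by (auto simp: \<kappa>_def I_def inv_into_into f_inv_into_f)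
  have \<kappa>h: "\<kappa> (h Z) = Z" "h Z \<in> I" if "Z \<in> Fl" for Z using h that by (auto simp: \<kappa>_def I_def)
  have \<kappa>D: "\<kappa> a \<in> ?D" "strip (\<kappa> a) \<noteq> \<kappa> a" if "a \<in> I" for a using \<kappa>[OF that] by (auto simp: Fl_def)
  have \<kappa>inj: "a = b" if "a \<in> I" "b \<in> I" "\<kappa> a = \<kappa> b" for a b using \<kappa> that by metis
  \<comment> \<open>The order of the tower is reversed: larger stages come first, so their factors
    stand further left.\<close>
  define r where "r = {(a, b). a \<in> I \<and> b \<in> I \<and> \<kappa> b \<le> \<kappa> a}"
  have Fr: "Field r = I" by (auto simp: r_def Field_def)
  have nn: "0 \<le> Z i j" if "Z \<in> ?D" for Z i j using tower_U_entire[OF X that] U_nonnegD(5) by blast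
  have glb_ex: "\<exists>w. greatest_lower w C" if "C \<subseteq> ?D" "C \<noteq> {}" for C
    using that nn by (intro zmat_glb_exists) auto
  have greatest: "\<exists>m\<in>B. \<forall>b\<in>B. b \<le> m" if "B \<subseteq> ?D" "B \<noteq> {}" for B
    using strip.tower_greatest[OF that glb_ex] by metis
  have wo: "Well_order r"
  proof -
    have "wf (r - Id)"
      unfolding wf_iff_ex_minimal
    proof (intro allI impI)
      fix B :: "nat set" assume "B \<noteq> {}"
      show "\<exists>z\<in>B. \<forall>y. (y, z) \<in> r - Id \<longrightarrow> y \<notin> B"
      proof (cases "B \<inter> I = {}")
        case True
        then show ?thesis using \<open>B \<noteq> {}\<close> by (auto simp: r_def)
      next
        case False
        then obtain m where m: "m \<in> \<kappa> ` (B \<inter> I)" "\<And>b. b \<in> \<kappa> ` (B \<inter> I) \<Longrightarrow> b \<le> m"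
          using greatest[of "\<kappa> ` (B \<inter> I)"] \<kappa>D by blast
        then obtain z where z: "z \<in> B" "z \<in> I" "m = \<kappa> z" by blast
        have "y \<notin> B" if "(y, z) \<in> r - Id" for y
        proof
          assume "y \<in> B"
          have y: "y \<in> I" "\<kappa> z \<le> \<kappa> y" "y \<noteq> z" using that by (auto simp: r_def)
          then have "\<kappa> y \<le> \<kappa> z" using m(2)[of "\<kappa> y"] z \<open>y \<in> B\<close> by blast
          then show False using y z \<kappa>inj[of y z] by (simp add: order_antisym)
        qed
        then show ?thesis using z(1) by blast
      qed
    qed
    moreover have "refl_on I r" by (auto simp: r_def refl_on_def)
    moreover have "trans r" by (rule transI) (auto simp: r_def intro: order_trans)
    moreover have "antisym r" by (rule antisymI) (auto simp: r_def intro: \<kappa>inj order_antisym)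
    moreover have "total_on I r" using strip.tower_linear \<kappa>D by (auto simp: r_def total_on_def)
    moreover have "r \<subseteq> I \<times> I" by (auto simp: r_def)
    ultimately show ?thesis unfolding Fr by (simp add: order_on_defs)
  qed
  \<comment> \<open>The remainder after a set \<open>A\<close> of factors is the greatest stage
    below all their cofactors. This treats the start, the successors, the limits and the end
    uniformly.\<close>
  define gz where "gz A W \<longleftrightarrow> W \<in> ?D \<and> (\<forall>a\<in>A. W \<le> strip (\<kappa> a)) \<and>
    (\<forall>V\<in>?D. (\<forall>a\<in>A. V \<le> strip (\<kappa> a)) \<longrightarrow> V \<le> W)" for A W
  define Z where "Z A = (THE W. gz A W)" for A
  have ZI: "Z A = W" if "gz A W" for A W
    unfolding Z_def by (rule the_equality[of "gz A", OF that]) (use that in \<open>auto simp: gz_def intro: order_antisym\<close>)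
  have Fleast: "F \<le> W" if "W \<in> ?D" for W
    by (rule strip.tower_fixpoint_least[OF F(2) strip_fcp[OF F(1)] that])
  have Z0: "Z {} = X"
    by (rule ZI) (auto simp: gz_def intro: tower.base strip.tower_le)
  have Zu: "Z (under r a) = strip (\<kappa> a)" if a: "a \<in> I" for a
  proof (rule ZI, unfold gz_def, intro conjI ballI impI)
    show "strip (\<kappa> a) \<in> ?D" by (rule tower.step[OF \<kappa>D(1)[OF a]])
    fix b assume "b \<in> under r a"
    then have b: "b \<in> I" "\<kappa> a \<le> \<kappa> b" by (auto simp: under_def r_def)
    show "strip (\<kappa> a) \<le> strip (\<kappa> b)"
    proof (cases "a = b")
      case False
      then have "\<not> \<kappa> b \<le> \<kappa> a" using b \<kappa>inj[OF a b(1)] by (auto intro: order_antisym)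
      then have "\<kappa> a \<le> strip (\<kappa> b)" using strip.tower_cases[OF \<kappa>D(1)[OF b(1)] \<kappa>D(1)[OF a]] by blast
      then show ?thesis using strip_le[of "\<kappa> a"] by (rule order_trans[rotated])
    qed simp
  next
    fix V assume "\<forall>b\<in>under r a. V \<le> strip (\<kappa> b)"
    moreover have "a \<in> under r a" using a by (simp add: under_def r_def)
    ultimately show "V \<le> strip (\<kappa> a)" by blast
  qed
  have Zs: "Z (underS r a) = \<kappa> a" if a: "a \<in> I" for a
  proof (rule ZI, unfold gz_def, intro conjI ballI impI)
    show "\<kappa> a \<in> ?D" by (rule \<kappa>D(1)[OF a])
    fix b assume "b \<in> underS r a"
    then have b: "b \<in> I" "\<kappa> a \<le> \<kappa> b" "b \<noteq> a" by (auto simp: underS_def r_def)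
    then have "\<not> \<kappa> b \<le> \<kappa> a" using \<kappa>inj[OF a b(1)] by (auto intro: order_antisym)
    then show "\<kappa> a \<le> strip (\<kappa> b)" using strip.tower_cases[OF \<kappa>D(1)[OF b(1)] \<kappa>D(1)[OF a]] by blast
  next
    fix V assume V: "V \<in> ?D" "\<forall>b\<in>underS r a. V \<le> strip (\<kappa> b)"
    show "V \<le> \<kappa> a"
    proof (rule ccontr)
      assume not: "\<not> V \<le> \<kappa> a"
      then have le: "\<kappa> a \<le> V" using strip.tower_linear[OF V(1) \<kappa>D(1)[OF a]] by blast
      show False
      proof (cases "strip V = V")
        case True
        then show False using strip.tower_fixpoint_least[OF V(1) True \<kappa>D(1)[OF a]] not by blast
      next
        case False
        then have VF: "V \<in> Fl" using V(1) by (simp add: Fl_def)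
        have "h V \<in> underS r a"
          using \<kappa>h[OF VF] a le not by (auto simp: underS_def r_def)
        then have "V \<le> strip V" using V(2) \<kappa>h(1)[OF VF] by metis
        then show False using strip_le[of V] False by (simp add: order_antisym)
      qed
    qed
  qed
  have ZF: "Z I = F"
  proof (rule ZI, unfold gz_def, intro conjI ballI impI)
    show "F \<in> ?D" by (rule F(2))
    show "F \<le> strip (\<kappa> a)" if "a \<in> I" for a by (rule Fleast[OF tower.step[OF \<kappa>D(1)[OF that]]])
    fix V assume V: "V \<in> ?D" "\<forall>b\<in>I. V \<le> strip (\<kappa> b)"
    show "V \<le> F"
    proof (cases "strip V = V")
      case True
      then show ?thesis by (rule strip.tower_fixpoint_least[OF V(1) _ F(2)])
    next
      case False
      then have VF: "V \<in> Fl" using V(1) by (simp add: Fl_def)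
      then have "V \<le> strip V" using V(2) \<kappa>h[OF VF] by metis
      then show ?thesis using strip_le[of V] False by (simp add: order_antisym)
    qed
  qed
  have Zlim: "((\<lambda>b. strip (\<kappa> b) i j) \<longlongrightarrow> Z A i j) (INF a\<in>A. principal {b \<in> A. (a, b) \<in> r})"
    if A: "Order_Relation.ofilter r A" "A \<noteq> {}" for A i j
  proof -
    have AI: "A \<subseteq> I" using ofilterD(1)[OF A(1)] Fr by blast
    have memD: "strip (\<kappa> b) \<in> ?D" if "b \<in> A" for b using tower.step[OF \<kappa>D(1)] AI that by blast
    obtain w where w: "greatest_lower w ((\<lambda>b. strip (\<kappa> b)) ` A)"
      using glb_ex[of "(\<lambda>b. strip (\<kappa> b)) ` A"] memD A(2) by blast
    have wD: "w \<in> ?D"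
      by (rule tower.glb[of "(\<lambda>b. strip (\<kappa> b)) ` A"]) (use w memD A(2) in auto)
    have "gz A w"
      unfolding gz_def
    proof (intro conjI ballI impI)
      show "w \<le> strip (\<kappa> a)" if "a \<in> A" for a using greatest_lowerD(1)[OF w] that by blast
      show "V \<le> w" if "\<forall>a\<in>A. V \<le> strip (\<kappa> a)" for V
        by (rule greatest_lowerD(2)[OF w]) (use that in blast)
    qed (rule wD)
    then have "Z A = w" by (rule ZI)
    have anti: "strip (\<kappa> b) \<le> strip (\<kappa> a)" if "a \<in> A" "b \<in> A" "(a, b) \<in> r" for a b
    proof -
      have ab: "a \<in> I" "b \<in> I" "\<kappa> b \<le> \<kappa> a" using that by (auto simp: r_def)
      show ?thesis
      proof (cases "a = b")
        case False
        then have "\<not> \<kappa> a \<le> \<kappa> b" using ab \<kappa>inj[OF ab(1,2)] by (auto intro: order_antisym)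
        then have "\<kappa> b \<le> strip (\<kappa> a)"
          using strip.tower_cases[OF \<kappa>D(1)[OF ab(1)] \<kappa>D(1)[OF ab(2)]] by blast
        then show ?thesis using strip_le[of "\<kappa> b"] by (rule order_trans[rotated])
      qed simp
    qed
    show ?thesis unfolding \<open>Z A = w\<close>
      by (rule tendsto_glb[OF w A(2) anti directed_ofilter[OF wo A(1)]])
  qed
  define Y where "Y a = (SOME V. V \<in> \<Omega> \<and> \<kappa> a = V \<star> strip (\<kappa> a))" for a
  have Y: "Y a \<in> \<Omega>" "\<kappa> a = Y a \<star> strip (\<kappa> a)" if a: "a \<in> I" for a
  proof -
    have "\<exists>V. V \<in> \<Omega> \<and> \<kappa> a = V \<star> strip (\<kappa> a)"
      by (cases rule: strip_cases[of "\<kappa> a"]) (use \<kappa>D(2)[OF a] in blast)+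
    from someI_ex[OF this] show "Y a \<in> \<Omega>" "\<kappa> a = Y a \<star> strip (\<kappa> a)" unfolding Y_def by blast+
  qed
  \<comment> \<open>The partial products are recovered from the remainders, so their continuity
    follows from that of \<open>zinv\<close>.\<close>
  define P where "P A = X \<star> zinv (Z A)" for A
  have uX: "upper_unipotent X" using U_nonnegD(2)[OF X(1)] .
  have uD: "upper_unipotent W" if "W \<in> ?D" for W using tower_U_entire[OF X that] U_nonnegD(2) by blast
  have "wo_partial_prods r Y P"
    unfolding wo_partial_prods_def Fr
  proof (intro conjI ballI allI impI)
    show "P {} = zid" using uX by (simp add: P_def Z0)
    fix a assume a: "a \<in> I"
    note u = uD[OF \<kappa>D(1)[OF a]] uD[OF tower.step[OF \<kappa>D(1)[OF a]]]
    have uY: "upper_unipotent (Y a)" using U_nonnegD(2)[OF Omega_U[OF Y(1)[OF a]]] .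
    have "zinv (\<kappa> a) \<star> Y a = zinv (strip (\<kappa> a))"
    proof (rule zmult_right_cancel[OF u(2)])
      have "zinv (\<kappa> a) \<star> Y a \<star> strip (\<kappa> a) = zinv (\<kappa> a) \<star> \<kappa> a"
        using Y(2)[OF a] zmult_assoc by metis
      then show "zinv (\<kappa> a) \<star> Y a \<star> strip (\<kappa> a) = zinv (strip (\<kappa> a)) \<star> strip (\<kappa> a)"
        using u by simp
    qed (use uY in simp_all)
    then show "P (under r a) = P (underS r a) \<star> Y a"
      by (simp add: P_def Zu[OF a] Zs[OF a] zmult_assoc)
  next
    fix A i j assume A: "Order_Relation.ofilter r A" "A \<noteq> {}"
    let ?G = "INF a\<in>A. principal {b \<in> A. (a, b) \<in> r}"
    have lim: "((\<lambda>b. (X \<star> zinv (strip (\<kappa> b))) i j) \<longlongrightarrow> P A i j) ?G"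
      unfolding P_def by (intro tendsto_zmult tendsto_zinv tendsto_const Zlim A)
    have "(X \<star> zinv (strip (\<kappa> b))) i j = P (under r b) i j" if "b \<in> A" for b
    proof -
      have "b \<in> I" using ofilterD(1)[OF A(1) that] Fr by blast
      then show ?thesis by (simp only: P_def Zu)
    qed
    then have "\<forall>\<^sub>F b in ?G. (X \<star> zinv (strip (\<kappa> b))) i j = P (under r b) i j"
      unfolding eventually_ofilter[OF wo A] using A(2) by blast
    then show "((\<lambda>b. P (under r b) i j) \<longlongrightarrow> P A i j) ?G"
      by (rule Lim_transform_eventually[OF lim])
  qed
  then have "has_wo_prod r Y (P I)" unfolding has_wo_prod_def Fr by blast
  moreover have "X = P I \<star> F"
    using uX fcp_uu[OF F(1)] by (simp add: P_def ZF zmult_assoc)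
  ultimately have "Omega_factorization n r Y F X"
    unfolding Omega_factorization_def Fr using wo Fr Y(1) F(1) by metis
  then show ?thesis by blast
qed

end

theorem theorem7p14:
  fixes n :: nat
  assumes "2 \<le> n"
  shows "(\<forall>X i t X'. X \<in> Omega n \<longrightarrow> 0 < t \<longrightarrow> X' \<in> U_nonneg n \<longrightarrow>
            X = chevalley n i t \<star> X' \<longrightarrow> X' \<in> Omega n) \<and>
         (\<forall>X\<in>L_r n. \<exists>(r :: nat rel) Y F. Omega_factorization n r Y F X \<and>
            (\<forall>(r' :: 'b rel) Y' F'. Omega_factorization n r' Y' F' X \<longrightarrow>
               same_factors r Y r' Y' \<and> F' = F)) \<and>
         (\<forall>X Y Z. X \<in> Omega n \<longrightarrow> Y \<in> Omega n \<longrightarrow> Z \<in> U_nonneg n \<longrightarrow>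
            X = Y \<star> Z \<longrightarrow> Z = zid)"
proof -
  interpret loop n by unfold_locales (rule assms)
  have "\<exists>(r :: nat rel) Y F. Omega_factorization n r Y F X \<and>
            (\<forall>(r' :: 'b rel) Y' F'. Omega_factorization n r' Y' F' X \<longrightarrow>
               same_factors r Y r' Y' \<and> F' = F)" if "X \<in> L_r n" for X
  proof -
    have X: "X \<in> strip_finite" using that L_r_subset_strip_finite by blast
    then have "X \<in> U_nonneg n" "entire X" using bimultD(1) by (auto simp: strip_finite_def)
    then show ?thesis using factorization_exists[OF X] factorization_unique by blast
  qed
  then show ?thesis using Omega_divide_chevalley Omega_no_divisor by blast
qed

end
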